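(* Let $n\ge 3$, $L>1$, $\theta\in(0,1)$, $C_0>0$. Let $\Omega\subset\mathbb{R}^n$ be a bounded $\theta$-admissible and $L$-uniform domain with $\operatorname{diam}(\Omega)\ge C_0$ and $0\in\partial\Omega$. Let $f\in L^2(\Omega)$ and $g\in C(\partial\Omega)$, and suppose that $u$ is a weak solution of $$-\Delta u=f\ \text{ in }\Omega,\qquad u=g\ \text{ on }\partial\Omega .$$ Then there exists $0<\alpha_0<1$ such that for all $0<\alpha<\alpha_0$: if $f$ is $C^{-2,\alpha}$ at $0$ in the $L^2$ sense and $g$ is $C^{\alpha}$ at $0$, then $u$ is $C^{\alpha}$ at $0$ in the $L^2$ sense, and $$[u]_{\mathcal{L}^{2,\alpha}(0)}\le C\left(\frac{1}{|B_1|}\int_{\Omega\cap B_1}u^2\,dx\right)^{1/2}+C\left([f]_{\mathcal{L}^{2,-2+\alpha}(0)}+\|g\|_{C^{\alpha}(0)}\right),$$ where $C$ is a constant depending only on $n,\alpha,L,\theta,C_0$.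
   Context: Notation: $B_r(x_0)$ is the open ball of radius $r$ centred at $x_0$, $B_r=B_r(0)$; $v^+=\max(v,0)$, $v^-=\max(-v,0)$. $L$-uniform domain ($L>1$): a domain $\Omega\subset\mathbb{R}^n$ such that for any $x_1,x_2\in\Omega$ there is a rectifiable curve $\gamma:[0,1]\to\Omega$ with $\gamma(0)=x_1$, $\gamma(1)=x_2$, $\mathcal{H}^1(\gamma)\le L|x_1-x_2|$, and $d(\gamma(t),\partial\Omega)\ge \frac1L\min\{|\gamma(t)-x_1|,|\gamma(t)-x_2|\}$ for all $t\in[0,1]$. $\theta$-admissible domain ($\theta\in(0,1)$): a bounded domain $\Omega$ with $|\Omega^c\cap B_r(x_0)|\ge\theta|B_r|$ for every $x_0\in\partial\Omega$ and $0<r<\operatorname{diam}(\Omega)$. Weak solution: $f$ is extended by zero to $\Omega^c$. A function $u$ is a weak solution of $-\Delta u=f$ in $\Omega$, $u=g$ on $\partial\Omega$ if (i) $u\in H^1_{loc}(\Omega)$ and $\int_\Omega\nabla u\cdot\nabla\varphi\,dx=\int_\Omega f\varphi\,dx$ for all $\varphi\in C_0^\infty(\Omega)$; (ii) for any $0<r\le\operatorname{diam}(\Omega)$ and $x_0\in\partial\Omega$, the extension by $0$ to $B_r(x_0)\cap\Omega^c$ of $(u-\sup_{B_r(x_0)\cap\partial\Omega}g)^+$ is in $H^1(B_r(x_0))$ and satisfies $\int_{B_r(x_0)}\nabla[(u-\sup_{B_r(x_0)\cap\partial\Omega}g)^+]\cdot\nabla\varphi\,dx\le\int_{B_r(x_0)}f^+\varphi\,dx$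 for all $\varphi\in C_0^\infty(B_r(x_0))$, $\varphi\ge0$; (iii) for any $0<r\le\operatorname{diam}(\Omega)$ and $x_0\in\partial\Omega$, the extension by $0$ to $B_r(x_0)\cap\Omega^c$ of $(u-\inf_{B_r(x_0)\cap\partial\Omega}g)^-$ is in $H^1(B_r(x_0))$ and satisfies $\int_{B_r(x_0)}\nabla[(u-\inf_{B_r(x_0)\cap\partial\Omega}g)^-]\cdot\nabla\varphi\,dx\le\int_{B_r(x_0)}f^-\varphi\,dx$ for all $\varphi\in C_0^\infty(B_r(x_0))$, $\varphi\ge0$. Pointwise regularity at $0\in\partial\Omega$ ($0<\alpha<1$): $f$ is $C^{-2,\alpha}$ at $0$ in the $L^2$ sense if $[f]_{\mathcal{L}^{2,-2+\alpha}(0)}:=\sup_{0<r<1}\frac{1}{r^{-2+\alpha}}\left(\frac{1}{|B_r|}\int_{\Omega\cap B_r}|f|^2dx\right)^{1/2}<\infty$. $u$ is $C^\alpha$ at $0$ in the $L^2$ sense if $[u]_{\mathcal{L}^{2,\alpha}(0)}:=\inf_{P}\sup_{0<r<1}\frac{1}{r^{\alpha}}\left(\frac{1}{|B_r|}\int_{\Omega\cap B_r}|u-P|^2dx\right)^{1/2}<\infty$, the infimum being over constants $P$. $g$ is $C^\alpha$ at $0$ if $[g]_{C^\alpha(0)}:=\sup_{x\in\partial\Omega\cap B_1\setminus\{0\}}\frac{|g(x)-g(0)|}{|x|^\alpha}<\infty$, and $\|g\|_{C^\alpha(0)}:=|g(0)|+[g]_{C^\alpha(0)}$. *)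

theory Defs
  imports "HOL-Analysis.Analysis"
begin

definition domain :: "'a::euclidean_space set \<Rightarrow> bool" where
  "domain \<Omega> \<longleftrightarrow> open \<Omega> \<and> connected \<Omega> \<and> \<Omega> \<noteq> {}"

text \<open>One-dimensional Hausdorff measure. In dimension one the usual normalising factor
  is 1, so the sum is over the diameters themselves. Boundedness of the covering sets is required
  because \<^const>\<open>diameter\<close> is meaningless for unbounded sets.\<close>

definition hausdorff1_pre :: "real \<Rightarrow> 'a::metric_space set \<Rightarrow> ennreal" where
  "hausdorff1_pre \<delta> A =
     (INF E\<in>{E :: nat \<Rightarrow> 'a set. A \<subseteq> (\<Union>i. E i) \<and> (\<forall>i. bounded (E i) \<and> diameter (E i) \<le> \<delta>)}.
        \<Sum>i. ennreal (diameter (E i)))"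

definition hausdorff1 :: "'a::metric_space set \<Rightarrow> ennreal" where
  "hausdorff1 A = (SUP \<delta>\<in>{0<..}. hausdorff1_pre \<delta> A)"

definition rectifiable_path :: "(real \<Rightarrow> 'a::real_normed_vector) \<Rightarrow> bool" where
  "rectifiable_path \<gamma> \<longleftrightarrow> path \<gamma> \<and>
     (\<exists>M. \<forall>(t :: nat \<Rightarrow> real) n. mono t \<and> range t \<subseteq> {0..1} \<longrightarrow>
        (\<Sum>i<n. dist (\<gamma> (t i)) (\<gamma> (t (Suc i)))) \<le> M)"

text \<open>Only used for bounded domains, whose frontier is nonempty, so that
  \<^const>\<open>infdist\<close> (which is 0 for the empty set) is the genuine distance.\<close>

definition uniform_domain :: "real \<Rightarrow> 'a::euclidean_space set \<Rightarrow> bool" where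
  "uniform_domain L \<Omega> \<longleftrightarrow> domain \<Omega> \<and>
     (\<forall>x\<^sub>1\<in>\<Omega>. \<forall>x\<^sub>2\<in>\<Omega>. \<exists>\<gamma>. rectifiable_path \<gamma> \<and> path_image \<gamma> \<subseteq> \<Omega> \<and>
        pathstart \<gamma> = x\<^sub>1 \<and> pathfinish \<gamma> = x\<^sub>2 \<and>
        hausdorff1 (path_image \<gamma>) \<le> ennreal (L * norm (x\<^sub>1 - x\<^sub>2)) \<and>
        (\<forall>t\<in>{0..1}. infdist (\<gamma> t) (frontier \<Omega>)
            \<ge> 1 / L * min (norm (\<gamma> t - x\<^sub>1)) (norm (\<gamma> t - x\<^sub>2))))"

definition admissible_domain :: "real \<Rightarrow> 'a::euclidean_space set \<Rightarrow> bool" where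
  "admissible_domain \<theta> \<Omega> \<longleftrightarrow> domain \<Omega> \<and> bounded \<Omega> \<and>
     (\<forall>x\<^sub>0\<in>frontier \<Omega>. \<forall>r. 0 < r \<and> r < diameter \<Omega> \<longrightarrow>
        measure lebesgue (- \<Omega> \<inter> ball x\<^sub>0 r) \<ge> \<theta> * measure lebesgue (ball x\<^sub>0 r))"

primrec Ck :: "nat \<Rightarrow> ('a::euclidean_space \<Rightarrow> real) \<Rightarrow> bool" where
  "Ck 0 \<phi> \<longleftrightarrow> continuous_on UNIV \<phi>"
| "Ck (Suc k) \<phi> \<longleftrightarrow> (\<forall>x. \<phi> differentiable (at x)) \<and>
     (\<forall>b\<in>Basis. Ck k (\<lambda>x. frechet_derivative \<phi> (at x) b))"

definition test_functions :: "'a::euclidean_space set \<Rightarrow> ('a \<Rightarrow> real) set" where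
  "test_functions U = {\<phi>. (\<forall>k. Ck k \<phi>) \<and>
     compact (closure {x. \<phi> x \<noteq> 0}) \<and> closure {x. \<phi> x \<noteq> 0} \<subseteq> U}"

definition grad :: "('a::euclidean_space \<Rightarrow> real) \<Rightarrow> 'a \<Rightarrow> 'a" where
  "grad \<phi> x = (\<Sum>b\<in>Basis. frechet_derivative \<phi> (at x) b *\<^sub>R b)"

definition L2_on :: "'a::euclidean_space set \<Rightarrow> ('a \<Rightarrow> 'b::euclidean_space) \<Rightarrow> bool" where
  "L2_on U h \<longleftrightarrow> set_borel_measurable lebesgue U h \<and>
     set_integrable lebesgue U (\<lambda>x. (norm (h x))\<^sup>2)"

definition L2_loc :: "'a::euclidean_space set \<Rightarrow> ('a \<Rightarrow> 'b::euclidean_space) \<Rightarrow> bool" where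
  "L2_loc U h \<longleftrightarrow> (\<forall>K. compact K \<and> K \<subseteq> U \<longrightarrow> L2_on K h)"

definition weak_gradient ::
    "'a::euclidean_space set \<Rightarrow> ('a \<Rightarrow> real) \<Rightarrow> ('a \<Rightarrow> 'a) \<Rightarrow> bool" where
  "weak_gradient U u G \<longleftrightarrow> (\<forall>\<phi>\<in>test_functions U. \<forall>b\<in>Basis.
     (LINT x:U|lebesgue. u x * (grad \<phi> x \<bullet> b)) = - (LINT x:U|lebesgue. (G x \<bullet> b) * \<phi> x))"

text \<open>The weak gradient, unique almost everywhere, is carried as an argument:
  \<open>H1_with_gradient U u G\<close> says that \<open>u\<close> is in \<open>H\<^sup>1(U)\<close> with \<open>\<nabla>u = G\<close>.\<close>

definition H1_with_gradient ::
    "'a::euclidean_space set \<Rightarrow> ('a \<Rightarrow> real) \<Rightarrow> ('a \<Rightarrow> 'a) \<Rightarrow> bool" where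
  "H1_with_gradient U u G \<longleftrightarrow> L2_on U u \<and> L2_on U G \<and> weak_gradient U u G"

definition H1_loc_with_gradient ::
    "'a::euclidean_space set \<Rightarrow> ('a \<Rightarrow> real) \<Rightarrow> ('a \<Rightarrow> 'a) \<Rightarrow> bool" where
  "H1_loc_with_gradient U u G \<longleftrightarrow> L2_loc U u \<and> L2_loc U G \<and> weak_gradient U u G"

definition zero_ext :: "'a set \<Rightarrow> ('a \<Rightarrow> real) \<Rightarrow> 'a \<Rightarrow> real" where
  "zero_ext \<Omega> h x = (if x \<in> \<Omega> then h x else 0)"

definition pos_part :: "real \<Rightarrow> real" where "pos_part v = max v 0"

definition neg_part :: "real \<Rightarrow> real" where "neg_part v = max (- v) 0"

text \<open>The real-valued \<^const>\<open>Sup\<close> and \<^const>\<open>Inf\<close> are genuine here: the index set contains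
  the centre, and \<open>g\<close> is bounded, being continuous on the compact boundary of a bounded domain.\<close>

definition weak_solution ::
    "'a::euclidean_space set \<Rightarrow> ('a \<Rightarrow> real) \<Rightarrow> ('a \<Rightarrow> real) \<Rightarrow> ('a \<Rightarrow> real) \<Rightarrow> bool" where
  "weak_solution \<Omega> f g u \<longleftrightarrow>
     (\<exists>G. H1_loc_with_gradient \<Omega> u G \<and>
        (\<forall>\<phi>\<in>test_functions \<Omega>.
           (LINT x:\<Omega>|lebesgue. G x \<bullet> grad \<phi> x) = (LINT x:\<Omega>|lebesgue. f x * \<phi> x))) \<and>
     (\<forall>r x\<^sub>0. 0 < r \<and> r \<le> diameter \<Omega> \<and> x\<^sub>0 \<in> frontier \<Omega> \<longrightarrow>
        (\<exists>G. H1_with_gradient (ball x\<^sub>0 r)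
               (zero_ext \<Omega> (\<lambda>x. pos_part (u x - (SUP y\<in>ball x\<^sub>0 r \<inter> frontier \<Omega>. g y)))) G \<and>
           (\<forall>\<phi>\<in>test_functions (ball x\<^sub>0 r). (\<forall>x. \<phi> x \<ge> 0) \<longrightarrow>
              (LINT x:ball x\<^sub>0 r|lebesgue. G x \<bullet> grad \<phi> x)
                \<le> (LINT x:ball x\<^sub>0 r|lebesgue. pos_part (zero_ext \<Omega> f x) * \<phi> x)))) \<and>
     (\<forall>r x\<^sub>0. 0 < r \<and> r \<le> diameter \<Omega> \<and> x\<^sub>0 \<in> frontier \<Omega> \<longrightarrow>
        (\<exists>G. H1_with_gradient (ball x\<^sub>0 r)
               (zero_ext \<Omega> (\<lambda>x. neg_part (u x - (INF y\<in>ball x\<^sub>0 r \<inter> frontier \<Omega>. g y)))) G \<and>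
           (\<forall>\<phi>\<in>test_functions (ball x\<^sub>0 r). (\<forall>x. \<phi> x \<ge> 0) \<longrightarrow>
              (LINT x:ball x\<^sub>0 r|lebesgue. G x \<bullet> grad \<phi> x)
                \<le> (LINT x:ball x\<^sub>0 r|lebesgue. neg_part (zero_ext \<Omega> f x) * \<phi> x))))"

text \<open>All seminorms take values in \<^typ>\<open>ennreal\<close>, so that ``is finite'' is a real condition.\<close>

definition ennreal_sqrt :: "ennreal \<Rightarrow> ennreal" where
  "ennreal_sqrt a = (if a = \<infinity> then \<infinity> else ennreal (sqrt (enn2real a)))"

text \<open>The average is over the full ball, although the integral is over \<open>\<Omega> \<inter> B\<^sub>r\<close> only.\<close>

definition L2_mean :: "'a::euclidean_space set \<Rightarrow> real \<Rightarrow> ('a \<Rightarrow> real) \<Rightarrow> ennreal" where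
  "L2_mean \<Omega> r h = ennreal_sqrt
     ((\<integral>\<^sup>+x\<in>\<Omega> \<inter> ball 0 r. ennreal (\<bar>h x\<bar>\<^sup>2) \<partial>lebesgue) / emeasure lebesgue (ball (0::'a) r))"

definition seminorm_f :: "'a::euclidean_space set \<Rightarrow> real \<Rightarrow> ('a \<Rightarrow> real) \<Rightarrow> ennreal" where
  "seminorm_f \<Omega> \<alpha> f = (SUP r\<in>{0<..<1}. ennreal (1 / r powr (- 2 + \<alpha>)) * L2_mean \<Omega> r f)"

definition seminorm_u :: "'a::euclidean_space set \<Rightarrow> real \<Rightarrow> ('a \<Rightarrow> real) \<Rightarrow> ennreal" where
  "seminorm_u \<Omega> \<alpha> u =
     (INF P::real. SUP r\<in>{0<..<1}. ennreal (1 / r powr \<alpha>) * L2_mean \<Omega> r (\<lambda>x. u x - P))"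

definition seminorm_g :: "'a::euclidean_space set \<Rightarrow> real \<Rightarrow> ('a \<Rightarrow> real) \<Rightarrow> ennreal" where
  "seminorm_g \<Omega> \<alpha> g =
     (SUP x\<in>frontier \<Omega> \<inter> ball 0 1 - {0}. ennreal (\<bar>g x - g 0\<bar> / norm x powr \<alpha>))"

definition norm_g :: "'a::euclidean_space set \<Rightarrow> real \<Rightarrow> ('a \<Rightarrow> real) \<Rightarrow> ennreal" where
  "norm_g \<Omega> \<alpha> g = ennreal \<bar>g 0\<bar> + seminorm_g \<Omega> \<alpha> g"

end

theory Submission
  imports Defs
begin

text \<open>
  The truncations \<open>(u - sup g)\<^sup>+\<close> and \<open>(u - inf g)\<^sup>-\<close> over \<open>B\<^sub>r\<close>, extended by zero, are nonnegative weak
  subsolutions \<open>v\<close> in the full ball \<open>B\<^sub>r\<close>. Testing with rescaled smooth bumps gives the mean value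
  inequality \<open>v(x) \<le> (average of v over B\<^sub>s(x)) + (K * |f|)(x)\<close> for almost every \<open>x\<close> in \<open>B\<^bsub>\<delta>r\<^esub>\<close>, where
  \<open>s = (1 - \<delta>) r\<close> and the nonnegative kernel \<open>K\<close> has mass of order \<open>r\<^sup>2\<close>. As \<open>v\<close> vanishes on a portion
  \<open>\<theta>\<close> of \<open>B\<^sub>r\<close>, the Cauchy-Schwarz inequality bounds the square of the average by about \<open>1 - \<theta>\<close> times
  the mean of \<open>v\<^sup>2\<close> over \<open>B\<^sub>r\<close>, and the convolution term is controlled in \<open>L\<^sup>2\<close> by Young's inequality.
  For small \<open>\<delta>\<close> the mean square of \<open>(u - g(0))\<^sup>\<plusminus>\<close> therefore contracts by a fixed factor from \<open>B\<^sub>r\<close> to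
  \<open>B\<^bsub>\<delta>r\<^esub>\<close>, up to an error of order \<open>r\<^bsup>2\<alpha>\<^esup>\<close>, and iterating gives the decay with \<open>P = g(0)\<close>.
\<close>

subsection \<open>A smooth cutoff\<close>

text \<open>The factor \<open>1 - \<theta>\<close> is the whole gain, so the mean value inequality
  has to hold with a constant arbitrarily close to 1; a bound with some large constant would lose
  the contraction. Subsolutions, however, may only be tested with smooth compactly supported
  functions. Hence the explicit radial family: \<open>cutoff K\<close> tends to the indicator of the
  unit ball as \<open>K\<close> grows, and it is -2 times the derivative of the profile
  \<open>bump K 0\<close> that is actually tested. The link is that the derivative in
  \<open>t\<close> of \<open>cutoff K (|z|^2 / t^2) / t^N\<close> equals \<open>t^(1-N)\<close>
  times the Laplacian of \<open>bump K 0 (|z|^2 / t^2)\<close>. All losses hang on the single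
  parameter \<delta>: the inner radius \<delta> r, the steepness \<open>K = 1 / \<delta>^2\<close>,
  and the weight in two estimates of the square of a sum. Together they cost the factor
  \<open>(1 + \<delta>)^2 / (1 - \<delta>)^(4 N + 2)\<close>, which tends to 1 as \<delta> tends to
  0. The pointwise inequality of the overview is realised as an inequality between measures:
  averages over shrinking balls are compared on open sets by Fatou's lemma, outer regularity extends
  this to Borel sets, and the result is integrated against \<open>v\<close> itself.\<close>

definition flat_exp :: "real poly \<Rightarrow> real \<Rightarrow> real" where
  "flat_exp P t = (if t > 0 then poly P (1 / t) * exp (- (1 / t)) else 0)"

text \<open>With \<open>w = 1 / t\<close>, differentiating \<open>P(w) * exp (- w)\<close> in
  \<open>t\<close> gives \<open>w\<^sup>2 * (P - P')(w) * exp (- w)\<close>; the two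
  \<open>pCons 0\<close> supply \<open>w\<^sup>2\<close>. The family is thus closed under
  differentiation, and smoothness at 0 comes down to a single limit.\<close>

definition flat_deriv :: "real poly \<Rightarrow> real poly" where
  "flat_deriv P = pCons 0 (pCons 0 (P - pderiv P))"

text \<open>The antiderivative of the member with polynomial \<open>1 + X\<close>. The factor
  \<open>t\<close> in front of the classical \<open>exp (- 1 / t)\<close> makes the slope tend to 1
  at infinity, so that the slope can imitate an indicator.\<close>

definition flat_id :: "real \<Rightarrow> real" where
  "flat_id t = (if t > 0 then t * exp (- (1 / t)) else 0)"

lemma tendsto_poly_exp_minus: "((\<lambda>w. poly P w * exp (- w)) \<longlongrightarrow> (0::real)) at_top"
proof -
  have "((\<lambda>w. \<Sum>i\<le>degree P. coeff P i * (w ^ i / exp w)) \<longlongrightarrow> (\<Sum>i\<le>degree P. coeff P i * 0)) at_top"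
    by (intro tendsto_sum tendsto_mult tendsto_const tendsto_power_div_exp_0)
  then show ?thesis
    by (simp add: poly_altdef sum_distrib_left exp_minus divide_inverse mult_ac)
qed

lemma tendsto_poly_inverse_exp_right:
  "((\<lambda>t. poly P (1 / t) * exp (- (1 / t))) \<longlongrightarrow> (0::real)) (at_right 0)"
  using filterlim_compose[OF tendsto_poly_exp_minus[of P] filterlim_inverse_at_top_right]
  by (simp add: inverse_eq_divide)

lemma DERIV_0_from_right:
  fixes g :: "real \<Rightarrow> real"
  assumes "((\<lambda>t. g t / t) \<longlongrightarrow> 0) (at_right 0)" and "\<And>t. t \<le> 0 \<Longrightarrow> g t = 0"
  shows "(g has_real_derivative 0) (at 0)"
proof -
  have "((\<lambda>t. g t / t) \<longlongrightarrow> 0) (at_left 0)"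
    by (rule tendsto_eventually) (auto simp: eventually_at_left_field assms(2) intro!: exI[of _ "-1"])
  then have "((\<lambda>t. g t / t) \<longlongrightarrow> 0) (at 0)"
    using assms(1) by (simp add: filterlim_split_at)
  then show ?thesis
    using assms(2)[of 0] by (simp add: DERIV_def)
qed

lemma DERIV_eq_on_open:
  fixes g h :: "real \<Rightarrow> real"
  assumes "(h has_real_derivative d) (at t)" "open S" "t \<in> S" "\<And>s. s \<in> S \<Longrightarrow> g s = h s"
  shows "(g has_real_derivative d) (at t)"
  using assms(1) has_field_derivative_transform_within_open[OF _ assms(2,3)] assms(4) by metis

lemma flat_exp_deriv: "(flat_exp P has_real_derivative flat_exp (flat_deriv P) t) (at t)"
proof -
  consider "t > 0" | "t < 0" | "t = 0" by linarith
  then show ?thesis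
  proof cases
    case 1
    have "((\<lambda>t. poly P (1 / t) * exp (- (1 / t))) has_real_derivative
            flat_exp (flat_deriv P) t) (at t)"
      using 1 by (auto intro!: derivative_eq_intros DERIV_chain2[OF poly_DERIV]
          simp: flat_exp_def flat_deriv_def power2_eq_square field_simps)
    then show ?thesis
      by (rule DERIV_eq_on_open[of _ _ _ "{0<..}"]) (use 1 in \<open>auto simp: flat_exp_def\<close>)
  next
    case 2
    have "((\<lambda>t. 0) has_real_derivative flat_exp (flat_deriv P) t) (at t)"
      using 2 by (simp add: flat_exp_def)
    then show ?thesis
      by (rule DERIV_eq_on_open[of _ _ _ "{..<0}"]) (use 2 in \<open>auto simp: flat_exp_def\<close>)
  next
    case 3
    \<comment> \<open>Dividing by \<open>t\<close> multiplies the polynomial in \<open>1 / t\<close>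
      by its variable: the difference quotient at 0 is again in the family and tends to 0.\<close>
    have ev: "\<forall>\<^sub>F t in at_right 0. flat_exp P t / t = poly (pCons 0 P) (1 / t) * exp (- (1 / t))"
      by (auto simp: eventually_at_right_field flat_exp_def intro!: exI[of _ 1])
    have "((\<lambda>t. flat_exp P t / t) \<longlongrightarrow> 0) (at_right 0)"
      using tendsto_poly_inverse_exp_right[of "pCons 0 P"] tendsto_cong[OF ev] by simp
    then have "(flat_exp P has_real_derivative 0) (at 0)"
      by (rule DERIV_0_from_right) (simp add: flat_exp_def)
    then show ?thesis
      using 3 by (simp add: flat_exp_def)
  qed
qed

lemma flat_id_deriv: "(flat_id has_real_derivative flat_exp [:1, 1:] t) (at t)"
proof -
  consider "t > 0" | "t < 0" | "t = 0" by linarith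
  then show ?thesis
  proof cases
    case 1
    have "((\<lambda>t. t * exp (- (1 / t))) has_real_derivative flat_exp [:1, 1:] t) (at t)"
      using 1 by (auto intro!: derivative_eq_intros
          simp: flat_exp_def power2_eq_square field_simps)
    then show ?thesis
      by (rule DERIV_eq_on_open[of _ _ _ "{0<..}"]) (use 1 in \<open>auto simp: flat_id_def\<close>)
  next
    case 2
    have "((\<lambda>t. 0) has_real_derivative flat_exp [:1, 1:] t) (at t)"
      using 2 by (simp add: flat_exp_def)
    then show ?thesis
      by (rule DERIV_eq_on_open[of _ _ _ "{..<0}"]) (use 2 in \<open>auto simp: flat_id_def\<close>)
  next
    case 3
    have ev: "\<forall>\<^sub>F t in at_right 0. flat_id t / t = poly [:1:] (1 / t) * exp (- (1 / t))"
      by (auto simp: eventually_at_right_field flat_id_def intro!: exI[of _ 1])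
    have "((\<lambda>t. flat_id t / t) \<longlongrightarrow> 0) (at_right 0)"
      using tendsto_poly_inverse_exp_right[of "[:1:]"] tendsto_cong[OF ev] by simp
    then have "(flat_id has_real_derivative 0) (at 0)"
      by (rule DERIV_0_from_right) (simp add: flat_id_def)
    then show ?thesis
      using 3 by (simp add: flat_exp_def)
  qed
qed

text \<open>\<open>bump K 0\<close> is a smooth profile on the half line, supported in \<open>[0,1]\<close>, with derivatives
  \<open>bump K k\<close>; it is chosen so that \<open>-2 * bump K 1\<close> takes values in \<open>[0,1]\<close> and tends to the
  indicator function of \<open>[0,1)\<close> as \<open>K \<longrightarrow> \<infinity>\<close>.\<close>

definition bump :: "real \<Rightarrow> nat \<Rightarrow> real \<Rightarrow> real" where
  "bump K k \<tau> = (if k = 0 then flat_id (K * (1 - \<tau>)) / (2 * K)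
     else (- K) ^ k / (2 * K) * flat_exp ((flat_deriv ^^ (k - 1)) [:1, 1:]) (K * (1 - \<tau>)))"

lemma bump_deriv: "(bump K k has_real_derivative bump K (Suc k) \<tau>) (at \<tau>)"
proof (cases k)
  case 0
  have "((\<lambda>\<tau>. flat_id (K * (1 - \<tau>)) / (2 * K)) has_real_derivative
          (flat_exp [:1, 1:] (K * (1 - \<tau>)) * (- K)) / (2 * K)) (at \<tau>)"
    by (intro DERIV_cdivide DERIV_chain2[OF flat_id_deriv]) (auto intro!: derivative_eq_intros)
  \<comment> \<open>For \<open>K = 0\<close> division by zero yields 0 and both sides
    vanish.\<close>
  then show ?thesis
    unfolding 0 bump_def[abs_def] by (cases "K = 0") (simp_all add: mult.commute)
next
  case (Suc j)
  let ?P = "(flat_deriv ^^ j) [:1, 1:]"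
  have "((\<lambda>\<tau>. (- K) ^ k / (2 * K) * flat_exp ?P (K * (1 - \<tau>))) has_real_derivative
          (- K) ^ k / (2 * K) * (flat_exp (flat_deriv ?P) (K * (1 - \<tau>)) * (- K))) (at \<tau>)"
    by (intro DERIV_cmult DERIV_chain2[OF flat_exp_deriv]) (auto intro!: derivative_eq_intros)
  then show ?thesis
    unfolding bump_def[abs_def] Suc by (cases "K = 0") (simp_all add: mult_ac)
qed

lemma continuous_on_bump [continuous_intros]:
  "continuous_on A f \<Longrightarrow> continuous_on A (\<lambda>x. bump K k (f x))"
  by (rule continuous_on_compose2[of UNIV "bump K k"])
     (auto intro!: continuous_at_imp_continuous_on DERIV_isCont bump_deriv)

lemma borel_measurable_bump [measurable]: "bump K k \<in> borel_measurable borel"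
  by (intro borel_measurable_continuous_onI continuous_on_bump continuous_on_id)

lemma bump_zero: "K > 0 \<Longrightarrow> \<tau> \<ge> 1 \<Longrightarrow> bump K k \<tau> = 0"
  by (auto simp: bump_def flat_id_def flat_exp_def zero_less_mult_iff)

lemma bump_bounded:
  assumes "K > 0"
  obtains B where "B > 0" "\<And>\<tau>. \<tau> \<ge> 0 \<Longrightarrow> \<bar>bump K k \<tau>\<bar> \<le> B"
proof -
  have "compact (bump K k ` {0..1})"
    by (intro compact_continuous_image continuous_on_bump continuous_on_id compact_Icc)
  then obtain B where "\<And>\<tau>. \<tau> \<in> {0..1} \<Longrightarrow> \<bar>bump K k \<tau>\<bar> \<le> B" "B > 0"
    by (force dest!: compact_imp_bounded simp: bounded_pos)
  then show ?thesis
    using that[of B] bump_zero[OF assms, of _ k] by (metis abs_zero atLeastAtMost_iff less_imp_le linear)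
qed

lemma bump_0_nonneg: "K > 0 \<Longrightarrow> 0 \<le> bump K 0 \<tau>"
  by (auto simp: bump_def flat_id_def)

text \<open>With \<open>w = K * (1 - \<tau>)\<close>, both \<open>exp (- 1 / w) \<le> 1\<close> and
  \<open>w \<le> K\<close> hold. The value 1/2 returns as the factor in
  \<open>mean_kernel\<close>.\<close>

lemma bump_0_le:
  assumes "K > 0" "\<tau> \<ge> 0"
  shows "bump K 0 \<tau> \<le> 1 / 2"
proof (cases "K * (1 - \<tau>) > 0")
  case True
  let ?w = "K * (1 - \<tau>)"
  have "?w * exp (- (1 / ?w)) \<le> ?w * 1"
    using True by (intro mult_left_mono) auto
  also have "\<dots> \<le> K" using assms by (simp add: algebra_simps)
  finally show ?thesis
    using True assms by (simp add: bump_def flat_id_def divide_simps)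
qed (use assms in \<open>auto simp: bump_def flat_id_def\<close>)

definition cutoff :: "real \<Rightarrow> real \<Rightarrow> real" where
  "cutoff K \<tau> = - 2 * bump K 1 \<tau>"

lemma cutoff_eq: "K > 0 \<Longrightarrow> cutoff K \<tau> = flat_exp [:1, 1:] (K * (1 - \<tau>))"
  by (simp add: cutoff_def bump_def)

lemma borel_measurable_cutoff [measurable]: "cutoff K \<in> borel_measurable borel"
  unfolding cutoff_def[abs_def] by measurable

lemma cutoff_nonneg: "K > 0 \<Longrightarrow> 0 \<le> cutoff K \<tau>"
  by (auto simp: cutoff_eq flat_exp_def)

text \<open>This is \<open>1 + a \<le> exp a\<close>, and it is the reason for the polynomial
  \<open>1 + X\<close>: the smooth kernel stays below the indicator that it approximates, so it may
  be replaced by 1 in upper bounds.\<close>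

lemma cutoff_le_1:
  assumes "K > 0"
  shows "cutoff K \<tau> \<le> 1"
proof -
  have "(1 + a) * exp (- a) \<le> 1" for a :: real
  proof -
    have "(1 + a) * exp (- a) \<le> exp a * exp (- a)"
      by (intro mult_right_mono exp_ge_add_one_self) auto
    then show ?thesis by (simp add: exp_minus)
  qed
  from this[of "1 / (K * (1 - \<tau>))"] show ?thesis
    by (auto simp: cutoff_eq[OF assms] flat_exp_def)
qed

lemma cutoff_zero: "K > 0 \<Longrightarrow> \<tau> \<ge> 1 \<Longrightarrow> cutoff K \<tau> = 0"
  by (simp add: cutoff_def bump_zero)

text \<open>From \<open>exp (- 1 / w) \<ge> 1 - 1 / w\<close> with
  \<open>w \<ge> K * \<eta>\<close>. The explicit rate turns the approximation of the indicator into
  a loss that is a number and can be made small.\<close>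

lemma cutoff_ge:
  assumes "K > 0" "\<tau> \<le> 1 - \<eta>" "\<eta> > 0"
  shows "1 - 1 / (K * \<eta>) \<le> cutoff K \<tau>"
proof -
  let ?w = "K * (1 - \<tau>)"
  have w: "?w \<ge> K * \<eta>" "K * \<eta> > 0" using assms by auto
  then have w0: "?w > 0" by linarith
  have "1 - 1 / (K * \<eta>) \<le> 1 - 1 / ?w"
    using w w0 by (intro diff_left_mono divide_left_mono) auto
  also have "\<dots> \<le> exp (- (1 / ?w))"
    using exp_ge_add_one_self[of "- (1 / ?w)"] by simp
  also have "\<dots> \<le> (1 + 1 / ?w) * exp (- (1 / ?w))"
    using w0 by (simp add: algebra_simps)
  also have "\<dots> = cutoff K \<tau>"
    using w0 by (simp add: cutoff_eq[OF assms(1)] flat_exp_def)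
  finally show ?thesis .
qed

subsection \<open>Radial test functions\<close>

text \<open>The product rule leaves one factor undifferentiated: it is known in class
  \<open>Suc k\<close> but has to be used in class \<open>k\<close>.\<close>

lemma Ck_mono: "Ck (Suc k) f \<Longrightarrow> Ck k f"
proof (induction k arbitrary: f)
  case 0
  then show ?case
    by (auto intro!: continuous_at_imp_continuous_on differentiable_imp_continuous_within)
next
  case (Suc k)
  from Suc.prems[unfolded Ck.simps(2)[of "Suc k" f]] Suc.IH show ?case
    unfolding Ck.simps(2)[of k f] by blast
qed

lemma Ck_add: "Ck k f \<Longrightarrow> Ck k g \<Longrightarrow> Ck k (\<lambda>x. f x + g x)"
proof (induction k arbitrary: f g)
  case (Suc k)
  have "frechet_derivative (\<lambda>x. f x + g x) (at x) =
      (\<lambda>h. frechet_derivative f (at x) h + frechet_derivative g (at x) h)" for x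
    using Suc.prems
    by (intro frechet_derivative_at[symmetric] has_derivative_add) (auto simp: frechet_derivative_works)
  then show ?case using Suc by (auto intro!: derivative_intros)
qed (auto intro: continuous_intros)

lemma Ck_mult: "Ck k f \<Longrightarrow> Ck k g \<Longrightarrow> Ck k (\<lambda>x. f x * g x)"
proof (induction k arbitrary: f g)
  case (Suc k)
  have "frechet_derivative (\<lambda>x. f x * g x) (at x) =
      (\<lambda>h. f x * frechet_derivative g (at x) h + frechet_derivative f (at x) h * g x)" for x
    using Suc.prems
    by (intro frechet_derivative_at[symmetric] has_derivative_mult) (auto simp: frechet_derivative_works)
  then show ?case using Suc Ck_mono[OF Suc.prems(1)] Ck_mono[OF Suc.prems(2)]
    by (auto intro!: derivative_intros Ck_add)
qed (auto intro: continuous_intros)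

lemma Ck_const: "Ck k (\<lambda>x. c)"
proof (induction k arbitrary: c)
  case (Suc k)
  then show ?case by (auto simp: frechet_derivative_const)
qed auto

lemma Ck_affine: "Ck k (\<lambda>y. (y - x) \<bullet> b * c)"
proof (cases k)
  case (Suc j)
  have *: "((\<lambda>y. (y - x) \<bullet> b * c) has_derivative (\<lambda>h. h \<bullet> b * c)) (at z)" for z
    by (auto intro!: derivative_eq_intros)
  show ?thesis
    unfolding Suc using * Ck_const
    by (auto simp: frechet_derivative_at[OF *, symmetric] intro: differentiableI[OF *])
qed (auto intro!: continuous_intros)

lemma radial_deriv:
  "((\<lambda>y. bump K k ((y - x) \<bullet> (y - x) / t\<^sup>2)) has_derivative
     (\<lambda>h. bump K (Suc k) ((z - x) \<bullet> (z - x) / t\<^sup>2) * ((z - x) \<bullet> h * (2 / t\<^sup>2)))) (at z)"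
proof -
  have "((\<lambda>y. (y - x) \<bullet> (y - x) / t\<^sup>2) has_derivative (\<lambda>h. (z - x) \<bullet> h * (2 / t\<^sup>2))) (at z)"
    by (cases "t = 0") (auto intro!: derivative_eq_intros simp: inner_commute divide_simps)
  from has_derivative_compose[OF this bump_deriv[unfolded has_field_derivative_def]]
  show ?thesis by simp
qed

lemma radial_frechet:
  "frechet_derivative (\<lambda>y. bump K k ((y - x) \<bullet> (y - x) / t\<^sup>2)) (at z) h =
     bump K (Suc k) ((z - x) \<bullet> (z - x) / t\<^sup>2) * ((z - x) \<bullet> h * (2 / t\<^sup>2))"
  by (simp add: frechet_derivative_at[OF radial_deriv, symmetric])

text \<open>A partial derivative is the next profile \<open>bump K (Suc k)\<close> times an affine
  function, so the induction on \<open>j\<close> closes only with \<open>k\<close>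
  arbitrary.\<close>

lemma Ck_radial: "Ck j (\<lambda>y. bump K k ((y - x) \<bullet> (y - x) / t\<^sup>2))"
proof (induction j arbitrary: k)
  case 0
  show ?case by (auto intro!: continuous_at_imp_continuous_on has_derivative_continuous[OF radial_deriv])
next
  case (Suc j)
  show ?case
    unfolding Ck.simps(2) radial_frechet
    by (intro conjI allI ballI Ck_mult Suc.IH Ck_affine differentiableI[OF radial_deriv])
qed

lemma test_functionsI:
  assumes "\<And>k. Ck k \<phi>" "\<And>y. dist x y \<ge> t \<Longrightarrow> \<phi> y = 0" "cball x t \<subseteq> U"
  shows "\<phi> \<in> test_functions U"
proof -
  have "{y. \<phi> y \<noteq> 0} \<subseteq> cball x t" using assms(2) by (force simp: not_le)
  then have "closure {y. \<phi> y \<noteq> 0} \<subseteq> cball x t"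
    by (simp add: closure_minimal)
  then show ?thesis
    using assms(1,3) bounded_subset[OF bounded_cball closure_subset[THEN subset_trans]]
    by (auto simp: test_functions_def compact_closure)
qed

lemma radial_arg_ge_1:
  assumes "t > 0" "dist x y \<ge> t"
  shows "(y - x) \<bullet> (y - x) / t\<^sup>2 \<ge> 1"
  using assms power_mono[of t "dist x y" 2]
  by (simp add: dist_norm norm_minus_commute[of x] power2_norm_eq_inner[symmetric] divide_simps)

lemma radial_test:
  assumes "K > 0" "t > 0" "cball x t \<subseteq> U"
  shows "(\<lambda>y. bump K k ((y - x) \<bullet> (y - x) / t\<^sup>2)) \<in> test_functions U"
  by (intro test_functionsI[where x = x and t = t] Ck_radial
      bump_zero[OF assms(1) radial_arg_ge_1[OF assms(2)]] assms(3))

text \<open>For \<open>k = 1\<close> and \<open>c = 2 / t\<^sup>2\<close> this is a partial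
  derivative of the radial function with \<open>k = 0\<close>. It must be a test function in its own
  right, because \<open>weak_gradient\<close> is applied to it.\<close>

lemma radial_deriv_test:
  assumes "K > 0" "t > 0" "cball x t \<subseteq> U"
  shows "(\<lambda>y. bump K k ((y - x) \<bullet> (y - x) / t\<^sup>2) * ((y - x) \<bullet> b * c)) \<in> test_functions U"
  by (intro test_functionsI[where x = x and t = t] Ck_mult Ck_radial Ck_affine assms(3))
     (simp add: bump_zero[OF assms(1) radial_arg_ge_1[OF assms(2)]])

lemma grad_inner: "b \<in> Basis \<Longrightarrow> grad \<phi> z \<bullet> b = frechet_derivative \<phi> (at z) b"
  by (simp add: grad_def inner_sum_left inner_Basis if_distrib cong: if_cong)

lemma grad_radial_inner:
  assumes "b \<in> Basis"
  shows "grad (\<lambda>y. bump K k ((y - x) \<bullet> (y - x) / t\<^sup>2)) z \<bullet> b =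
     bump K (Suc k) ((z - x) \<bullet> (z - x) / t\<^sup>2) * ((z - x) \<bullet> b * (2 / t\<^sup>2))"
  by (simp only: grad_inner[OF assms] radial_frechet)

lemma grad_radial_deriv_inner:
  assumes "b \<in> Basis"
  shows "grad (\<lambda>y. bump K k ((y - x) \<bullet> (y - x) / t\<^sup>2) * ((y - x) \<bullet> b * c)) z \<bullet> b =
     bump K (Suc k) ((z - x) \<bullet> (z - x) / t\<^sup>2) * (2 / t\<^sup>2 * c) * ((z - x) \<bullet> b)\<^sup>2
     + bump K k ((z - x) \<bullet> (z - x) / t\<^sup>2) * c"
proof -
  have "((\<lambda>y. (y - x) \<bullet> b * c) has_derivative (\<lambda>h. h \<bullet> b * c)) (at z)"
    by (auto intro!: derivative_eq_intros)
  from frechet_derivative_at[OF has_derivative_mult[OF radial_deriv this], symmetric] show ?thesis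
    using assms by (simp add: grad_inner power2_eq_square mult_ac)
qed

subsection \<open>The mean value inequality\<close>

lemma test_function_continuous: "\<phi> \<in> test_functions U \<Longrightarrow> continuous_on UNIV \<phi>"
  unfolding test_functions_def using Ck.simps(1) by blast

lemma test_function_bounded:
  assumes "\<phi> \<in> test_functions U"
  obtains B where "\<And>x. \<bar>\<phi> x\<bar> \<le> B"
proof -
  let ?S = "closure {x. \<phi> x \<noteq> 0}"
  have "compact (\<phi> ` ?S)"
    using assms test_function_continuous[OF assms]
    by (intro compact_continuous_image) (auto simp: test_functions_def elim: continuous_on_subset)
  then obtain B where B: "\<And>x. x \<in> ?S \<Longrightarrow> \<bar>\<phi> x\<bar> \<le> B" "B > 0"
    by (force dest!: compact_imp_bounded simp: bounded_pos)
  have "\<bar>\<phi> x\<bar> \<le> B" for x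
  proof (cases "\<phi> x = 0")
    case False
    then show ?thesis using B closure_subset[of "{x. \<phi> x \<noteq> 0}"] by auto
  qed (use B in auto)
  then show ?thesis by (rule that)
qed

lemma test_function_deriv:
  assumes "\<phi> \<in> test_functions U" "b \<in> Basis"
  shows "(\<lambda>x. frechet_derivative \<phi> (at x) b) \<in> test_functions U"
proof -
  let ?S = "closure {x. \<phi> x \<noteq> 0}"
  have "frechet_derivative \<phi> (at x) b = 0" if "x \<notin> ?S" for x
  proof -
    have "(\<phi> has_derivative (\<lambda>h. 0)) (at x)"
      by (rule has_derivative_transform_within_open[of "\<lambda>x. 0" _ _ _ "- ?S"])
         (use that closure_subset[of "{x. \<phi> x \<noteq> 0}"] in auto)
    from frechet_derivative_at[OF this, symmetric] show ?thesis by simp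
  qed
  then have "{x. frechet_derivative \<phi> (at x) b \<noteq> 0} \<subseteq> ?S" by auto
  then have *: "closure {x. frechet_derivative \<phi> (at x) b \<noteq> 0} \<subseteq> ?S"
    by (simp add: closure_minimal)
  have "Ck k (\<lambda>x. frechet_derivative \<phi> (at x) b)" for k
  proof -
    have "Ck (Suc k) \<phi>" using assms by (simp add: test_functions_def)
    then show ?thesis using assms(2) unfolding Ck.simps(2) by blast
  qed
  moreover have "bounded ?S" "?S \<subseteq> U"
    using assms by (auto simp: test_functions_def compact_imp_bounded)
  ultimately show ?thesis
    using * bounded_subset[OF \<open>bounded ?S\<close>] subset_trans[OF closure_subset *]
    by (auto simp: test_functions_def compact_closure)
qed

lemma set_integrable_mult_bounded:
  fixes f c :: "'a \<Rightarrow> real"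
  assumes "set_integrable M A f" "c \<in> borel_measurable M" "\<And>x. \<bar>c x\<bar> \<le> B"
  shows "set_integrable M A (\<lambda>x. f x * c x)"
proof -
  have "integrable M (\<lambda>x. (indicator A x *\<^sub>R f x) * c x)"
  proof (rule Bochner_Integration.integrable_bound[of M "\<lambda>x. B * (indicator A x *\<^sub>R f x)"])
    show "AE x in M. norm (indicator A x *\<^sub>R f x * c x) \<le> norm (B * (indicator A x *\<^sub>R f x))"
    proof (rule AE_I2)
      fix x
      have "\<bar>indicator A x *\<^sub>R f x\<bar> * \<bar>c x\<bar> \<le> \<bar>indicator A x *\<^sub>R f x\<bar> * \<bar>B\<bar>"
        using assms(3)[of x] by (intro mult_left_mono) auto
      then show "norm (indicator A x *\<^sub>R f x * c x) \<le> norm (B * (indicator A x *\<^sub>R f x))"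
        by (simp add: abs_mult mult_ac)
    qed
  qed (use assms in \<open>auto simp: set_integrable_def\<close>)
  then show ?thesis by (simp add: set_integrable_def mult_ac)
qed

lemma set_integrable_mult_test:
  fixes f :: "'a::euclidean_space \<Rightarrow> real"
  assumes "set_integrable lebesgue A f" "\<phi> \<in> test_functions U"
  shows "set_integrable lebesgue A (\<lambda>x. f x * \<phi> x)"
proof -
  obtain B where "\<And>x. \<bar>\<phi> x\<bar> \<le> B" using test_function_bounded[OF assms(2)] by blast
  moreover have "\<phi> \<in> borel_measurable lebesgue"
    using borel_measurable_continuous_onI[OF test_function_continuous[OF assms(2)]]
    by (intro measurable_completion) auto
  ultimately show ?thesis by (intro set_integrable_mult_bounded[OF assms(1)])
qed

text \<open>On a set of finite measure, \<open>norm (f x) \<le> 1 + (norm (f x))\<^sup>2\<close> is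
  an integrable majorant.\<close>

lemma L2_on_set_integrable:
  fixes f :: "'a::euclidean_space \<Rightarrow> 'b::euclidean_space"
  assumes "L2_on U f" "U \<in> lmeasurable"
  shows "set_integrable lebesgue U f"
proof -
  have int: "set_integrable lebesgue U (\<lambda>x. 1 + (norm (f x))\<^sup>2)"
    using assms by (intro set_integral_add) (auto simp: L2_on_def set_integrable_def fmeasurable_def)
  have AE: "AE x in lebesgue. x \<in> U \<longrightarrow> norm (f x) \<le> norm (1 + (norm (f x))\<^sup>2)"
  proof (intro AE_I2 impI)
    fix x
    have "2 * 1 * norm (f x) \<le> 1\<^sup>2 + (norm (f x))\<^sup>2" by (rule sum_squares_bound)
    then have "norm (f x) \<le> 1 + (norm (f x))\<^sup>2" using norm_ge_zero[of "f x"] unfolding power_one by linarith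
    then show "norm (f x) \<le> norm (1 + (norm (f x))\<^sup>2)" unfolding real_norm_def by linarith
  qed
  have meas: "set_borel_measurable lebesgue U f"
    using assms(1) by (simp add: L2_on_def)
  show ?thesis by (rule set_integrable_bound[OF int meas AE])
qed

lemma set_integral_sum:
  fixes f :: "'i \<Rightarrow> 'a \<Rightarrow> real"
  assumes "\<And>i. i \<in> I \<Longrightarrow> set_integrable M A (f i)"
  shows "(LINT x:A|M. (\<Sum>i\<in>I. f i x)) = (\<Sum>i\<in>I. (LINT x:A|M. f i x))"
  using assms unfolding set_lebesgue_integral_def set_integrable_def scaleR_sum_right
  by (rule Bochner_Integration.integral_sum)

text \<open>The Laplacian in \<open>z\<close> of
  \<open>bump K 0 (z \<bullet> z / t\<^sup>2)\<close>, written out by the chain rule.\<close>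

definition radial_laplacian :: "real \<Rightarrow> real \<Rightarrow> 'a::euclidean_space \<Rightarrow> real" where
  "radial_laplacian K t z = bump K 2 (z \<bullet> z / t\<^sup>2) * (4 * (z \<bullet> z) / t ^ 4)
     + bump K 1 (z \<bullet> z / t\<^sup>2) * (2 * DIM('a) / t\<^sup>2)"

text \<open>The coordinates of the gradient of the radial function are the test functions
  \<open>?\<psi> b\<close>. The weak gradient identity for each of them moves the derivative from
  \<open>v\<close> to \<open>?\<psi> b\<close>, and summing over \<open>b\<close> produces the
  Laplacian.\<close>

lemma weak_laplacian_radial:
  fixes v :: "'a::euclidean_space \<Rightarrow> real"
  assumes "H1_with_gradient U v G" "U \<in> lmeasurable" "K > 0" "t > 0" "cball x t \<subseteq> U"
  shows "(LINT y:U|lebesgue. G y \<bullet> grad (\<lambda>y. bump K 0 ((y - x) \<bullet> (y - x) / t\<^sup>2)) y)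
    = - (LINT y:U|lebesgue. v y * radial_laplacian K t (y - x))"
proof -
  let ?\<phi> = "\<lambda>y. bump K 0 ((y - x) \<bullet> (y - x) / t\<^sup>2)"
  let ?\<psi> = "\<lambda>b y. bump K 1 ((y - x) \<bullet> (y - x) / t\<^sup>2) * ((y - x) \<bullet> b * (2 / t\<^sup>2))"
  have test: "?\<psi> b \<in> test_functions U" for b
    by (rule radial_deriv_test[OF assms(3-5)])
  have L2: "L2_on U v" "L2_on U G" and weak: "weak_gradient U v G"
    using assms(1) by (auto simp: H1_with_gradient_def)
  have v: "set_integrable lebesgue U v" and G: "set_integrable lebesgue U G"
    using L2 assms(2) by (auto intro: L2_on_set_integrable)
  have Gb: "set_integrable lebesgue U (\<lambda>y. G y \<bullet> b)" for b
    using integrable_inner_left[OF G[unfolded set_integrable_def], of b]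
    by (simp add: set_integrable_def)
  have int_v: "set_integrable lebesgue U (\<lambda>y. v y * (grad (?\<psi> b) y \<bullet> b))" if "b \<in> Basis" for b
    using set_integrable_mult_test[OF v test_function_deriv[OF test that]]
    by (simp add: grad_inner[OF that])
  have "G y \<bullet> grad ?\<phi> y = (\<Sum>b\<in>Basis. (G y \<bullet> b) * ?\<psi> b y)" for y
    unfolding euclidean_inner[of "G y" "grad ?\<phi> y"]
    by (intro sum.cong refl) (simp only: grad_radial_inner One_nat_def)
  then have "(LINT y:U|lebesgue. G y \<bullet> grad ?\<phi> y)
      = (LINT y:U|lebesgue. (\<Sum>b\<in>Basis. (G y \<bullet> b) * ?\<psi> b y))"
    by simp
  also have "\<dots> = (\<Sum>b\<in>Basis. (LINT y:U|lebesgue. (G y \<bullet> b) * ?\<psi> b y))"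
    by (intro set_integral_sum set_integrable_mult_test[OF Gb test])
  also have "\<dots> = (\<Sum>b\<in>Basis. - (LINT y:U|lebesgue. v y * (grad (?\<psi> b) y \<bullet> b)))"
    using weak test by (intro sum.cong) (auto simp: weak_gradient_def)
  also have "\<dots> = - (LINT y:U|lebesgue. (\<Sum>b\<in>Basis. v y * (grad (?\<psi> b) y \<bullet> b)))"
    by (simp only: sum_negf set_integral_sum[OF int_v])
  finally have eq: "(LINT y:U|lebesgue. G y \<bullet> grad ?\<phi> y)
      = - (LINT y:U|lebesgue. (\<Sum>b\<in>Basis. v y * (grad (?\<psi> b) y \<bullet> b)))" .
  have "(\<Sum>b\<in>Basis. v y * (grad (?\<psi> b) y \<bullet> b)) = v y * radial_laplacian K t (y - x)" for y
  proof -
    have sq: "(y - x) \<bullet> (y - x) = (\<Sum>b\<in>Basis. ((y - x) \<bullet> b)\<^sup>2)"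
      by (subst euclidean_inner) (simp add: power2_eq_square)
    have "(\<Sum>b\<in>Basis. grad (?\<psi> b) y \<bullet> b) =
      (\<Sum>b\<in>Basis. bump K 2 ((y - x) \<bullet> (y - x) / t\<^sup>2) * (4 / t ^ 4) * ((y - x) \<bullet> b)\<^sup>2
         + bump K 1 ((y - x) \<bullet> (y - x) / t\<^sup>2) * (2 / t\<^sup>2))"
    proof (rule sum.cong[OF refl])
      fix b :: 'a assume "b \<in> Basis"
      then show "grad (?\<psi> b) y \<bullet> b = bump K 2 ((y - x) \<bullet> (y - x) / t\<^sup>2) * (4 / t ^ 4) * ((y - x) \<bullet> b)\<^sup>2
         + bump K 1 ((y - x) \<bullet> (y - x) / t\<^sup>2) * (2 / t\<^sup>2)"
        by (subst grad_radial_deriv_inner) (auto simp: numeral_2_eq_2[symmetric] power2_eq_square power4_eq_xxxx)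
    qed
    also have "\<dots> = radial_laplacian K t (y - x)"
      unfolding sum.distrib sum_distrib_left[symmetric] sq[symmetric] radial_laplacian_def
      by (simp add: mult_ac)
    finally show ?thesis by (simp only: sum_distrib_left[symmetric])
  qed
  then show ?thesis unfolding eq by (simp only:)
qed

text \<open>The scale derivative of the averaging kernel is the Laplacian of a compactly supported
  nonnegative function. Tested against a subsolution, it shows that the averages increase with the
  scale up to a contribution of the right-hand side.\<close>

lemma kernel_deriv:
  fixes z :: "'a::euclidean_space"
  assumes "t > 0"
  shows "((\<lambda>t. cutoff K (z \<bullet> z / t\<^sup>2) / t ^ DIM('a)) has_real_derivative
           t / t ^ DIM('a) * radial_laplacian K t z) (at t)"
proof -
  let ?N = "DIM('a)"
  have N: "t ^ (?N - 1) = t ^ ?N / t" using assms by (simp add: power_diff)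
  have "((\<lambda>t. - 2 * bump K 1 (z \<bullet> z / t\<^sup>2) / t ^ ?N) has_real_derivative
     ((- 2 * (bump K (Suc 1) (z \<bullet> z / t\<^sup>2) * (- 2 * (z \<bullet> z) / t ^ 3))) * t ^ ?N
       - (- 2 * bump K 1 (z \<bullet> z / t\<^sup>2)) * (?N * t ^ (?N - 1))) / (t ^ ?N * t ^ ?N)) (at t)"
  proof (intro DERIV_divide DERIV_cmult DERIV_chain2[OF bump_deriv])
    show "((\<lambda>t. z \<bullet> z / t\<^sup>2) has_real_derivative - 2 * (z \<bullet> z) / t ^ 3) (at t)"
      using assms by (auto intro!: derivative_eq_intros simp: power2_eq_square power3_eq_cube field_simps)
    show "((\<lambda>t. t ^ ?N) has_real_derivative real ?N * t ^ (?N - 1)) (at t)"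
      using DERIV_pow[of ?N t] by simp
  qed (use assms in auto)
  moreover have "((- 2 * (bump K (Suc 1) (z \<bullet> z / t\<^sup>2) * (- 2 * (z \<bullet> z) / t ^ 3))) * t ^ ?N
       - (- 2 * bump K 1 (z \<bullet> z / t\<^sup>2)) * (?N * t ^ (?N - 1))) / (t ^ ?N * t ^ ?N)
     = t / t ^ DIM('a) * radial_laplacian K t z"
    unfolding radial_laplacian_def N using assms
    by (simp add: numeral_2_eq_2[symmetric] power2_eq_square power3_eq_cube power4_eq_xxxx divide_simps)
       (simp add: algebra_simps)
  ultimately show ?thesis by (simp add: cutoff_def)
qed

section \<open>Integrating the scale derivative of the averages\<close>

lemma ennreal_integral_le_nn_integral:
  fixes f :: "'a \<Rightarrow> real"
  assumes "integrable M f"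
  shows "ennreal (integral\<^sup>L M f) \<le> (\<integral>\<^sup>+x. ennreal (f x) \<partial>M)"
proof -
  have "integral\<^sup>L M f \<le> (\<integral>x. max 0 (f x) \<partial>M)"
    using assms by (intro integral_mono) auto
  then have "ennreal (integral\<^sup>L M f) \<le> ennreal (\<integral>x. max 0 (f x) \<partial>M)"
    by (rule ennreal_leI)
  also have "\<dots> = (\<integral>\<^sup>+x. ennreal (max 0 (f x)) \<partial>M)"
    using assms by (subst nn_integral_eq_integral) auto
  also have "\<dots> = (\<integral>\<^sup>+x. ennreal (f x) \<partial>M)"
    by (intro nn_integral_cong) (auto simp: max_def ennreal_neg)
  finally show ?thesis .
qed

text \<open>The majorant \<open>B * indicator {a..b} t * V y\<close> separates the variables. The
  lemma licenses exchanging the scale integral with the space integral.\<close>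

lemma integrable_prod_bounded:
  fixes V :: "'a::euclidean_space \<Rightarrow> real" and w :: "real \<Rightarrow> 'a \<Rightarrow> real"
  assumes V: "integrable lborel V"
    and w[measurable]: "(\<lambda>(t, y). w t y) \<in> borel_measurable (borel \<Otimes>\<^sub>M borel)"
    and bound: "\<And>t y. t \<in> {a..b} \<Longrightarrow> \<bar>w t y\<bar> \<le> B"
  shows "integrable (lborel \<Otimes>\<^sub>M lborel) (\<lambda>(t, y). V y * (w t y * indicator {a..b} t))"
proof -
  have Vm[measurable]: "V \<in> borel_measurable borel" using V by auto
  have "integrable (lborel \<Otimes>\<^sub>M lborel) (\<lambda>(t, y). (B * indicator {a..b} t) * V y)"
  proof (rule lborel_pair.Fubini_integrable)
    show "integrable lborel (\<lambda>t. \<integral>y. norm (case (t, y) of (t, y) \<Rightarrow> (B * indicator {a..b} t) * V y) \<partial>lborel)"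
      by (auto simp: abs_mult intro!: integrable_real_indicator emeasure_compact_finite[unfolded infinity_ennreal_def])
    show "AE t in lborel. integrable lborel (\<lambda>y. case (t, y) of (t, y) \<Rightarrow> (B * indicator {a..b} t) * V y)"
      using V by auto
  qed measurable
  then show ?thesis
  proof (rule Bochner_Integration.integrable_bound)
    show "(\<lambda>(t, y). V y * (w t y * indicator {a..b} t)) \<in> borel_measurable (lborel \<Otimes>\<^sub>M lborel)"
      by measurable
    have "\<bar>V y\<bar> * (\<bar>w t y\<bar> * indicator {a..b} t) \<le> \<bar>B\<bar> * indicator {a..b} t * \<bar>V y\<bar>" for t y
      using mult_left_mono[OF order_trans[OF bound[of t y] abs_ge_self], of "\<bar>V y\<bar>"]
      by (auto simp: indicator_def mult.commute)
    then show "AE p in lborel \<Otimes>\<^sub>M lborel. norm (case p of (t, y) \<Rightarrow> V y * (w t y * indicator {a..b} t))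
        \<le> norm (case p of (t, y) \<Rightarrow> (B * indicator {a..b} t) * V y)"
      by (auto simp: abs_mult)
  qed
qed

text \<open>Dominates \<open>t / t ^ N * bump K 0 (z \<bullet> z / t\<^sup>2)\<close> for scales up
  to \<open>s\<close>. For \<open>N \<ge> 3\<close> its integral over \<open>t\<close> is a multiple
  of \<open>|z|^(2-N) - s^(2-N)\<close>, the Green function of the ball with pole at the centre;
  leaving the scale integral open keeps every slice a multiple of an indicator.\<close>

definition mean_kernel :: "real \<Rightarrow> real \<Rightarrow> 'a::euclidean_space \<Rightarrow> real" where
  "mean_kernel s t z = (if 0 < t \<and> t \<le> s \<and> norm z < t then t / t ^ DIM('a) / 2 else 0)"

definition mean_potential :: "('a::euclidean_space \<Rightarrow> real) \<Rightarrow> real \<Rightarrow> 'a \<Rightarrow> ennreal" where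
  "mean_potential h s x = (\<integral>\<^sup>+t. (\<integral>\<^sup>+y. ennreal (h y * mean_kernel s t (y - x)) \<partial>lborel) \<partial>lborel)"

text \<open>An interface from which the weak gradient has disappeared: what remains of the weak
  inequality are the radial tests, with the Laplacian already on the test function. \<open>V\<close>
  and \<open>h\<close> are integrable on the whole space; only the balls allowed in
  \<open>sub\<close> refer to \<open>ball 0 r\<close>.\<close>

locale subsolution =
  fixes V h :: "'a::euclidean_space \<Rightarrow> real" and K r :: real
  assumes K: "K > 0"
    and V: "integrable lborel V" "\<And>y. V y \<ge> 0"
    and h: "integrable lborel h" "\<And>y. h y \<ge> 0"
    and sub: "\<And>x t. t > 0 \<Longrightarrow> cball x t \<subseteq> ball 0 r \<Longrightarrow>
      - (\<integral>y. V y * radial_laplacian K t (y - x) \<partial>lborel)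
        \<le> (\<integral>y. h y * bump K 0 ((y - x) \<bullet> (y - x) / t\<^sup>2) \<partial>lborel)"
begin

lemma V_measurable [measurable]: "V \<in> borel_measurable borel"
  and h_measurable [measurable]: "h \<in> borel_measurable borel"
  using V(1) h(1) by auto

text \<open>Not normalised to mass 1: the kernel has the scale-free mass of
  \<open>cutoff K (z \<bullet> z)\<close>, at most the volume of the unit ball. For small
  \<open>t\<close> one therefore expects this mass times \<open>V x\<close>, not
  \<open>V x\<close>.\<close>

definition smooth_mean :: "real \<Rightarrow> 'a \<Rightarrow> real" where
  "smooth_mean t x = (\<integral>y. V y * (cutoff K ((y - x) \<bullet> (y - x) / t\<^sup>2) / t ^ DIM('a)) \<partial>lborel)"

lemma integrable_smooth_mean:
  assumes "t > 0"
  shows "integrable lborel (\<lambda>y. V y * (cutoff K ((y - x) \<bullet> (y - x) / t\<^sup>2) / t ^ DIM('a)))"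
proof (rule Bochner_Integration.integrable_bound)
  show "integrable lborel (\<lambda>y. V y * (1 / t ^ DIM('a)))" using V(1) by simp
  show "AE y in lborel. norm (V y * (cutoff K ((y - x) \<bullet> (y - x) / t\<^sup>2) / t ^ DIM('a)))
      \<le> norm (V y * (1 / t ^ DIM('a)))"
    using V(2) cutoff_nonneg[OF K] cutoff_le_1[OF K] assms
    by (intro AE_I2) (auto simp: abs_mult intro!: mult_left_le divide_right_mono)
qed measurable

text \<open>For each fixed \<open>y\<close> the kernel at scale \<open>s\<close> minus the kernel at
  scale \<epsilon> is the integral of its scale derivative \<open>w\<close>. Fubini then puts the
  space integral inside, where \<open>sub\<close> applies at every single scale. Positivity of
  \<epsilon> keeps \<open>w\<close> bounded.\<close>

lemma mean_value_inequality:
  assumes "0 < \<epsilon>" "\<epsilon> \<le> s" "cball x s \<subseteq> ball 0 r"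
  shows "ennreal (smooth_mean \<epsilon> x) \<le> ennreal ((\<integral>y. V y \<partial>lborel) / s ^ DIM('a)) + mean_potential h s x"
proof -
  let ?N = "DIM('a)"
  define w where "w t y = t / t ^ ?N * radial_laplacian K t (y - x)" for t and y :: 'a
  have s: "s > 0" using assms by simp
  have w_meas[measurable]: "(\<lambda>(t, y). w t y) \<in> borel_measurable (borel \<Otimes>\<^sub>M borel)"
    unfolding w_def radial_laplacian_def by measurable
  obtain B1 where B1: "B1 > 0" "\<And>\<tau>. \<tau> \<ge> 0 \<Longrightarrow> \<bar>bump K 1 \<tau>\<bar> \<le> B1" using bump_bounded[OF K] by blast
  obtain B2 where B2: "B2 > 0" "\<And>\<tau>. \<tau> \<ge> 0 \<Longrightarrow> \<bar>bump K 2 \<tau>\<bar> \<le> B2" using bump_bounded[OF K] by blast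
  have abs_sum4: "\<bar>a * 4 + b\<bar> \<le> 4 * a' + b'" if "\<bar>a\<bar> \<le> a'" "\<bar>b\<bar> \<le> b'" for a b a' b' :: real
    using that by linarith
  have lap_bound: "\<bar>radial_laplacian K t (y - x)\<bar> \<le> (4 * B2 + 2 * ?N * B1) / \<epsilon>\<^sup>2" if "t \<in> {\<epsilon>..s}" for t y
  proof -
    let ?\<tau> = "(y - x) \<bullet> (y - x) / t\<^sup>2"
    have t: "t > 0" "\<epsilon>\<^sup>2 \<le> t\<^sup>2" using that assms by (auto intro: power_mono)
    have \<tau>: "?\<tau> \<ge> 0" by simp
    have "radial_laplacian K t (y - x) = (bump K 2 ?\<tau> * ?\<tau> * 4 + bump K 1 ?\<tau> * (2 * ?N)) / t\<^sup>2"
      using t by (simp add: radial_laplacian_def power2_eq_square power4_eq_xxxx divide_simps)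
    \<comment> \<open>The unbounded factor \<open>?\<tau>\<close> does no harm, since the profile
      vanishes from 1 on.\<close>
    moreover have "\<bar>bump K 2 ?\<tau> * ?\<tau>\<bar> \<le> B2"
    proof (cases "?\<tau> \<ge> 1")
      case False
      then have "\<bar>bump K 2 ?\<tau>\<bar> * ?\<tau> \<le> B2 * 1"
        using B2(2)[OF \<tau>] B2(1) by (intro mult_mono) auto
      then show ?thesis using \<tau> by (simp add: abs_mult)
    qed (use bump_zero[OF K] B2 in auto)
    moreover have "\<bar>bump K 1 ?\<tau> * (2 * ?N)\<bar> \<le> 2 * ?N * B1"
      using B1(2)[OF \<tau>] by (simp add: abs_mult)
    ultimately have "\<bar>radial_laplacian K t (y - x)\<bar> \<le> (4 * B2 + 2 * ?N * B1) / t\<^sup>2"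
      using abs_sum4[of "bump K 2 ?\<tau> * ?\<tau>" B2 "bump K 1 ?\<tau> * (2 * ?N)" "2 * ?N * B1"]
      by (simp only: abs_divide power2_abs abs_power2) (rule divide_right_mono, simp_all)
    also have "\<dots> \<le> (4 * B2 + 2 * ?N * B1) / \<epsilon>\<^sup>2"
      using t assms B1 B2 by (intro divide_left_mono) auto
    finally show ?thesis .
  qed
  have w_bound: "\<bar>w t y\<bar> \<le> s / \<epsilon> ^ ?N * ((4 * B2 + 2 * ?N * B1) / \<epsilon>\<^sup>2)" if "t \<in> {\<epsilon>..s}" for t y
  proof -
    have "t / t ^ ?N \<le> s / \<epsilon> ^ ?N"
      using that assms by (intro frac_le power_mono) auto
    then have "\<bar>t / t ^ ?N\<bar> * \<bar>radial_laplacian K t (y - x)\<bar> \<le> s / \<epsilon> ^ ?N * ((4 * B2 + 2 * ?N * B1) / \<epsilon>\<^sup>2)"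
      using that assms lap_bound[OF that, of y] by (intro mult_mono) auto
    then show ?thesis by (simp add: w_def abs_mult)
  qed
  have int: "integrable (lborel \<Otimes>\<^sub>M lborel) (\<lambda>(t, y). V y * (w t y * indicator {\<epsilon>..s} t))"
    by (rule integrable_prod_bounded[OF V(1) w_meas w_bound])
  have ftc: "(\<integral>t. w t y * indicator {\<epsilon>..s} t \<partial>lborel)
      = cutoff K ((y - x) \<bullet> (y - x) / s\<^sup>2) / s ^ ?N - cutoff K ((y - x) \<bullet> (y - x) / \<epsilon>\<^sup>2) / \<epsilon> ^ ?N" for y
  proof (rule integral_FTC_Icc_real[OF assms(2)])
    fix t assume "\<epsilon> \<le> t" "t \<le> s"
    then have t: "t > 0" using assms by simp
    show "((\<lambda>t. cutoff K ((y - x) \<bullet> (y - x) / t\<^sup>2) / t ^ ?N) has_real_derivative w t y) (at t)"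
      unfolding w_def by (rule kernel_deriv[OF t])
    have "isCont (\<lambda>t. bump K k ((y - x) \<bullet> (y - x) / t\<^sup>2)) t" for k
      using t by (intro isCont_o2[OF _ DERIV_isCont[OF bump_deriv]] continuous_intros) auto
    then show "isCont (\<lambda>t. w t y) t"
      unfolding w_def radial_laplacian_def using t by (intro continuous_intros) auto
  qed
  have "smooth_mean s x - smooth_mean \<epsilon> x
      = (\<integral>y. V y * (\<integral>t. w t y * indicator {\<epsilon>..s} t \<partial>lborel) \<partial>lborel)"
    unfolding smooth_mean_def ftc right_diff_distrib
    using assms s by (intro Bochner_Integration.integral_diff[symmetric] integrable_smooth_mean) auto
  also have "\<dots> = (\<integral>y. (\<integral>t. V y * (w t y * indicator {\<epsilon>..s} t) \<partial>lborel) \<partial>lborel)"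
    by simp
  also have "\<dots> = (\<integral>t. (\<integral>y. V y * (w t y * indicator {\<epsilon>..s} t) \<partial>lborel) \<partial>lborel)"
    using lborel_pair.Fubini_integral[OF int] by simp
  finally have eq: "smooth_mean \<epsilon> x = smooth_mean s x
      + (\<integral>t. - (\<integral>y. V y * (w t y * indicator {\<epsilon>..s} t) \<partial>lborel) \<partial>lborel)"
    by simp
  have int_t: "integrable lborel (\<lambda>t. - (\<integral>y. V y * (w t y * indicator {\<epsilon>..s} t) \<partial>lborel))"
    using lborel_pair.integrable_fst[OF int] by simp
  \<comment> \<open>Extended nonnegative integrals drop the negative parts and admit an infinite
    potential.\<close>
  have "ennreal (\<integral>t. - (\<integral>y. V y * (w t y * indicator {\<epsilon>..s} t) \<partial>lborel) \<partial>lborel)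
      \<le> (\<integral>\<^sup>+t. ennreal (- (\<integral>y. V y * (w t y * indicator {\<epsilon>..s} t) \<partial>lborel)) \<partial>lborel)"
    by (rule ennreal_integral_le_nn_integral[OF int_t])
  also have "\<dots> \<le> mean_potential h s x"
    unfolding mean_potential_def
  proof (intro nn_integral_mono)
    fix t
    show "ennreal (- (\<integral>y. V y * (w t y * indicator {\<epsilon>..s} t) \<partial>lborel))
        \<le> (\<integral>\<^sup>+y. ennreal (h y * mean_kernel s t (y - x)) \<partial>lborel)"
    proof (cases "t \<in> {\<epsilon>..s}")
      case True
      then have t: "t > 0" "cball x t \<subseteq> ball 0 r" using assms subset_cball[of t s x] by auto
      let ?q = "\<lambda>y. bump K 0 ((y - x) \<bullet> (y - x) / t\<^sup>2)"
      have "- (\<integral>y. V y * (w t y * indicator {\<epsilon>..s} t) \<partial>lborel)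
          = t / t ^ ?N * - (\<integral>y. V y * radial_laplacian K t (y - x) \<partial>lborel)"
        using True by (simp add: w_def mult.left_commute[of "V _"] del: times_divide_eq_left)
      also have "\<dots> \<le> t / t ^ ?N * (\<integral>y. h y * ?q y \<partial>lborel)"
        using t by (intro mult_left_mono sub) auto
      also have "\<dots> = (\<integral>y. h y * (t / t ^ ?N * ?q y) \<partial>lborel)"
        by (simp add: mult.left_commute[of "h _"] del: times_divide_eq_left)
      finally have "ennreal (- (\<integral>y. V y * (w t y * indicator {\<epsilon>..s} t) \<partial>lborel))
          \<le> ennreal (\<integral>y. h y * (t / t ^ ?N * ?q y) \<partial>lborel)"
        by (rule ennreal_leI)
      also have "\<dots> \<le> (\<integral>\<^sup>+y. ennreal (h y * (t / t ^ ?N * ?q y)) \<partial>lborel)"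
      proof (rule ennreal_integral_le_nn_integral, rule Bochner_Integration.integrable_bound)
        show "integrable lborel (\<lambda>y. h y * (t / t ^ ?N))" using h(1) by simp
        show "AE y in lborel. norm (h y * (t / t ^ ?N * ?q y)) \<le> norm (h y * (t / t ^ ?N))"
        proof (rule AE_I2)
          fix y
          have "?q y \<le> 1 / 2" by (rule bump_0_le[OF K]) simp
          then have "t / t ^ ?N * ?q y \<le> t / t ^ ?N * 1"
            using t by (intro mult_left_mono) auto
          then show "norm (h y * (t / t ^ ?N * ?q y)) \<le> norm (h y * (t / t ^ ?N))"
            using bump_0_nonneg[OF K] t h(2)[of y] mult_left_mono[of _ _ "h y"]
            by (simp add: abs_mult del: times_divide_eq_left times_divide_eq_right)
        qed
      qed measurable
      also have "\<dots> \<le> (\<integral>\<^sup>+y. ennreal (h y * mean_kernel s t (y - x)) \<partial>lborel)"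
      proof (intro nn_integral_mono ennreal_leI mult_left_mono h(2))
        fix y
        show "t / t ^ ?N * ?q y \<le> mean_kernel s t (y - x)"
        proof (cases "norm (y - x) < t")
          case in_ball: True
          have "?q y \<le> 1 / 2" by (rule bump_0_le[OF K]) simp
          then have "t / t ^ ?N * ?q y \<le> t / t ^ ?N * (1 / 2)"
            using t by (intro mult_left_mono) auto
          then show ?thesis using in_ball True t by (simp add: mean_kernel_def)
        next
          case False
          then have "?q y = 0"
            using t by (intro bump_zero[OF K] radial_arg_ge_1) (auto simp: dist_norm norm_minus_commute)
          then show ?thesis using False by (simp add: mean_kernel_def)
        qed
      qed
      finally show ?thesis .
    qed simp
  qed
  finally have pot: "ennreal (\<integral>t. - (\<integral>y. V y * (w t y * indicator {\<epsilon>..s} t) \<partial>lborel) \<partial>lborel)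
      \<le> mean_potential h s x" .
  \<comment> \<open>At the outer scale the cutoff is simply bounded by 1 on the whole space, which
    leaves the plain integral of \<open>V\<close>.\<close>
  have "smooth_mean s x \<le> (\<integral>y. V y * (1 / s ^ ?N) \<partial>lborel)"
    unfolding smooth_mean_def
    using V cutoff_le_1[OF K] s
    by (intro integral_mono integrable_smooth_mean) (auto intro!: mult_left_le divide_right_mono)
  then have "ennreal (smooth_mean \<epsilon> x) \<le> ennreal ((\<integral>y. V y \<partial>lborel) / s ^ ?N
      + max 0 (\<integral>t. - (\<integral>y. V y * (w t y * indicator {\<epsilon>..s} t) \<partial>lborel) \<partial>lborel))"
    unfolding eq by (intro ennreal_leI) auto
  also have "\<dots> = ennreal ((\<integral>y. V y \<partial>lborel) / s ^ ?N)
      + ennreal (max 0 (\<integral>t. - (\<integral>y. V y * (w t y * indicator {\<epsilon>..s} t) \<partial>lborel) \<partial>lborel))"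
    using s V(2) by (intro ennreal_plus) auto
  also have "\<dots> \<le> ennreal ((\<integral>y. V y \<partial>lborel) / s ^ ?N) + mean_potential h s x"
    using pot by (intro add_left_mono) (auto simp: max_def ennreal_neg)
  finally show ?thesis .
qed

end

section \<open>Masses of the kernels and the square integral of the potential\<close>

lemma nn_integral_lborel_affine:
  fixes f :: "'a::euclidean_space \<Rightarrow> ennreal"
  assumes [measurable]: "f \<in> borel_measurable borel" and c: "c > 0"
  shows "(\<integral>\<^sup>+x. f x \<partial>lborel) = ennreal (c ^ DIM('a)) * (\<integral>\<^sup>+x. f (a + c *\<^sub>R x) \<partial>lborel)"
  using c
  by (subst lborel_affine[of c a])
     (simp_all add: nn_integral_density nn_integral_distr nn_integral_cmult)

text \<open>The integration is over the centre \<open>x\<close>: when the averages are themselves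
  integrated over \<open>x\<close>, Tonelli leaves \<open>V y\<close> times this mass, which does
  not depend on the scale.\<close>

lemma nn_integral_cutoff_scale:
  fixes y :: "'a::euclidean_space"
  assumes "t > 0"
  shows "(\<integral>\<^sup>+x. ennreal (cutoff K ((y - x) \<bullet> (y - x) / t\<^sup>2) / t ^ DIM('a)) \<partial>lborel)
    = (\<integral>\<^sup>+z. ennreal (cutoff K ((z::'a) \<bullet> z)) \<partial>lborel)"
proof -
  have "(\<integral>\<^sup>+x. ennreal (cutoff K ((y - x) \<bullet> (y - x) / t\<^sup>2) / t ^ DIM('a)) \<partial>lborel)
      = ennreal (t ^ DIM('a)) * (\<integral>\<^sup>+z. ennreal (cutoff K ((z::'a) \<bullet> z) / t ^ DIM('a)) \<partial>lborel)"
    using assms by (subst nn_integral_lborel_affine[of _ t y]) (auto simp: power2_eq_square)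
  also have "\<dots> = (\<integral>\<^sup>+z. ennreal (t ^ DIM('a)) * ennreal (cutoff K ((z::'a) \<bullet> z) / t ^ DIM('a)) \<partial>lborel)"
    by (subst nn_integral_cmult) auto
  also have "\<dots> = (\<integral>\<^sup>+z. ennreal (cutoff K ((z::'a) \<bullet> z)) \<partial>lborel)"
    using assms by (intro nn_integral_cong) (simp add: ennreal_mult'[symmetric])
  finally show ?thesis .
qed

lemma cutoff_mass_ge:
  assumes "K > 0" "0 < \<eta>" "\<eta> < 1" "1 \<le> K * \<eta>"
  shows "ennreal ((1 - 1 / (K * \<eta>)) * (unit_ball_vol DIM('a) * (1 - \<eta>) ^ DIM('a)))
    \<le> (\<integral>\<^sup>+z. ennreal (cutoff K ((z::'a::euclidean_space) \<bullet> z)) \<partial>lborel)"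
proof -
  have "ennreal ((1 - 1 / (K * \<eta>)) * (unit_ball_vol DIM('a) * (1 - \<eta>) ^ DIM('a)))
      = ennreal (1 - 1 / (K * \<eta>)) * emeasure lborel (ball (0::'a) (1 - \<eta>))"
    using assms by (subst ennreal_mult) (auto simp: emeasure_ball field_simps)
  also have "\<dots> = (\<integral>\<^sup>+z. ennreal (1 - 1 / (K * \<eta>)) * indicator (ball (0::'a) (1 - \<eta>)) z \<partial>lborel)"
    by (simp add: nn_integral_cmult_indicator)
  also have "\<dots> \<le> (\<integral>\<^sup>+z. ennreal (cutoff K ((z::'a) \<bullet> z)) \<partial>lborel)"
  proof (intro nn_integral_mono)
    fix z :: 'a
    show "ennreal (1 - 1 / (K * \<eta>)) * indicator (ball 0 (1 - \<eta>)) z \<le> ennreal (cutoff K (z \<bullet> z))"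
    proof (cases "z \<in> ball 0 (1 - \<eta>)")
      case True
      \<comment> \<open>The cutoff takes the squared norm, which has to be at most
        \<open>1 - \<eta>\<close>; one of the two factors is bounded by 1.\<close>
      then have "norm z * norm z \<le> (1 - \<eta>) * 1"
        using assms by (intro mult_mono) auto
      then have "z \<bullet> z \<le> 1 - \<eta>"
        by (simp add: dot_square_norm power2_eq_square)
      then show ?thesis
        using True cutoff_ge[OF assms(1) _ assms(2)] by (simp add: ennreal_leI)
    qed simp
  qed
  finally show ?thesis .
qed

text \<open>Expanding \<open>(\<mu> * x - y)\<^sup>2 / \<mu> \<ge> 0\<close>. The weight keeps the
  coefficient of the main term \<open>a\<^sup>2\<close> close to 1 and puts the large constant on
  the error; it is used twice with \<open>\<mu> = \<delta>\<close>, whence the square of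
  \<open>1 + \<delta>\<close> in the contraction factor.\<close>

lemma ennreal_square_add_le:
  fixes a b :: ennreal
  assumes "\<mu> > 0"
  shows "(a + b)\<^sup>2 \<le> ennreal (1 + \<mu>) * a\<^sup>2 + ennreal (1 + 1 / \<mu>) * b\<^sup>2"
proof (cases a; cases b)
  fix x y assume *: "0 \<le> x" "a = ennreal x" "0 \<le> y" "b = ennreal y"
  have "0 \<le> (\<mu> * x - y)\<^sup>2 / \<mu>" using assms by simp
  also have "\<dots> = \<mu> * x\<^sup>2 + y\<^sup>2 / \<mu> - 2 * x * y"
    using assms by (simp add: power2_eq_square field_simps)
  finally have "(x + y)\<^sup>2 \<le> (1 + \<mu>) * x\<^sup>2 + (1 + 1 / \<mu>) * y\<^sup>2"
    by (simp add: power2_eq_square algebra_simps)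
  then have "ennreal ((x + y)\<^sup>2) \<le> ennreal ((1 + \<mu>) * x\<^sup>2 + (1 + 1 / \<mu>) * y\<^sup>2)"
    by (rule ennreal_leI)
  then show ?thesis
    using * assms by (simp add: ennreal_plus[symmetric] ennreal_mult'[symmetric] ennreal_power del: ennreal_plus)
qed (use assms in \<open>auto simp: ennreal_mult_top power2_eq_square top_add add_top\<close>)

lemma mean_kernel_measurable [measurable]:
  "(\<lambda>(t, z). mean_kernel s t z) \<in> borel_measurable (borel \<Otimes>\<^sub>M borel)"
  unfolding mean_kernel_def by measurable

lemma mean_kernel_nonneg [simp]: "mean_kernel s t z \<ge> 0"
  by (simp add: mean_kernel_def)

lemma mean_kernel_minus_commute: "mean_kernel s t (x - y) = mean_kernel s t (y - x)"
  by (simp add: mean_kernel_def norm_minus_commute)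

text \<open>The slice at scale \<open>t\<close> has mass \<open>\<omega> t / 2\<close> with \<omega>
  the volume of the unit ball, since \<open>t ^ N\<close> cancels; integrating over
  \<open>0 < t \<le> s\<close> gives \<open>\<omega> s^2 / 4\<close>.\<close>

lemma nn_integral_mean_kernel:
  fixes x :: "'a::euclidean_space"
  assumes "s > 0"
  shows "(\<integral>\<^sup>+t. (\<integral>\<^sup>+y. ennreal (mean_kernel s t (y - x)) \<partial>lborel) \<partial>lborel)
    = ennreal (unit_ball_vol DIM('a) * s\<^sup>2 / 4)"
proof -
  let ?\<omega> = "unit_ball_vol DIM('a)"
  have "(\<integral>\<^sup>+y. ennreal (mean_kernel s t (y - x)) \<partial>lborel) = ennreal (?\<omega> / 2 * t) * indicator {0..s} t" for t
  proof (cases "0 < t \<and> t \<le> s")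
    case True
    have "(\<integral>\<^sup>+y. ennreal (mean_kernel s t (y - x)) \<partial>lborel)
        = (\<integral>\<^sup>+y. ennreal (t / t ^ DIM('a) / 2) * indicator (ball x t) y \<partial>lborel)"
      using True by (intro nn_integral_cong) (auto simp: mean_kernel_def indicator_def dist_norm norm_minus_commute)
    also have "\<dots> = ennreal (t / t ^ DIM('a) / 2) * emeasure lborel (ball x t)"
      by (simp add: nn_integral_cmult_indicator)
    also have "\<dots> = ennreal (?\<omega> / 2 * t)"
      using True by (simp add: emeasure_ball ennreal_mult'[symmetric] field_simps)
    finally show ?thesis using True by simp
  qed (auto simp: mean_kernel_def indicator_def not_le)
  then have "(\<integral>\<^sup>+t. (\<integral>\<^sup>+y. ennreal (mean_kernel s t (y - x)) \<partial>lborel) \<partial>lborel)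
      = (\<integral>\<^sup>+t. ennreal (?\<omega> / 2 * t) * indicator {0..s} t \<partial>lborel)"
    by simp
  also have "\<dots> = ennreal (?\<omega> / 4 * s\<^sup>2 - ?\<omega> / 4 * 0\<^sup>2)"
    using assms by (intro nn_integral_FTC_Icc) (auto intro!: derivative_eq_intros)
  finally show ?thesis by simp
qed

lemma mean_potential_measurable [measurable]:
  assumes [measurable]: "h \<in> borel_measurable borel"
  shows "mean_potential h s \<in> borel_measurable borel"
  unfolding mean_potential_def[abs_def] by measurable

text \<open>Young's inequality in Schur's form: the mass of the kernel enters once through
  Cauchy-Schwarz in \<open>(t, y)\<close> and once more, by symmetry of the kernel, when
  \<open>x\<close> is integrated. Hence its square, of order \<open>s ^ 4\<close>.\<close>

lemma nn_integral_mean_potential_square: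
  fixes h :: "'a::euclidean_space \<Rightarrow> real"
  assumes [measurable]: "h \<in> borel_measurable borel" and h: "\<And>x. h x \<ge> 0" and s: "s > 0"
  shows "(\<integral>\<^sup>+x. (mean_potential h s x)\<^sup>2 \<partial>lborel)
    \<le> ennreal ((unit_ball_vol DIM('a) * s\<^sup>2 / 4)\<^sup>2) * (\<integral>\<^sup>+x. ennreal ((h x)\<^sup>2) \<partial>lborel)"
proof -
  let ?k = "mean_kernel s :: real \<Rightarrow> 'a \<Rightarrow> real"
  let ?c = "ennreal (unit_ball_vol DIM('a) * s\<^sup>2 / 4)"
  let ?P = "lborel \<Otimes>\<^sub>M lborel :: (real \<times> 'a) measure"
  have sq: "(mean_potential h s x)\<^sup>2
      \<le> (\<integral>\<^sup>+t. (\<integral>\<^sup>+y. ennreal ((h y)\<^sup>2 * ?k t (y - x)) \<partial>lborel) \<partial>lborel) * ?c" for x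
  proof -
    have "mean_potential h s x = (\<integral>\<^sup>+p. ennreal (h (snd p) * ?k (fst p) (snd p - x)) \<partial>?P)"
      unfolding mean_potential_def by (subst lborel.nn_integral_fst[symmetric]) auto
    \<comment> \<open>The kernel is split into two square roots, only one of which stays with
      \<open>h\<close>.\<close>
    also have "\<dots> = (\<integral>\<^sup>+p. ennreal (h (snd p) * sqrt (?k (fst p) (snd p - x)))
        * ennreal (sqrt (?k (fst p) (snd p - x))) \<partial>?P)"
      using h by (intro nn_integral_cong, subst ennreal_mult[symmetric]) (simp_all add: mult.assoc)
    finally have "(mean_potential h s x)\<^sup>2 \<le>
        (\<integral>\<^sup>+p. (ennreal (h (snd p) * sqrt (?k (fst p) (snd p - x))))\<^sup>2 \<partial>?P)
        * (\<integral>\<^sup>+p. (ennreal (sqrt (?k (fst p) (snd p - x))))\<^sup>2 \<partial>?P)"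
      by (simp only:) (rule Cauchy_Schwarz_nn_integral; measurable)
    also have "\<dots> = (\<integral>\<^sup>+p. ennreal ((h (snd p))\<^sup>2 * ?k (fst p) (snd p - x)) \<partial>?P)
        * (\<integral>\<^sup>+p. ennreal (?k (fst p) (snd p - x)) \<partial>?P)"
      using h
      by (intro arg_cong2[where f = "(*)"] nn_integral_cong) (simp_all add: ennreal_power power_mult_distrib)
    also have "(\<integral>\<^sup>+p. ennreal (?k (fst p) (snd p - x)) \<partial>?P) = ?c"
      unfolding nn_integral_mean_kernel[OF s, of x, symmetric]
      by (subst lborel.nn_integral_fst[symmetric]) auto
    also have "(\<integral>\<^sup>+p. ennreal ((h (snd p))\<^sup>2 * ?k (fst p) (snd p - x)) \<partial>?P)
        = (\<integral>\<^sup>+t. (\<integral>\<^sup>+y. ennreal ((h y)\<^sup>2 * ?k t (y - x)) \<partial>lborel) \<partial>lborel)"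
      by (subst lborel.nn_integral_fst[symmetric]) auto
    finally show ?thesis .
  qed
  have "(\<integral>\<^sup>+x. (mean_potential h s x)\<^sup>2 \<partial>lborel)
      \<le> (\<integral>\<^sup>+x. (\<integral>\<^sup>+t. (\<integral>\<^sup>+y. ennreal ((h y)\<^sup>2 * ?k t (y - x)) \<partial>lborel) \<partial>lborel) * ?c \<partial>lborel)"
    by (intro nn_integral_mono sq)
  also have "\<dots> = (\<integral>\<^sup>+x. (\<integral>\<^sup>+t. (\<integral>\<^sup>+y. ennreal ((h y)\<^sup>2 * ?k t (y - x)) \<partial>lborel) \<partial>lborel) \<partial>lborel) * ?c"
    by (intro nn_integral_multc) measurable
  \<comment> \<open>Three exchanges bring \<open>y\<close> outside and \<open>x\<close> innermost,
    so that \<open>(h y)\<^sup>2\<close> can be pulled out.\<close>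
  also have "(\<integral>\<^sup>+x. (\<integral>\<^sup>+t. (\<integral>\<^sup>+y. ennreal ((h y)\<^sup>2 * ?k t (y - x)) \<partial>lborel) \<partial>lborel) \<partial>lborel)
      = (\<integral>\<^sup>+t. (\<integral>\<^sup>+x. (\<integral>\<^sup>+y. ennreal ((h y)\<^sup>2 * ?k t (y - x)) \<partial>lborel) \<partial>lborel) \<partial>lborel)"
    by (rule lborel_pair.Fubini') measurable
  also have "\<dots> = (\<integral>\<^sup>+t. (\<integral>\<^sup>+y. (\<integral>\<^sup>+x. ennreal ((h y)\<^sup>2 * ?k t (y - x)) \<partial>lborel) \<partial>lborel) \<partial>lborel)"
    by (intro nn_integral_cong lborel_pair.Fubini') measurable
  also have "\<dots> = (\<integral>\<^sup>+y. (\<integral>\<^sup>+t. (\<integral>\<^sup>+x. ennreal ((h y)\<^sup>2 * ?k t (y - x)) \<partial>lborel) \<partial>lborel) \<partial>lborel)"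
    by (rule lborel_pair.Fubini') measurable
  also have "\<dots> = (\<integral>\<^sup>+y. ennreal ((h y)\<^sup>2) * ?c \<partial>lborel)"
  proof (intro nn_integral_cong)
    fix y :: 'a
    have "(\<integral>\<^sup>+t. (\<integral>\<^sup>+x. ennreal ((h y)\<^sup>2 * ?k t (y - x)) \<partial>lborel) \<partial>lborel)
       = (\<integral>\<^sup>+t. (\<integral>\<^sup>+x. ennreal ((h y)\<^sup>2) * ennreal (?k t (x - y)) \<partial>lborel) \<partial>lborel)"
      by (intro nn_integral_cong) (simp add: ennreal_mult' mean_kernel_nonneg mean_kernel_minus_commute[of s _ y])
    also have "\<dots> = ennreal ((h y)\<^sup>2) * (\<integral>\<^sup>+t. (\<integral>\<^sup>+x. ennreal (?k t (x - y)) \<partial>lborel) \<partial>lborel)"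
      by (simp add: nn_integral_cmult)
    finally show "(\<integral>\<^sup>+t. (\<integral>\<^sup>+x. ennreal ((h y)\<^sup>2 * ?k t (y - x)) \<partial>lborel) \<partial>lborel)
        = ennreal ((h y)\<^sup>2) * ?c"
      by (simp add: nn_integral_mean_kernel[OF s])
  qed
  also have "\<dots> = (\<integral>\<^sup>+y. ennreal ((h y)\<^sup>2) \<partial>lborel) * ?c"
    by (intro nn_integral_multc) measurable
  also have "\<dots> * ?c = ennreal ((unit_ball_vol DIM('a) * s\<^sup>2 / 4)\<^sup>2) * (\<integral>\<^sup>+x. ennreal ((h x)\<^sup>2) \<partial>lborel)"
    by (simp add: ennreal_power[symmetric] power2_eq_square[of ?c] mult_ac)
  finally show ?thesis .
qed

text \<open>A Borel set is approximated from outside by open sets with respect to the finite measure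
  \<open>density M g\<close>, and the inequality on these passes to the infimum. This stands for the
  limit of the averages at almost every point.\<close>

lemma density_le_densityI:
  fixes f g :: "'a::{second_countable_topology, complete_space} \<Rightarrow> ennreal"
  assumes [measurable]: "f \<in> borel_measurable borel" "g \<in> borel_measurable borel"
    and M: "sets M = sets borel"
    and fin: "(\<integral>\<^sup>+x. g x \<partial>M) < \<infinity>"
    and le: "\<And>U. open U \<Longrightarrow> (\<integral>\<^sup>+x. f x * indicator U x \<partial>M) \<le> (\<integral>\<^sup>+x. g x * indicator U x \<partial>M)"
  shows "density M f \<le> density M g"
proof -
  have [measurable]: "f \<in> borel_measurable M" "g \<in> borel_measurable M"
    using assms(1,2) by (simp_all cong: measurable_cong_sets add: measurable_cong_sets[OF M refl])
  have emf: "emeasure (density M f) A = (\<integral>\<^sup>+x. f x * indicator A x \<partial>M)"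
    and emg: "emeasure (density M g) A = (\<integral>\<^sup>+x. g x * indicator A x \<partial>M)" if "A \<in> sets borel" for A
    using that M by (auto simp: emeasure_density)
  have "emeasure (density M f) A \<le> emeasure (density M g) A" if A: "A \<in> sets borel" for A
  proof -
    have "emeasure (density M g) A = (INF U \<in> {U. A \<subseteq> U \<and> open U}. emeasure (density M g) U)"
    proof (rule outer_regular[OF _ _ A])
      show "sets (density M g) = sets borel" using M by simp
      have "space M \<in> sets M" by simp
      then have "emeasure (density M g) (space (density M g)) = (\<integral>\<^sup>+x. g x * indicator (space M) x \<partial>M)"
        by (simp add: emeasure_density)
      also have "\<dots> = (\<integral>\<^sup>+x. g x \<partial>M)" by (intro nn_integral_cong) simp
      finally show "emeasure (density M g) (space (density M g)) \<noteq> \<infinity>"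
        using fin by simp
    qed
    also have "\<dots> \<ge> emeasure (density M f) A"
    proof (intro INF_greatest, safe)
      fix U :: "'a set" assume U: "A \<subseteq> U" "open U"
      have "emeasure (density M f) A \<le> emeasure (density M f) U"
        using U M by (intro emeasure_mono) auto
      also have "\<dots> \<le> emeasure (density M g) U"
        using U le by (simp add: emf emg)
      finally show "emeasure (density M f) A \<le> emeasure (density M g) U" .
    qed
    finally show ?thesis .
  qed
  then show ?thesis using M by (subst le_measure) auto
qed

context subsolution
begin

definition bound_fun :: "real \<Rightarrow> 'a \<Rightarrow> ennreal" where
  "bound_fun s x = ennreal ((\<integral>y. V y \<partial>lborel) / s ^ DIM('a)) + mean_potential h s x"

lemma bound_fun_measurable [measurable]: "bound_fun s \<in> borel_measurable borel"
  unfolding bound_fun_def[abs_def] by measurable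

text \<open>The averages at scale \<open>s / Suc n\<close> are integrated over \<open>A\<close>. By
  Tonelli this weighs \<open>V y\<close> with the part of the kernel mass around \<open>y\<close>
  that falls into \<open>A\<close>; for \<open>y\<close> in the open set \<open>A\<close> it is
  eventually the whole mass, at least \<open>c\<close>, and Fatou's lemma gives the claim. Centres
  in \<open>ball 0 (r - s)\<close> keep the balls of radius \<open>s\<close> inside
  \<open>ball 0 r\<close>.\<close>

lemma nn_integral_V_open_le:
  assumes "open A" "A \<subseteq> ball 0 (r - s)" "s > 0"
    and c: "c \<le> (\<integral>\<^sup>+z. ennreal (cutoff K ((z::'a) \<bullet> z)) \<partial>lborel)"
  shows "(\<integral>\<^sup>+x. c * ennreal (V x) * indicator A x \<partial>lborel) \<le> (\<integral>\<^sup>+x. bound_fun s x * indicator A x \<partial>lborel)"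
proof -
  define k where "k n y x = cutoff K ((y - x) \<bullet> (y - x) / (s / Suc n)\<^sup>2) / (s / Suc n) ^ DIM('a)"
    for n :: nat and x y :: 'a
  have [measurable]: "A \<in> sets borel" using assms(1) by simp
  have [measurable]: "(\<lambda>(y, x). k n y x) \<in> borel_measurable (borel \<Otimes>\<^sub>M borel)" for n
    unfolding k_def by measurable
  \<comment> \<open>\<open>Suc n\<close> keeps the radii positive and not above \<open>s\<close>, as
    \<open>mean_value_inequality\<close> requires.\<close>
  have eps: "0 < s / Suc n" "s / Suc n \<le> s" for n
    using assms(3) by (auto simp: field_simps)
  have k0: "k n y x \<ge> 0" for n y x
    using eps(1)[of n] cutoff_nonneg[OF K] by (auto simp: k_def simp del: of_nat_Suc)
  define u where "u n y = ennreal (V y) * (\<integral>\<^sup>+x. ennreal (k n y x) * indicator A x \<partial>lborel)" for n y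
  have [measurable]: "u n \<in> borel_measurable borel" for n unfolding u_def by measurable
  have lower: "c * ennreal (V y) * indicator A y \<le> liminf (\<lambda>n. u n y)" for y
  proof (cases "y \<in> A")
    case True
    then obtain e where e: "e > 0" "ball y e \<subseteq> A" using assms(1) open_contains_ball by blast
    have "\<forall>\<^sub>F n in sequentially. s / Suc n < e"
      using LIMSEQ_Suc[OF lim_const_over_n[of s]] e(1) by (rule order_tendstoD)
    then have "\<forall>\<^sub>F n in sequentially. c * ennreal (V y) * indicator A y \<le> u n y"
    proof eventually_elim
      case (elim n)
      have "(\<integral>\<^sup>+x. ennreal (k n y x) * indicator A x \<partial>lborel) = (\<integral>\<^sup>+x. ennreal (k n y x) \<partial>lborel)"
      proof (intro nn_integral_cong)
        fix x
        show "ennreal (k n y x) * indicator A x = ennreal (k n y x)"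
        proof (cases "x \<in> A")
          case False
          then have "dist x y \<ge> s / Suc n" using e(2) elim by (force simp: dist_commute)
          then have "k n y x = 0"
            using radial_arg_ge_1[OF eps(1)[of n]] cutoff_zero[OF K] by (auto simp: k_def)
          then show ?thesis by simp
        qed simp
      qed
      also have "\<dots> \<ge> c"
        unfolding k_def nn_integral_cutoff_scale[OF eps(1)] by (rule c)
      finally show ?case
        using True by (simp add: u_def mult.commute[of c] mult_left_mono)
    qed
    then show ?thesis by (rule Liminf_bounded)
  qed simp
  have upper: "(\<integral>\<^sup>+y. u n y \<partial>lborel) \<le> (\<integral>\<^sup>+x. bound_fun s x * indicator A x \<partial>lborel)" for n
  proof -
    have "(\<integral>\<^sup>+y. u n y \<partial>lborel) = (\<integral>\<^sup>+y. (\<integral>\<^sup>+x. ennreal (V y) * (ennreal (k n y x) * indicator A x) \<partial>lborel) \<partial>lborel)"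
      unfolding u_def by (simp add: nn_integral_cmult)
    also have "\<dots> = (\<integral>\<^sup>+x. (\<integral>\<^sup>+y. ennreal (V y) * (ennreal (k n y x) * indicator A x) \<partial>lborel) \<partial>lborel)"
      by (rule lborel_pair.Fubini'[symmetric]) measurable
    also have "\<dots> \<le> (\<integral>\<^sup>+x. bound_fun s x * indicator A x \<partial>lborel)"
    proof (intro nn_integral_mono)
      fix x
      show "(\<integral>\<^sup>+y. ennreal (V y) * (ennreal (k n y x) * indicator A x) \<partial>lborel) \<le> bound_fun s x * indicator A x"
      proof (cases "x \<in> A")
        case True
        then have x: "cball x s \<subseteq> ball 0 r"
          using assms(2) by (subst cball_subset_ball_iff) auto
        have "(\<integral>\<^sup>+y. ennreal (V y) * (ennreal (k n y x) * indicator A x) \<partial>lborel)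
            = (\<integral>\<^sup>+y. ennreal (V y * k n y x) \<partial>lborel)"
          using True V(2) k0 by (simp add: ennreal_mult)
        also have "\<dots> = ennreal (smooth_mean (s / Suc n) x)"
          using integrable_smooth_mean[OF eps(1)[of n], of x] V(2) k0
          unfolding smooth_mean_def k_def[symmetric] by (intro nn_integral_eq_integral) auto
        also have "\<dots> \<le> bound_fun s x"
          unfolding bound_fun_def by (rule mean_value_inequality[OF eps x])
        finally show ?thesis using True by simp
      qed simp
    qed
    finally show ?thesis .
  qed
  have "(\<integral>\<^sup>+x. c * ennreal (V x) * indicator A x \<partial>lborel) \<le> (\<integral>\<^sup>+x. liminf (\<lambda>n. u n x) \<partial>lborel)"
    by (intro nn_integral_mono lower)
  also have "\<dots> \<le> liminf (\<lambda>n. \<integral>\<^sup>+x. u n x \<partial>lborel)"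
    by (intro nn_integral_liminf) measurable
  also have "\<dots> \<le> (\<integral>\<^sup>+x. bound_fun s x * indicator A x \<partial>lborel)"
    using upper by (intro Liminf_le) auto
  finally show ?thesis .
qed

end

subsection \<open>Contraction of the mean square\<close>

context subsolution
begin

text \<open>The inequality of measures, integrated against \<open>V\<close>, bounds
  \<open>c * ?X\<close> by an integral of \<open>V\<close> times \<open>bound_fun\<close>. By
  Cauchy-Schwarz \<open>(c * ?X)\<^sup>2 \<le> ?X * ?Y\<close>, and one factor \<open>?X\<close>
  cancels because it is finite.\<close>

lemma L2_bound:
  assumes "0 < s" "s < r" "\<mu> > 0"
    and c: "ennreal c \<le> (\<integral>\<^sup>+z. ennreal (cutoff K ((z::'a) \<bullet> z)) \<partial>lborel)" "c > 0"
    and V2: "(\<integral>\<^sup>+x. ennreal ((V x)\<^sup>2) \<partial>lborel) < \<infinity>"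
    and h2: "(\<integral>\<^sup>+x. ennreal ((h x)\<^sup>2) \<partial>lborel) < \<infinity>"
  shows "(\<integral>\<^sup>+x\<in>ball 0 (r - s). ennreal ((V x)\<^sup>2) \<partial>lborel)
    \<le> ennreal (1 / c\<^sup>2) *
      (ennreal (1 + \<mu>) * (ennreal ((\<integral>y. V y \<partial>lborel) / s ^ DIM('a)))\<^sup>2 * emeasure lborel (ball (0::'a) (r - s))
       + ennreal (1 + 1 / \<mu>) * (ennreal ((unit_ball_vol DIM('a) * s\<^sup>2 / 4)\<^sup>2)
           * (\<integral>\<^sup>+x. ennreal ((h x)\<^sup>2) \<partial>lborel)))"
    (is "?X \<le> _ * ?Y")
proof -
  let ?B = "ball (0::'a) (r - s)"
  let ?a = "ennreal ((\<integral>y. V y \<partial>lborel) / s ^ DIM('a))"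
  let ?i = "indicator ?B :: 'a \<Rightarrow> ennreal"
  have [measurable]: "?B \<in> sets borel" by simp
  have Y: "(\<integral>\<^sup>+x. (bound_fun s x * ?i x)\<^sup>2 \<partial>lborel) \<le> ?Y"
  proof -
    have "(\<integral>\<^sup>+x. (bound_fun s x * ?i x)\<^sup>2 \<partial>lborel)
        \<le> (\<integral>\<^sup>+x. ennreal (1 + \<mu>) * ?a\<^sup>2 * ?i x + ennreal (1 + 1 / \<mu>) * (mean_potential h s x)\<^sup>2 \<partial>lborel)"
      using ennreal_square_add_le[OF assms(3)]
      by (intro nn_integral_mono) (auto simp: bound_fun_def indicator_def)
    also have "\<dots> = ennreal (1 + \<mu>) * ?a\<^sup>2 * emeasure lborel ?B
        + ennreal (1 + 1 / \<mu>) * (\<integral>\<^sup>+x. (mean_potential h s x)\<^sup>2 \<partial>lborel)"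
      by (subst nn_integral_add) (auto simp: nn_integral_cmult nn_integral_cmult_indicator)
    also have "\<dots> \<le> ?Y"
      using nn_integral_mean_potential_square[OF h_measurable h(2) assms(1)]
      by (intro add_left_mono mult_left_mono) auto
    finally show ?thesis .
  qed
  have ballfin: "emeasure lborel ?B < \<infinity>" by (rule emeasure_lborel_ball_finite)
  have Yfin: "?Y < \<infinity>"
    using ballfin h2 by (auto simp: ennreal_mult_less_top power_less_top_ennreal)
  \<comment> \<open>Cauchy-Schwarz against the indicator of the ball; outer regularity needs this
    finiteness.\<close>
  have fin: "(\<integral>\<^sup>+x. bound_fun s x * ?i x \<partial>lborel) < \<infinity>"
  proof -
    have "(\<integral>\<^sup>+x. (bound_fun s x * ?i x) * ?i x \<partial>lborel)\<^sup>2
        \<le> (\<integral>\<^sup>+x. (bound_fun s x * ?i x)\<^sup>2 \<partial>lborel) * (\<integral>\<^sup>+x. (?i x)\<^sup>2 \<partial>lborel)"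
      by (rule Cauchy_Schwarz_nn_integral) measurable
    also have "(\<integral>\<^sup>+x. (?i x)\<^sup>2 \<partial>lborel) = (\<integral>\<^sup>+x. ?i x \<partial>lborel)"
      by (intro nn_integral_cong) (auto simp: indicator_def)
    also have "(\<integral>\<^sup>+x. (bound_fun s x * ?i x)\<^sup>2 \<partial>lborel) * (\<integral>\<^sup>+x. ?i x \<partial>lborel) < \<infinity>"
      using le_less_trans[OF Y Yfin] ballfin by (simp add: ennreal_mult_less_top)
    also have "(\<integral>\<^sup>+x. (bound_fun s x * ?i x) * ?i x \<partial>lborel) = (\<integral>\<^sup>+x. bound_fun s x * ?i x \<partial>lborel)"
      by (intro nn_integral_cong) (auto simp: indicator_def)
    finally show ?thesis by (simp add: power_less_top_ennreal)
  qed
  define f where "f x = ennreal c * ennreal (V x) * ?i x" for x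
  define g where "g x = bound_fun s x * ?i x" for x
  have [measurable]: "f \<in> borel_measurable borel" "g \<in> borel_measurable borel"
    unfolding f_def g_def by measurable
  have dens: "density lborel f \<le> density lborel g"
  proof (rule density_le_densityI)
    fix U :: "'a set" assume "open U"
    then have "(\<integral>\<^sup>+x. ennreal c * ennreal (V x) * indicator (U \<inter> ?B) x \<partial>lborel)
        \<le> (\<integral>\<^sup>+x. bound_fun s x * indicator (U \<inter> ?B) x \<partial>lborel)"
      using assms(1) c(1) by (intro nn_integral_V_open_le) auto
    then show "(\<integral>\<^sup>+x. f x * indicator U x \<partial>lborel) \<le> (\<integral>\<^sup>+x. g x * indicator U x \<partial>lborel)"
      by (simp add: f_def g_def indicator_inter_arith mult_ac)
  qed (use fin in \<open>simp_all add: g_def\<close>)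
  have "ennreal c * ?X = (\<integral>\<^sup>+x. f x * ennreal (V x) \<partial>lborel)"
    using V(2) by (simp add: f_def nn_integral_cmult[symmetric] power2_eq_square ennreal_mult mult_ac)
  also have "\<dots> = (\<integral>\<^sup>+x. ennreal (V x) \<partial>density lborel f)"
    by (simp add: nn_integral_density)
  also have "\<dots> \<le> (\<integral>\<^sup>+x. ennreal (V x) \<partial>density lborel g)"
    by (intro nn_integral_mono_measure dens) simp
  also have "\<dots> = (\<integral>\<^sup>+x. (ennreal (V x) * ?i x) * (bound_fun s x * ?i x) \<partial>lborel)"
    by (simp add: nn_integral_density g_def mult_ac)
       (auto intro!: nn_integral_cong simp: indicator_def mult_ac)
  finally have "(ennreal c * ?X)\<^sup>2 \<le> (\<integral>\<^sup>+x. (ennreal (V x) * ?i x) * (bound_fun s x * ?i x) \<partial>lborel)\<^sup>2"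
    by (intro power_mono) auto
  also have "\<dots> \<le> (\<integral>\<^sup>+x. (ennreal (V x) * ?i x)\<^sup>2 \<partial>lborel) * (\<integral>\<^sup>+x. (bound_fun s x * ?i x)\<^sup>2 \<partial>lborel)"
    by (rule Cauchy_Schwarz_nn_integral) measurable
  also have "(\<integral>\<^sup>+x. (ennreal (V x) * ?i x)\<^sup>2 \<partial>lborel) = ?X"
    using V(2) by (intro nn_integral_cong) (auto simp: indicator_def ennreal_power)
  also have "?X * (\<integral>\<^sup>+x. (bound_fun s x * ?i x)\<^sup>2 \<partial>lborel) \<le> ?X * ?Y"
    by (intro mult_left_mono Y) simp
  finally have main: "(ennreal c * ?X)\<^sup>2 \<le> ?X * ?Y" .
  have "?X \<le> (\<integral>\<^sup>+x. ennreal ((V x)\<^sup>2) \<partial>lborel)"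
    by (intro nn_integral_mono) (auto simp: indicator_def)
  then have "?X < \<infinity>" using V2 by simp
  then obtain x where x: "?X = ennreal x" "x \<ge> 0" by (auto simp: less_top_ennreal)
  obtain y where y: "?Y = ennreal y" "y \<ge> 0" using Yfin by (auto simp: less_top_ennreal)
  have "(c * x)\<^sup>2 \<le> x * y"
    using main x y c(2) by (simp add: ennreal_mult[symmetric] ennreal_power)
  then have "x \<le> 1 / c\<^sup>2 * y"
    using x(2) y(2) c(2) by (cases "x = 0") (auto simp: power2_eq_square field_simps)
  then show ?thesis
    using x y c(2) by (simp add: ennreal_mult[symmetric] ennreal_leI)
qed

text \<open>Bookkeeping of constants with \<open>s = (1 - \<delta>) * r\<close>. The two divisions
  by \<open>s ^ N\<close> cost \<open>(1 - \<delta>)^(-2N)\<close>, and \<open>1 / c\<^sup>2\<close>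
  costs \<open>(1 - \<delta>)^(-2N-2)\<close>. The volumes of the unit ball cancel exactly, and
  \<open>\<delta> ^ N\<close> is the ratio of the volumes of the two balls, so per unit volume only
  \<open>1 - \<theta>\<close> and factors tending to 1 remain.\<close>

lemma L2_decay:
  assumes r: "r > 0" and \<delta>: "0 < \<delta>" "\<delta> < 1" and \<theta>: "\<theta> < 1" and K_eq: "K = 1 / \<delta>\<^sup>2"
    and V2: "(\<integral>\<^sup>+x. ennreal ((V x)\<^sup>2) \<partial>lborel) < \<infinity>"
    and h2: "(\<integral>\<^sup>+x. ennreal ((h x)\<^sup>2) \<partial>lborel) < \<infinity>"
    and P [measurable]: "P \<in> sets borel" and VP: "\<And>y. y \<notin> P \<Longrightarrow> V y = 0"
    and vol: "emeasure lborel P \<le> ennreal ((1 - \<theta>) * (unit_ball_vol DIM('a) * r ^ DIM('a)))"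
  shows "(\<integral>\<^sup>+x\<in>ball 0 (\<delta> * r). ennreal ((V x)\<^sup>2) \<partial>lborel)
    \<le> ennreal ((1 + \<delta>) * (1 - \<theta>) / (1 - \<delta>) ^ (4 * DIM('a) + 2) * \<delta> ^ DIM('a))
        * (\<integral>\<^sup>+x. ennreal ((V x)\<^sup>2) \<partial>lborel)
      + ennreal ((1 + 1 / \<delta>) / (1 - \<delta>) ^ (2 * DIM('a) + 2) * r ^ 4)
        * (\<integral>\<^sup>+x. ennreal ((h x)\<^sup>2) \<partial>lborel)"
proof -
  let ?N = "DIM('a)" and ?\<omega> = "unit_ball_vol DIM('a)"
  define s where "s = (1 - \<delta>) * r"
  \<comment> \<open>The bound of \<open>cutoff_mass_ge\<close> for \<open>\<eta> = \<delta>\<close>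
    and \<open>K = 1 / \<delta>\<^sup>2\<close>, where
    \<open>1 / (K * \<eta>) = \<delta>\<close>.\<close>
  define c where "c = (1 - \<delta>) * (?\<omega> * (1 - \<delta>) ^ ?N)"
  have s: "0 < s" "s < r" "s \<le> r" "r - s = \<delta> * r"
    using r \<delta> by (auto simp: s_def algebra_simps)
  have \<omega>: "?\<omega> > 0" by simp
  have c0: "c > 0" using \<delta> by (simp add: c_def)
  have "ennreal ((1 - 1 / (K * \<delta>)) * (?\<omega> * (1 - \<delta>) ^ ?N))
      \<le> (\<integral>\<^sup>+z. ennreal (cutoff K ((z::'a) \<bullet> z)) \<partial>lborel)"
    using \<delta> K by (intro cutoff_mass_ge) (auto simp: K_eq power2_eq_square)
  then have c: "ennreal c \<le> (\<integral>\<^sup>+z. ennreal (cutoff K ((z::'a) \<bullet> z)) \<partial>lborel)"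
    using \<delta> by (simp add: c_def K_eq power2_eq_square)
  obtain x where x: "(\<integral>\<^sup>+x. ennreal ((V x)\<^sup>2) \<partial>lborel) = ennreal x" "x \<ge> 0"
    using V2 by (auto simp: less_top_ennreal)
  obtain y where y: "(\<integral>\<^sup>+x. ennreal ((h x)\<^sup>2) \<partial>lborel) = ennreal y" "y \<ge> 0"
    using h2 by (auto simp: less_top_ennreal)
  define m where "m = (\<integral>y. V y \<partial>lborel)"
  have m0: "m \<ge> 0" unfolding m_def using V(2) by simp
  \<comment> \<open>Cauchy-Schwarz over \<open>P\<close> alone instead of the whole ball: this is
    where the factor \<open>1 - \<theta>\<close> is gained.\<close>
  have m2: "m\<^sup>2 \<le> x * ((1 - \<theta>) * (?\<omega> * r ^ ?N))"
  proof -
    have "ennreal m = (\<integral>\<^sup>+y. ennreal (V y) * indicator P y \<partial>lborel)"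
      unfolding m_def using V(1,2) VP
      by (subst nn_integral_eq_integral[symmetric]) (auto intro!: nn_integral_cong simp: indicator_def)
    then have "(ennreal m)\<^sup>2 \<le> (\<integral>\<^sup>+y. (ennreal (V y))\<^sup>2 \<partial>lborel) * (\<integral>\<^sup>+y. (indicator P y)\<^sup>2 \<partial>lborel)"
      by (simp only:) (rule Cauchy_Schwarz_nn_integral; measurable)
    also have "(\<integral>\<^sup>+y. (ennreal (V y))\<^sup>2 \<partial>lborel) = ennreal x"
      unfolding x(1)[symmetric] using V(2) by (simp add: ennreal_power)
    also have "(\<integral>\<^sup>+y. (indicator P y :: ennreal)\<^sup>2 \<partial>lborel) = (\<integral>\<^sup>+y. indicator P y \<partial>lborel)"
      by (intro nn_integral_cong) (auto simp: indicator_def)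
    also have "\<dots> = emeasure lborel P" by simp
    also have "ennreal x * emeasure lborel P \<le> ennreal x * ennreal ((1 - \<theta>) * (?\<omega> * r ^ ?N))"
      by (intro mult_left_mono vol) simp
    finally show ?thesis
      using x(2) m0 \<theta> r \<omega> by (simp add: ennreal_power ennreal_mult[symmetric])
  qed
  have "(\<integral>\<^sup>+x\<in>ball 0 (\<delta> * r). ennreal ((V x)\<^sup>2) \<partial>lborel)
    \<le> ennreal (1 / c\<^sup>2) * (ennreal (1 + \<delta>) * (ennreal (m / s ^ ?N))\<^sup>2 * ennreal (?\<omega> * (\<delta> * r) ^ ?N)
       + ennreal (1 + 1 / \<delta>) * (ennreal ((?\<omega> * s\<^sup>2 / 4)\<^sup>2) * ennreal y))"
    using L2_bound[OF s(1,2) \<delta>(1) c c0 V2 h2] r \<delta> unfolding s(4) y m_def[symmetric]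
    by (simp add: emeasure_ball)
  also have "\<dots> = ennreal (1 / c\<^sup>2 * ((1 + \<delta>) * (m / s ^ ?N)\<^sup>2 * (?\<omega> * (\<delta> * r) ^ ?N)
       + (1 + 1 / \<delta>) * ((?\<omega> * s\<^sup>2 / 4)\<^sup>2 * y)))"
    using m0 s(1) \<delta> r \<omega> y(2)
    by (simp add: ennreal_power ennreal_mult[symmetric] ennreal_plus[symmetric] del: ennreal_plus)
  also have "\<dots> \<le> ennreal ((1 + \<delta>) * (1 - \<theta>) / (1 - \<delta>) ^ (4 * ?N + 2) * \<delta> ^ ?N * x
      + (1 + 1 / \<delta>) / (1 - \<delta>) ^ (2 * ?N + 2) * r ^ 4 * y)"
  proof (rule ennreal_leI)
    have cancel1: "p * (x * (z * (w * A)) / (D * A\<^sup>2)) * (w * (e * A)) = w\<^sup>2 * (p * z / D * e * x)"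
      if "A > 0" "D > 0" for p x z w A D e :: real
      using that by (simp add: power2_eq_square)
    have cancel2: "1 / (w\<^sup>2 * E) * (w\<^sup>2 * (p * z / D * e * x) + w\<^sup>2 * (q * R * y))
        = p * z / (D * E) * e * x + q / E * R * y"
      if "w > 0" "D > 0" "E > 0" for w E p z D e x q R y :: real
      using that by (simp add: add_divide_distrib distrib_left)
    have d1: "1 - \<delta> > 0" using \<delta> by simp
    have c2: "c\<^sup>2 = ?\<omega>\<^sup>2 * (1 - \<delta>) ^ (2 * ?N + 2)"
      by (simp add: c_def power_mult_distrib power_add power_mult power2_eq_square mult_ac)
    have s2: "(s ^ ?N)\<^sup>2 = (1 - \<delta>) ^ (2 * ?N) * (r ^ ?N)\<^sup>2"
      by (simp add: s_def power_mult_distrib power_mult[symmetric] mult.commute)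
    have "(1 + \<delta>) * (m / s ^ ?N)\<^sup>2 * (?\<omega> * (\<delta> * r) ^ ?N)
        \<le> (1 + \<delta>) * (x * ((1 - \<theta>) * (?\<omega> * r ^ ?N)) / (s ^ ?N)\<^sup>2) * (?\<omega> * (\<delta> * r) ^ ?N)"
      using m2 \<delta> r \<omega> by (intro mult_right_mono mult_left_mono) (auto simp: power_divide divide_right_mono)
    also have "\<dots> = ?\<omega>\<^sup>2 * ((1 + \<delta>) * (1 - \<theta>) / (1 - \<delta>) ^ (2 * ?N) * \<delta> ^ ?N * x)"
      unfolding s2 power_mult_distrib[of \<delta> r] using r d1 by (intro cancel1) auto
    finally have 1: "(1 + \<delta>) * (m / s ^ ?N)\<^sup>2 * (?\<omega> * (\<delta> * r) ^ ?N)
        \<le> ?\<omega>\<^sup>2 * ((1 + \<delta>) * (1 - \<theta>) / (1 - \<delta>) ^ (2 * ?N) * \<delta> ^ ?N * x)" .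
    \<comment> \<open>The potential is an error term, for which a crude bound suffices.\<close>
    have "s\<^sup>2 \<le> r\<^sup>2" using s by (intro power_mono) auto
    then have "s\<^sup>2 / 4 \<le> r\<^sup>2" using zero_le_power2[of r] by linarith
    then have "(?\<omega> * s\<^sup>2 / 4)\<^sup>2 \<le> (?\<omega> * r\<^sup>2)\<^sup>2"
      using \<omega> mult_left_mono[of "s\<^sup>2 / 4" "r\<^sup>2" ?\<omega>] by (intro power_mono) auto
    also have "\<dots> = ?\<omega>\<^sup>2 * r ^ 4"
      by (simp add: power_mult_distrib power_mult[symmetric])
    finally have "(?\<omega> * s\<^sup>2 / 4)\<^sup>2 \<le> ?\<omega>\<^sup>2 * r ^ 4" .
    then have "(1 + 1 / \<delta>) * ((?\<omega> * s\<^sup>2 / 4)\<^sup>2 * y) \<le> (1 + 1 / \<delta>) * (?\<omega>\<^sup>2 * r ^ 4 * y)"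
      using y(2) \<delta> by (intro mult_left_mono mult_right_mono) auto
    then have 2: "(1 + 1 / \<delta>) * ((?\<omega> * s\<^sup>2 / 4)\<^sup>2 * y) \<le> ?\<omega>\<^sup>2 * ((1 + 1 / \<delta>) * r ^ 4 * y)"
      by (simp add: mult_ac)
    have "1 / c\<^sup>2 * ((1 + \<delta>) * (m / s ^ ?N)\<^sup>2 * (?\<omega> * (\<delta> * r) ^ ?N) + (1 + 1 / \<delta>) * ((?\<omega> * s\<^sup>2 / 4)\<^sup>2 * y))
      \<le> 1 / c\<^sup>2 * (?\<omega>\<^sup>2 * ((1 + \<delta>) * (1 - \<theta>) / (1 - \<delta>) ^ (2 * ?N) * \<delta> ^ ?N * x)
          + ?\<omega>\<^sup>2 * ((1 + 1 / \<delta>) * r ^ 4 * y))"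
      using 1 2 by (intro mult_left_mono add_mono) auto
    also have "\<dots> = (1 + \<delta>) * (1 - \<theta>) / ((1 - \<delta>) ^ (2 * ?N) * (1 - \<delta>) ^ (2 * ?N + 2)) * \<delta> ^ ?N * x
      + (1 + 1 / \<delta>) / (1 - \<delta>) ^ (2 * ?N + 2) * r ^ 4 * y"
      unfolding c2 using \<omega> d1 by (intro cancel2) auto
    also have "(1 - \<delta>) ^ (2 * ?N) * (1 - \<delta>) ^ (2 * ?N + 2) = (1 - \<delta>) ^ (4 * ?N + 2)"
      by (simp add: power_add[symmetric])
    finally show "1 / c\<^sup>2 * ((1 + \<delta>) * (m / s ^ ?N)\<^sup>2 * (?\<omega> * (\<delta> * r) ^ ?N) + (1 + 1 / \<delta>) * ((?\<omega> * s\<^sup>2 / 4)\<^sup>2 * y))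
      \<le> (1 + \<delta>) * (1 - \<theta>) / (1 - \<delta>) ^ (4 * ?N + 2) * \<delta> ^ ?N * x
      + (1 + 1 / \<delta>) / (1 - \<delta>) ^ (2 * ?N + 2) * r ^ 4 * y" .
  qed
  also have "\<dots> = ennreal ((1 + \<delta>) * (1 - \<theta>) / (1 - \<delta>) ^ (4 * ?N + 2) * \<delta> ^ ?N) * ennreal x
      + ennreal ((1 + 1 / \<delta>) / (1 - \<delta>) ^ (2 * ?N + 2) * r ^ 4) * ennreal y"
    unfolding ennreal_mult''[OF x(2), symmetric] ennreal_mult''[OF y(2), symmetric]
    using \<delta> \<theta> r x y by (intro ennreal_plus mult_nonneg_nonneg divide_nonneg_nonneg) auto
  finally show ?thesis unfolding x y .
qed

end

section \<open>From Lebesgue measurable weak subsolutions to Borel representatives\<close>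

text \<open>A Borel function agrees with \<open>v\<close> on \<open>B\<close> only almost
  everywhere. Taking its maximum with 0 and cutting it off outside \<open>P\<close> restores sign
  and support at every point, and changes it only on a null set because \<open>v\<close> has both
  properties.\<close>

lemma borel_version:
  fixes v :: "'a::euclidean_space \<Rightarrow> real"
  assumes "set_borel_measurable lebesgue B v"
    and [measurable]: "P \<in> sets borel" and P: "P \<subseteq> B" "\<And>x. x \<in> B - P \<Longrightarrow> v x = 0"
    and v: "\<And>x. v x \<ge> 0"
  obtains V where "V \<in> borel_measurable borel" "\<And>x. V x \<ge> 0" "\<And>x. x \<notin> P \<Longrightarrow> V x = 0"
    "AE x in lebesgue. V x = indicator B x * v x"
proof -
  have "(\<lambda>x. indicator B x * v x) \<in> borel_measurable (completion lborel)"
    using assms(1) by (simp add: set_borel_measurable_def)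
  from completion_ex_borel_measurable_real[OF this] obtain W where
    [measurable]: "W \<in> borel_measurable lborel" and W: "AE x in lborel. indicator B x * v x = W x" by blast
  have "AE x in lborel. indicator P x * max 0 (W x) = indicator B x * v x"
    using W
  proof eventually_elim
    case (elim x)
    show ?case
    proof (cases "x \<in> P")
      case True
      then show ?thesis using elim[symmetric] P(1) v[of x] by auto
    next
      case False
      then show ?thesis using P(2)[of x] by (cases "x \<in> B") auto
    qed
  qed
  then have "AE x in lebesgue. indicator P x * max 0 (W x) = indicator B x * v x"
    by (rule AE_completion)
  then show ?thesis
    by (intro that[of "\<lambda>x. indicator P x * max 0 (W x)"]) auto
qed

lemma set_lebesgue_integral_borel_version:
  fixes v V c :: "'a::euclidean_space \<Rightarrow> real"
  assumes [measurable]: "V \<in> borel_measurable borel" "c \<in> borel_measurable borel"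
    and AE: "AE x in lebesgue. V x = indicator B x * v x"
    and meas: "set_borel_measurable lebesgue B v"
  shows "(LINT x:B|lebesgue. v x * c x) = (\<integral>x. V x * c x \<partial>lborel)"
proof -
  have [measurable]: "c \<in> borel_measurable lebesgue" "V \<in> borel_measurable lebesgue"
    by (auto intro: measurable_completion)
  have "(\<lambda>x. (indicator B x *\<^sub>R v x) * c x) \<in> borel_measurable lebesgue"
    using meas by (intro borel_measurable_times) (auto simp: set_borel_measurable_def)
  then have "(LINT x:B|lebesgue. v x * c x) = (\<integral>x. V x * c x \<partial>lebesgue)"
    unfolding set_lebesgue_integral_def
    by (intro integral_cong_AE) (use AE in \<open>auto simp: mult.assoc\<close>)
  then show ?thesis by (simp add: integral_completion)
qed

lemma nn_integral_borel_version:
  fixes v V :: "'a::euclidean_space \<Rightarrow> real"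
  assumes [measurable]: "V \<in> borel_measurable borel" and C: "C \<subseteq> B"
    and AE: "AE x in lebesgue. V x = indicator B x * v x"
  shows "(\<integral>\<^sup>+x\<in>C. ennreal ((V x)\<^sup>2) \<partial>lborel) = (\<integral>\<^sup>+x\<in>C. ennreal ((v x)\<^sup>2) \<partial>lebesgue)"
proof -
  have "(\<integral>\<^sup>+x\<in>C. ennreal ((V x)\<^sup>2) \<partial>lebesgue) = (\<integral>\<^sup>+x\<in>C. ennreal ((v x)\<^sup>2) \<partial>lebesgue)"
    by (intro nn_integral_cong_AE) (use AE C in \<open>auto elim!: eventually_mono simp: indicator_def\<close>)
  then show ?thesis by (simp add: nn_integral_completion)
qed

lemma L2_on_nn_integral_finite:
  fixes f :: "'a::euclidean_space \<Rightarrow> real"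
  assumes "L2_on U f"
  shows "(\<integral>\<^sup>+x\<in>U. ennreal ((f x)\<^sup>2) \<partial>lebesgue) < \<infinity>"
proof -
  have "integrable lebesgue (\<lambda>x. indicator U x * (f x)\<^sup>2)"
    using assms by (simp add: L2_on_def set_integrable_def)
  then have "(\<integral>\<^sup>+x. ennreal (norm (indicator U x * (f x)\<^sup>2)) \<partial>lebesgue) < \<infinity>"
    by (simp add: integrable_iff_bounded)
  also have "(\<integral>\<^sup>+x. ennreal (norm (indicator U x * (f x)\<^sup>2)) \<partial>lebesgue) = (\<integral>\<^sup>+x\<in>U. ennreal ((f x)\<^sup>2) \<partial>lebesgue)"
    by (intro nn_integral_cong) (auto simp: indicator_def)
  finally show ?thesis .
qed

text \<open>From the weak inequality only the tests \<open>bump K 0\<close> with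
  \<open>K = 1 / \<delta>\<^sup>2\<close> are taken. Since \<open>v\<close> vanishes off \<Omega>,
  it lives on \<open>\<Omega> \<inter> ball 0 r\<close>, whose volume bound carries
  \<theta>.\<close>

lemma weak_subsolution_L2_decay:
  fixes v hf :: "'a::euclidean_space \<Rightarrow> real"
  assumes H1: "H1_with_gradient (ball 0 r) v G" and hf: "L2_on (ball 0 r) hf"
    and weak: "\<And>\<phi>. \<phi> \<in> test_functions (ball 0 r) \<Longrightarrow> (\<And>x. \<phi> x \<ge> 0) \<Longrightarrow>
      (LINT x:ball 0 r|lebesgue. G x \<bullet> grad \<phi> x) \<le> (LINT x:ball 0 r|lebesgue. hf x * \<phi> x)"
    and nonneg: "\<And>x. v x \<ge> 0" "\<And>x. hf x \<ge> 0"
    and zero: "\<And>x. x \<notin> \<Omega> \<Longrightarrow> v x = 0" "\<And>x. x \<notin> \<Omega> \<Longrightarrow> hf x = 0"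
    and \<Omega>: "open \<Omega>" and r: "r > 0" and \<delta>: "0 < \<delta>" "\<delta> < 1" and \<theta>: "\<theta> < 1"
    and vol: "emeasure lborel (\<Omega> \<inter> ball 0 r) \<le> ennreal ((1 - \<theta>) * (unit_ball_vol DIM('a) * r ^ DIM('a)))"
  shows "(\<integral>\<^sup>+x\<in>ball 0 (\<delta> * r). ennreal ((v x)\<^sup>2) \<partial>lebesgue)
    \<le> ennreal ((1 + \<delta>) * (1 - \<theta>) / (1 - \<delta>) ^ (4 * DIM('a) + 2) * \<delta> ^ DIM('a))
        * (\<integral>\<^sup>+x\<in>ball 0 r. ennreal ((v x)\<^sup>2) \<partial>lebesgue)
      + ennreal ((1 + 1 / \<delta>) / (1 - \<delta>) ^ (2 * DIM('a) + 2) * r ^ 4)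
        * (\<integral>\<^sup>+x\<in>ball 0 r. ennreal ((hf x)\<^sup>2) \<partial>lebesgue)"
proof -
  let ?B = "ball (0::'a) r" and ?P = "\<Omega> \<inter> ball 0 r"
  define K where "K = 1 / \<delta>\<^sup>2"
  have K: "K > 0" using \<delta> by (simp add: K_def)
  have P: "?P \<in> sets borel" using \<Omega> by auto
  have L2v: "L2_on ?B v" using H1 by (simp add: H1_with_gradient_def)
  have meas: "set_borel_measurable lebesgue ?B v" "set_borel_measurable lebesgue ?B hf"
    using L2v hf by (auto simp: L2_on_def)
  obtain V where V: "V \<in> borel_measurable borel" "\<And>x. V x \<ge> 0" "\<And>x. x \<notin> ?P \<Longrightarrow> V x = 0"
    "AE x in lebesgue. V x = indicator ?B x * v x"
    by (rule borel_version[OF meas(1) P inf_le2 _ nonneg(1)]) (use zero(1) in blast)+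
  obtain h where h: "h \<in> borel_measurable borel" "\<And>x. h x \<ge> 0" "\<And>x. x \<notin> ?P \<Longrightarrow> h x = 0"
    "AE x in lebesgue. h x = indicator ?B x * hf x"
    by (rule borel_version[OF meas(2) P inf_le2 _ nonneg(2)]) (use zero(2) in blast)+
  have int: "integrable lborel W" if W: "W \<in> borel_measurable borel" "AE x in lebesgue. W x = indicator ?B x * w x"
    "L2_on ?B w" for W w :: "'a \<Rightarrow> real"
  proof -
    have "set_integrable lebesgue ?B w" using W(3) by (rule L2_on_set_integrable) simp
    then have "integrable lebesgue W"
      unfolding set_integrable_def real_scaleR_def
    proof (rule Bochner_Integration.integrable_cong_AE_imp)
      show "W \<in> borel_measurable lebesgue" using W(1) by (intro measurable_completion) simp
      show "AE x in lebesgue. indicator ?B x * w x = W x" by (rule eventually_mono[OF W(2)]) (rule sym)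
    qed
    then show ?thesis using W(1) by (simp add: integrable_completion)
  qed
  have full: "(\<integral>\<^sup>+x. ennreal ((W x)\<^sup>2) \<partial>lborel) = (\<integral>\<^sup>+x\<in>?B. ennreal ((w x)\<^sup>2) \<partial>lebesgue)"
    if "W \<in> borel_measurable borel" "\<forall>x. x \<notin> ?P \<longrightarrow> W x = 0" "AE x in lebesgue. W x = indicator ?B x * w x"
    for W w :: "'a \<Rightarrow> real"
  proof -
    have "(\<integral>\<^sup>+x. ennreal ((W x)\<^sup>2) \<partial>lborel) = (\<integral>\<^sup>+x\<in>?B. ennreal ((W x)\<^sup>2) \<partial>lborel)"
      using that(2) by (intro nn_integral_cong) (auto simp: indicator_def)
    then show ?thesis using nn_integral_borel_version[OF that(1) order_refl that(3)] by simp
  qed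
  have "subsolution V h K r"
  proof
    fix x :: 'a and t :: real assume t: "t > 0" "cball x t \<subseteq> ?B"
    let ?q = "\<lambda>y. bump K 0 ((y - x) \<bullet> (y - x) / t\<^sup>2)"
    have "(LINT y:?B|lebesgue. G y \<bullet> grad ?q y) \<le> (LINT y:?B|lebesgue. hf y * ?q y)"
      by (rule weak[OF radial_test[OF K t] bump_0_nonneg[OF K]])
    then have "- (LINT y:?B|lebesgue. v y * radial_laplacian K t (y - x)) \<le> (LINT y:?B|lebesgue. hf y * ?q y)"
      using weak_laplacian_radial[OF H1 _ K t] by simp
    moreover have "(LINT y:?B|lebesgue. v y * radial_laplacian K t (y - x))
        = (\<integral>y. V y * radial_laplacian K t (y - x) \<partial>lborel)"
      by (rule set_lebesgue_integral_borel_version[OF V(1) _ V(4) meas(1)])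
         (unfold radial_laplacian_def, measurable)
    moreover have "(LINT y:?B|lebesgue. hf y * ?q y) = (\<integral>y. h y * ?q y \<partial>lborel)"
      by (rule set_lebesgue_integral_borel_version[OF h(1) _ h(4) meas(2)]) measurable
    ultimately show "- (\<integral>y. V y * radial_laplacian K t (y - x) \<partial>lborel) \<le> (\<integral>y. h y * ?q y \<partial>lborel)"
      by simp
  qed (use K V h int[OF V(1,4) L2v] int[OF h(1,4) hf] in auto)
  then interpret sol: subsolution V h K r .
  have sub: "ball 0 (\<delta> * r) \<subseteq> ?B"
    using \<delta> r by (intro subset_ball) (simp add: mult_left_le_one_le)
  have fullV: "(\<integral>\<^sup>+x. ennreal ((V x)\<^sup>2) \<partial>lborel) = (\<integral>\<^sup>+x\<in>?B. ennreal ((v x)\<^sup>2) \<partial>lebesgue)"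
    using V by (intro full) auto
  have fullh: "(\<integral>\<^sup>+x. ennreal ((h x)\<^sup>2) \<partial>lborel) = (\<integral>\<^sup>+x\<in>?B. ennreal ((hf x)\<^sup>2) \<partial>lebesgue)"
    using h by (intro full) auto
  show ?thesis
    unfolding fullV[symmetric] fullh[symmetric] nn_integral_borel_version[OF V(1) sub V(4), symmetric]
    using V(3) L2_on_nn_integral_finite[OF L2v] L2_on_nn_integral_finite[OF hf]
    by (intro sol.L2_decay[OF r \<delta> \<theta> K_def _ _ P _ vol]) (simp_all only: fullV fullh)
qed

section \<open>Choice of the ratio of radii and geometric iteration\<close>

text \<open>The expression tends to \<open>1 - \<theta> < 1\<close> as \<delta> decreases to
  0.\<close>

lemma exists_decay_scale:
  fixes \<theta> :: real
  assumes "0 < \<theta>"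
  obtains \<delta> where "0 < \<delta>" "\<delta> < 1" "(1 + \<delta>)\<^sup>2 * (1 - \<theta>) / (1 - \<delta>) ^ N < 1"
proof -
  have "((\<lambda>\<delta>. (1 + \<delta>)\<^sup>2 * (1 - \<theta>) / (1 - \<delta>) ^ N) \<longlongrightarrow> (1 + 0)\<^sup>2 * (1 - \<theta>) / (1 - 0) ^ N) (at_right 0)"
    by (intro tendsto_intros) auto
  then have "\<forall>\<^sub>F \<delta> in at_right 0. (1 + \<delta>)\<^sup>2 * (1 - \<theta>) / (1 - \<delta>) ^ N < 1"
    by (rule order_tendstoD) (use assms in auto)
  moreover have "\<forall>\<^sub>F \<delta>::real in at_right 0. \<delta> < 1 \<and> 0 < \<delta>"
    by (auto simp: eventually_at_right_field intro!: exI[of _ 1])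
  ultimately have "\<forall>\<^sub>F \<delta> in at_right 0. 0 < \<delta> \<and> \<delta> < 1 \<and> (1 + \<delta>)\<^sup>2 * (1 - \<theta>) / (1 - \<delta>) ^ N < 1"
    by eventually_elim auto
  then show ?thesis
    using that eventually_happens'[OF trivial_limit_at_right_real] by blast
qed

text \<open>The constant \<open>M\<close> is large enough for the top range of radii and satisfies
  \<open>\<kappa> * M + B \<le> \<delta> powr \<beta> * M\<close>, so that a bound
  \<open>M * r powr \<beta>\<close> reproduces itself under one step.\<close>

lemma decay_iteration:
  fixes A :: "real \<Rightarrow> real"
  assumes \<delta>: "0 < \<delta>" "\<delta> < 1" and \<kappa>: "0 \<le> \<kappa>" "\<kappa> < \<delta> powr \<beta>"
    and R: "R > 0" and nonneg: "\<beta> \<ge> 0" "B \<ge> 0" "D \<ge> 0" "A R \<ge> 0"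
    and step: "\<And>r. 0 < r \<Longrightarrow> r \<le> R \<Longrightarrow> A (\<delta> * r) \<le> \<kappa> * A r + B * r powr \<beta>"
    and base: "\<And>r. \<delta> * R < r \<Longrightarrow> r \<le> R \<Longrightarrow> A r \<le> D * A R"
    and r: "0 < r" "r \<le> R"
  shows "A r \<le> (D * A R / (\<delta> * R) powr \<beta> + B / (\<delta> powr \<beta> - \<kappa>)) * r powr \<beta>"
proof -
  define M where "M = D * A R / (\<delta> * R) powr \<beta> + B / (\<delta> powr \<beta> - \<kappa>)"
  have M0: "D * A R / (\<delta> * R) powr \<beta> \<le> M" "B / (\<delta> powr \<beta> - \<kappa>) \<le> M"
    using nonneg \<kappa> by (auto simp: M_def)
  have MB: "B \<le> (\<delta> powr \<beta> - \<kappa>) * M"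
    using M0(2) \<kappa> by (simp add: field_simps)
  obtain k where k: "\<delta> ^ k < r / R"
    using real_arch_pow_inv[of "r / R" \<delta>] r R \<delta> by auto
  \<comment> \<open>Induction on the number of steps needed to return to the range above
    \<open>\<delta> * R\<close>; for \<open>k = 0\<close> the premises \<open>R < r\<close> and
    \<open>r \<le> R\<close> contradict each other.\<close>
  have "\<delta> ^ k * R < r \<Longrightarrow> 0 < r \<Longrightarrow> r \<le> R \<Longrightarrow> A r \<le> M * r powr \<beta>" for r
  proof (induction k arbitrary: r)
    case 0
    then show ?case by simp
  next
    case (Suc k)
    show ?case
    proof (cases "\<delta> * R < r")
      case True
      have pos: "(\<delta> * R) powr \<beta> > 0" using \<delta> R by simp
      have "A r \<le> D * A R / (\<delta> * R) powr \<beta> * (\<delta> * R) powr \<beta>"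
        using base[OF True Suc.prems(3)] pos by simp
      also have "\<dots> \<le> D * A R / (\<delta> * R) powr \<beta> * r powr \<beta>"
        using True nonneg \<delta> R by (intro mult_left_mono powr_mono2) auto
      also have "\<dots> \<le> M * r powr \<beta>"
        using M0(1) by (intro mult_right_mono) auto
      finally show ?thesis .
    next
      case False
      define q where "q = r / \<delta>"
      have q: "0 < q" "q \<le> R" "\<delta> ^ k * R < q" "r = \<delta> * q"
        using False Suc.prems \<delta> by (auto simp: q_def field_simps)
      have "A r \<le> \<kappa> * A q + B * q powr \<beta>"
        using step[OF q(1,2)] q(4) by simp
      also have "\<dots> \<le> \<kappa> * (M * q powr \<beta>) + ((\<delta> powr \<beta> - \<kappa>) * M) * q powr \<beta>"
        using Suc.IH[OF q(3,1,2)] \<kappa> MB by (intro add_mono mult_left_mono mult_right_mono) auto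
      also have "\<dots> = M * r powr \<beta>"
        using q(1,4) \<delta> by (simp add: powr_mult algebra_simps)
      finally show ?thesis .
    qed
  qed
  from this[of r] show ?thesis
    unfolding M_def using k r R by (simp add: field_simps)
qed

section \<open>Square integrals over the part of a ball inside the domain\<close>

abbreviation sq_int :: "'a::euclidean_space set \<Rightarrow> real \<Rightarrow> ('a \<Rightarrow> real) \<Rightarrow> ennreal" where
  "sq_int \<Omega> r w \<equiv> \<integral>\<^sup>+x\<in>\<Omega> \<inter> ball 0 r. ennreal ((w x)\<^sup>2) \<partial>lebesgue"

lemma sq_int_mono:
  assumes "r \<le> r'" "\<And>x. x \<in> \<Omega> \<Longrightarrow> \<bar>v x\<bar> \<le> \<bar>w x\<bar>"
  shows "sq_int \<Omega> r v \<le> sq_int \<Omega> r' w"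
  using assms by (intro nn_integral_mono) (auto simp: indicator_def abs_le_square_iff intro!: ennreal_leI)

lemma volume_admissible:
  fixes \<Omega> :: "'a::euclidean_space set"
  assumes "admissible_domain \<theta> \<Omega>" "0 \<in> frontier \<Omega>" "0 < r" "r < diameter \<Omega>"
  shows "emeasure lborel (\<Omega> \<inter> ball 0 r) \<le> ennreal ((1 - \<theta>) * (unit_ball_vol DIM('a) * r ^ DIM('a)))"
proof -
  have op: "open \<Omega>" using assms(1) by (simp add: admissible_domain_def domain_def)
  have 1: "\<Omega> \<inter> ball 0 r \<in> lmeasurable"
    using op by (intro lmeasurable_open) (auto intro: bounded_subset)
  have 2: "- \<Omega> \<inter> ball 0 r = ball 0 r - (\<Omega> \<inter> ball 0 r)" by auto
  have "measure lebesgue (- \<Omega> \<inter> ball 0 r) = measure lebesgue (ball (0::'a) r) - measure lebesgue (\<Omega> \<inter> ball 0 r)"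
    unfolding 2 using 1 by (intro measurable_measure_Diff) auto
  moreover have "measure lebesgue (- \<Omega> \<inter> ball 0 r) \<ge> \<theta> * measure lebesgue (ball (0::'a) r)"
    using assms by (auto simp: admissible_domain_def)
  moreover have "measure lebesgue (ball (0::'a) r) = unit_ball_vol DIM('a) * r ^ DIM('a)"
    using content_ball[of r "0::'a"] assms(3) by simp
  ultimately have "measure lebesgue (\<Omega> \<inter> ball 0 r) \<le> (1 - \<theta>) * (unit_ball_vol DIM('a) * r ^ DIM('a))"
    by (simp add: algebra_simps)
  moreover have "emeasure lborel (\<Omega> \<inter> ball 0 r) = ennreal (measure lebesgue (\<Omega> \<inter> ball 0 r))"
    using emeasure_eq_measure2[OF 1] op by simp
  ultimately show ?thesis by (simp add: ennreal_leI)
qed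

text \<open>Openness gives strictness: a point of \<Omega> can be pushed radially outwards by
  \<open>e / 2\<close> within \<Omega>, and the pushed point is still within the diameter from the
  boundary point 0. Thus the open ball of the largest radius in \<open>weak_solution\<close> covers
  \<Omega>.\<close>

lemma domain_subset_ball_diameter:
  fixes \<Omega> :: "'a::euclidean_space set"
  assumes "open \<Omega>" "bounded \<Omega>" "0 \<in> frontier \<Omega>"
  shows "\<Omega> \<subseteq> ball 0 (diameter \<Omega>)"
proof
  fix x assume x: "x \<in> \<Omega>"
  then have x0: "x \<noteq> 0"
    using assms(1,3) by (auto simp: frontier_def interior_open)
  obtain e where e: "e > 0" "ball x e \<subseteq> \<Omega>" using assms(1) x open_contains_ball by blast
  define z where "z = x + (e / 2 / norm x) *\<^sub>R x"
  have "dist x z < e" using e x0 by (simp add: z_def dist_norm)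
  then have "z \<in> closure \<Omega>" using e(2) closure_subset[of \<Omega>] by auto
  moreover have "0 \<in> closure \<Omega>" using assms(3) by (simp add: frontier_def)
  ultimately have "dist z 0 \<le> diameter (closure \<Omega>)"
    using assms(2) by (intro diameter_bounded_bound) auto
  then have "norm z \<le> diameter \<Omega>" using assms(2) by (simp add: diameter_closure)
  moreover have "norm z = norm x + e / 2"
  proof -
    have "z = (1 + e / 2 / norm x) *\<^sub>R x" by (simp add: z_def algebra_simps)
    then have "norm z = \<bar>1 + e / 2 / norm x\<bar> * norm x" by simp
    also have "\<bar>1 + e / 2 / norm x\<bar> = 1 + e / 2 / norm x" using e by simp
    finally show ?thesis using x0 by (simp add: distrib_right)
  qed
  ultimately show "x \<in> ball 0 (diameter \<Omega>)" using e by simp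
qed

text \<open>Measurability is given on compact subsets only and passes to \<Omega> as a pointwise
  limit along a compact exhaustion.\<close>

lemma L2_loc_measurable:
  fixes u :: "'a::euclidean_space \<Rightarrow> real"
  assumes "L2_loc \<Omega> u" "open \<Omega>"
  shows "set_borel_measurable lebesgue \<Omega> u"
proof -
  obtain C where C: "\<And>n. compact (C n)" "\<And>n. C n \<subseteq> \<Omega>" "\<And>n. C n \<subseteq> C (Suc n)" "\<Union>(range C) = \<Omega>"
    using open_Union_compact_subsets[OF assms(2)] by (metis interior_subset subset_trans)
  have mono: "C m \<subseteq> C n" if "m \<le> n" for m n
    using that C(3) by (rule lift_Suc_mono_le[rotated])
  have meas: "(\<lambda>x. indicator (C n) x *\<^sub>R u x) \<in> borel_measurable lebesgue" for n
    using assms(1) C(1,2) by (auto simp: L2_loc_def L2_on_def set_borel_measurable_def)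
  show ?thesis
    unfolding set_borel_measurable_def
  proof (rule borel_measurable_LIMSEQ_real[OF _ meas])
    fix x
    show "(\<lambda>n. indicator (C n) x *\<^sub>R u x) \<longlonglongrightarrow> indicator \<Omega> x *\<^sub>R u x"
    proof (cases "x \<in> \<Omega>")
      case True
      then obtain m where "x \<in> C m" using C(4) by auto
      then have "\<forall>\<^sub>F n in sequentially. indicator (C n) x *\<^sub>R u x = indicator \<Omega> x *\<^sub>R u x"
        using True mono by (intro eventually_sequentiallyI[of m]) (auto simp: indicator_def)
      then show ?thesis by (rule tendsto_eventually)
    next
      case False
      then have "indicator (C n) x = (0::real)" for n using C(2)[of n] by (auto simp: indicator_def)
      then show ?thesis using False by simp
    qed
  qed
qed

lemma L2_mean_eq:
  fixes w :: "'a::euclidean_space \<Rightarrow> real"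
  assumes "r > 0" "sq_int \<Omega> r w = ennreal e" "e \<ge> 0"
  shows "L2_mean \<Omega> r w = ennreal (sqrt (e / (unit_ball_vol DIM('a) * r ^ DIM('a))))"
proof -
  have "emeasure lebesgue (ball (0::'a) r) = ennreal (unit_ball_vol DIM('a) * r ^ DIM('a))"
    using emeasure_ball[of r "0::'a"] assms(1) by simp
  moreover have "0 < unit_ball_vol DIM('a) * r ^ DIM('a)"
    using assms(1) by simp
  ultimately show ?thesis
    using assms unfolding L2_mean_def by (simp add: divide_ennreal ennreal_sqrt_def)
qed

text \<open>Intended for \<open>v = (u - sup g)^+\<close> and \<open>w = (u - g 0)^+\<close>. The
  subsolution \<open>v\<close> changes with \<open>r\<close>, whereas \<open>w\<close> does not and
  can be iterated; they differ by at most \<open>e\<close>, the deviation of the extremum of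
  \<open>g\<close> from \<open>g 0\<close>. The passage from \<open>v\<close> to \<open>w\<close>
  costs the second factor \<open>1 + \<delta>\<close>.\<close>

lemma sq_int_decay_step:
  fixes v hf w f :: "'a::euclidean_space \<Rightarrow> real"
  assumes H1: "H1_with_gradient (ball 0 r) v G" and hf: "L2_on (ball 0 r) hf"
    and weak: "\<And>\<phi>. \<phi> \<in> test_functions (ball 0 r) \<Longrightarrow> (\<And>x. \<phi> x \<ge> 0) \<Longrightarrow>
      (LINT x:ball 0 r|lebesgue. G x \<bullet> grad \<phi> x) \<le> (LINT x:ball 0 r|lebesgue. hf x * \<phi> x)"
    and nonneg: "\<And>x. v x \<ge> 0" "\<And>x. hf x \<ge> 0"
    and zero: "\<And>x. x \<notin> \<Omega> \<Longrightarrow> v x = 0" "\<And>x. x \<notin> \<Omega> \<Longrightarrow> hf x = 0"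
    and \<Omega>: "open \<Omega>" and r: "r > 0" and \<delta>: "0 < \<delta>" "\<delta> < 1" and \<theta>: "\<theta> < 1"
    and vol: "emeasure lborel (\<Omega> \<inter> ball 0 r) \<le> ennreal ((1 - \<theta>) * (unit_ball_vol DIM('a) * r ^ DIM('a)))"
    and vw: "\<And>x. x \<in> \<Omega> \<Longrightarrow> v x \<le> w x" "\<And>x. x \<in> \<Omega> \<Longrightarrow> w x \<le> v x + e" and e: "e \<ge> 0"
    and hf_le: "\<And>x. x \<in> \<Omega> \<Longrightarrow> hf x \<le> \<bar>f x\<bar>"
  shows "sq_int \<Omega> (\<delta> * r) w
    \<le> ennreal (1 + \<delta>) *
       (ennreal ((1 + \<delta>) * (1 - \<theta>) / (1 - \<delta>) ^ (4 * DIM('a) + 2) * \<delta> ^ DIM('a)) * sq_int \<Omega> r w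
        + ennreal ((1 + 1 / \<delta>) / (1 - \<delta>) ^ (2 * DIM('a) + 2) * r ^ 4) * sq_int \<Omega> r f)
      + ennreal ((1 + 1 / \<delta>) * e\<^sup>2 * (unit_ball_vol DIM('a) * (\<delta> * r) ^ DIM('a)))"
proof -
  let ?B = "ball (0::'a) (\<delta> * r)"
  have sub: "?B \<subseteq> ball 0 r"
    using \<delta> r by (intro subset_ball) (simp add: mult_left_le_one_le)
  \<comment> \<open>Measurability of \<open>v\<close> is available on the larger ball only, so it is
    transferred through the truncation \<open>v'\<close>.\<close>
  have "(\<lambda>x. indicator (ball 0 r) x *\<^sub>R v x) \<in> borel_measurable lebesgue"
    using H1 by (simp add: H1_with_gradient_def L2_on_def set_borel_measurable_def)
  moreover define v' where "v' x = indicator (ball 0 r) x *\<^sub>R v x" for x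
  ultimately have [measurable]: "v' \<in> borel_measurable lebesgue" by (simp add: v'_def[abs_def])
  have [measurable]: "?B \<in> sets lebesgue" by simp
  have "(\<lambda>x. ennreal ((v' x)\<^sup>2) * indicator ?B x) \<in> borel_measurable lebesgue" by measurable
  also have "(\<lambda>x. ennreal ((v' x)\<^sup>2) * indicator ?B x) = (\<lambda>x. ennreal ((v x)\<^sup>2) * indicator ?B x)"
    using sub by (auto simp: v'_def indicator_def fun_eq_iff)
  finally have meas: "(\<lambda>x. ennreal ((v x)\<^sup>2) * indicator ?B x) \<in> borel_measurable lebesgue" .
  have "sq_int \<Omega> (\<delta> * r) w
      \<le> (\<integral>\<^sup>+x. ennreal (1 + \<delta>) * (ennreal ((v x)\<^sup>2) * indicator ?B x)
          + ennreal ((1 + 1 / \<delta>) * e\<^sup>2) * indicator ?B x \<partial>lebesgue)"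
  proof (intro nn_integral_mono)
    fix x
    show "ennreal ((w x)\<^sup>2) * indicator (\<Omega> \<inter> ?B) x
        \<le> ennreal (1 + \<delta>) * (ennreal ((v x)\<^sup>2) * indicator ?B x) + ennreal ((1 + 1 / \<delta>) * e\<^sup>2) * indicator ?B x"
    proof (cases "x \<in> \<Omega> \<inter> ?B")
      case True
      then have "(w x)\<^sup>2 \<le> (v x + e)\<^sup>2"
        using vw[of x] nonneg(1)[of x] by (intro power_mono) auto
      then have "ennreal ((w x)\<^sup>2) \<le> (ennreal (v x) + ennreal e)\<^sup>2"
        using nonneg(1)[of x] e by (simp add: ennreal_plus[symmetric] ennreal_power ennreal_leI del: ennreal_plus)
      also have "\<dots> \<le> ennreal (1 + \<delta>) * (ennreal (v x))\<^sup>2 + ennreal (1 + 1 / \<delta>) * (ennreal e)\<^sup>2"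
        by (rule ennreal_square_add_le[OF \<delta>(1)])
      finally show ?thesis
        using True nonneg(1)[of x] e \<delta> by (simp add: ennreal_power ennreal_mult)
    qed simp
  qed
  also have "\<dots> = ennreal (1 + \<delta>) * (\<integral>\<^sup>+x\<in>?B. ennreal ((v x)\<^sup>2) \<partial>lebesgue)
      + ennreal ((1 + 1 / \<delta>) * e\<^sup>2) * emeasure lebesgue ?B"
    using meas by (subst nn_integral_add) (auto simp: nn_integral_cmult nn_integral_cmult_indicator)
  also have "emeasure lebesgue ?B = ennreal (unit_ball_vol DIM('a) * (\<delta> * r) ^ DIM('a))"
    using emeasure_ball[of "\<delta> * r" "0::'a"] \<delta> r by simp
  also have "ennreal ((1 + 1 / \<delta>) * e\<^sup>2) * \<dots> = ennreal ((1 + 1 / \<delta>) * e\<^sup>2 * (unit_ball_vol DIM('a) * (\<delta> * r) ^ DIM('a)))"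
    using \<delta> r by (intro ennreal_mult[symmetric]) auto
  also have "(\<integral>\<^sup>+x\<in>?B. ennreal ((v x)\<^sup>2) \<partial>lebesgue) \<le>
    ennreal ((1 + \<delta>) * (1 - \<theta>) / (1 - \<delta>) ^ (4 * DIM('a) + 2) * \<delta> ^ DIM('a))
        * (\<integral>\<^sup>+x\<in>ball 0 r. ennreal ((v x)\<^sup>2) \<partial>lebesgue)
      + ennreal ((1 + 1 / \<delta>) / (1 - \<delta>) ^ (2 * DIM('a) + 2) * r ^ 4)
        * (\<integral>\<^sup>+x\<in>ball 0 r. ennreal ((hf x)\<^sup>2) \<partial>lebesgue)"
    by (rule weak_subsolution_L2_decay[OF H1 hf weak nonneg zero \<Omega> r \<delta> \<theta> vol])
  also have "(\<integral>\<^sup>+x\<in>ball 0 r. ennreal ((v x)\<^sup>2) \<partial>lebesgue) \<le> sq_int \<Omega> r w"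
    using vw(1) nonneg(1) zero(1)
    by (intro nn_integral_mono) (auto simp: indicator_def intro!: ennreal_leI power_mono)
  also have "(\<integral>\<^sup>+x\<in>ball 0 r. ennreal ((hf x)\<^sup>2) \<partial>lebesgue) \<le> sq_int \<Omega> r f"
    using hf_le nonneg(2) zero(2)
    by (intro nn_integral_mono)
       (auto simp: indicator_def abs_le_square_iff[symmetric] intro!: ennreal_leI)
  finally show ?thesis
    by (simp add: add_mono mult_left_mono)
qed

subsection \<open>Decay at the boundary point\<close>

text \<open>Puts the step into the form of \<open>decay_iteration\<close> with exponent
  \<open>2 * \<alpha>\<close>, and covers the radii between \<open>R\<close> and 1, where no step is
  at hand, by monotonicity. The constants involve neither \<open>w\<close> nor
  \<open>f\<close>.\<close>

lemma sq_int_growth: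
  fixes w f :: "'a::euclidean_space \<Rightarrow> real"
  assumes \<delta>: "0 < \<delta>" "\<delta> < 1" and qC: "q \<ge> 0" "C \<ge> 0" "(1 + \<delta>) * q < \<delta> powr (2 * \<alpha>)"
    and \<alpha>: "\<alpha> > 0" and R: "0 < R" "R < 1"
    and e1: "sq_int \<Omega> 1 w \<le> ennreal e1" "e1 \<ge> 0"
    and f: "\<And>r. 0 < r \<Longrightarrow> r < 1 \<Longrightarrow> ennreal (r ^ 4) * sq_int \<Omega> r f
        \<le> ennreal (unit_ball_vol DIM('a) * r ^ DIM('a) * (F\<^sup>2 * r powr (2 * \<alpha>)))"
    and step: "\<And>r. 0 < r \<Longrightarrow> r \<le> R \<Longrightarrow> sq_int \<Omega> (\<delta> * r) w
      \<le> ennreal (1 + \<delta>) * (ennreal (q * \<delta> ^ DIM('a)) * sq_int \<Omega> r w + ennreal (C * r ^ 4) * sq_int \<Omega> r f)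
        + ennreal ((1 + 1 / \<delta>) * (\<gamma> * r powr \<alpha>)\<^sup>2 * (unit_ball_vol DIM('a) * (\<delta> * r) ^ DIM('a)))"
    and r: "0 < r" "r < 1"
  shows "sq_int \<Omega> r w \<le> ennreal ((1 / (\<delta> ^ DIM('a) * R ^ DIM('a) * (\<delta> * R) powr (2 * \<alpha>)) * e1
      + unit_ball_vol DIM('a) * ((1 + \<delta>) * C / \<delta> ^ DIM('a) + 1 + 1 / \<delta>) / (\<delta> powr (2 * \<alpha>) - (1 + \<delta>) * q)
        * (F\<^sup>2 + \<gamma>\<^sup>2)) * r powr (2 * \<alpha>) * r ^ DIM('a))"
proof -
  let ?N = "DIM('a)" and ?\<omega> = "unit_ball_vol DIM('a)" and ?\<beta> = "2 * \<alpha>"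
  have fin: "sq_int \<Omega> r w \<le> ennreal e1" if "r \<le> 1" for r
    using sq_int_mono[OF that, of \<Omega> w w] e1(1) by (auto intro: order_trans)
  define E where "E r = enn2real (sq_int \<Omega> r w)" for r
  have E: "sq_int \<Omega> r w = ennreal (E r)" "E r \<ge> 0" "E r \<le> e1" if "r \<le> 1" for r
    using fin[OF that] e1(2)
    by (auto simp: E_def less_top le_less_trans[OF _ ennreal_less_top] intro: enn2real_leI)
  have E_mono: "E r \<le> E r'" if "r \<le> r'" "r' \<le> 1" for r r'
    using sq_int_mono[OF that(1), of \<Omega> w w] E(1)[of r] E(1,2)[of r'] that by simp
  \<comment> \<open>Per unit volume the factor \<open>q * \<delta> ^ N\<close> of the step becomes
    \<open>q\<close>.\<close>
  define A where "A r = E r / r ^ ?N" for r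
  define B where "B = ?\<omega> * ((1 + \<delta>) * C / \<delta> ^ ?N + 1 + 1 / \<delta>) * (F\<^sup>2 + \<gamma>\<^sup>2)"
  define M where "M = 1 / \<delta> ^ ?N * A R / (\<delta> * R) powr ?\<beta> + B / (\<delta> powr ?\<beta> - (1 + \<delta>) * q)"
  have \<omega>: "?\<omega> > 0" by simp
  have A_step: "A (\<delta> * r) \<le> (1 + \<delta>) * q * A r + B * r powr ?\<beta>" if r: "0 < r" "r \<le> R" for r
  proof -
    have r1: "r < 1" "r \<le> 1" "\<delta> * r \<le> 1" using r R \<delta> by (auto intro: mult_le_one)
    have "ennreal (C * r ^ 4) * sq_int \<Omega> r f \<le> ennreal C * ennreal (?\<omega> * r ^ ?N * (F\<^sup>2 * r powr ?\<beta>))"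
      using f[OF r(1) r1(1)] qC r by (simp add: ennreal_mult mult.assoc mult_left_mono)
    then have "ennreal (E (\<delta> * r)) \<le> ennreal (1 + \<delta>) * (ennreal (q * \<delta> ^ ?N) * ennreal (E r)
          + ennreal C * ennreal (?\<omega> * r ^ ?N * (F\<^sup>2 * r powr ?\<beta>)))
        + ennreal ((1 + 1 / \<delta>) * (\<gamma> * r powr \<alpha>)\<^sup>2 * (?\<omega> * (\<delta> * r) ^ ?N))"
      using order_trans[OF step[OF r]] unfolding E(1)[OF r1(3)] E(1)[OF r1(2)]
      by (meson add_left_mono add_right_mono mult_left_mono zero_le)
    also have "\<dots> = ennreal ((1 + \<delta>) * (q * \<delta> ^ ?N * E r + C * (?\<omega> * r ^ ?N * (F\<^sup>2 * r powr ?\<beta>)))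
        + (1 + 1 / \<delta>) * (\<gamma> * r powr \<alpha>)\<^sup>2 * (?\<omega> * (\<delta> * r) ^ ?N))"
      using \<delta> qC r E(2)[OF r1(2)] \<omega>
      by (simp add: ennreal_mult[symmetric] ennreal_plus[symmetric] del: ennreal_plus)
    finally have "E (\<delta> * r) \<le> (1 + \<delta>) * (q * \<delta> ^ ?N * E r + C * (?\<omega> * r ^ ?N * (F\<^sup>2 * r powr ?\<beta>)))
        + (1 + 1 / \<delta>) * (\<gamma> * r powr \<alpha>)\<^sup>2 * (?\<omega> * (\<delta> * r) ^ ?N)"
      using \<delta> qC r E(2)[OF r1(2)] \<omega> by (subst (asm) ennreal_le_iff) auto
    then have "A (\<delta> * r) \<le> ((1 + \<delta>) * (q * \<delta> ^ ?N * E r + C * (?\<omega> * r ^ ?N * (F\<^sup>2 * r powr ?\<beta>)))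
        + (1 + 1 / \<delta>) * (\<gamma> * r powr \<alpha>)\<^sup>2 * (?\<omega> * (\<delta> * r) ^ ?N)) / (\<delta> * r) ^ ?N"
      unfolding A_def using \<delta> r by (intro divide_right_mono) auto
    also have "\<dots> = (1 + \<delta>) * q * A r
        + ?\<omega> * ((1 + \<delta>) * C / \<delta> ^ ?N * F\<^sup>2 + (1 + 1 / \<delta>) * \<gamma>\<^sup>2) * r powr ?\<beta>"
    proof -
      have cancel: "(p * (q * D * E' + C * (w * P * (F2 * x))) + k * (G * x) * (w * (D * P))) / (D * P)
          = p * q * (E' / P) + w * (p * C / D * F2 + k * G) * x"
        if "D > 0" "P > 0" for p D E' w P F2 x k G :: real
        using that by (simp add: field_simps)
      have "(r powr \<alpha>)\<^sup>2 = r powr ?\<beta>" using r by (simp add: powr_power mult.commute)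
      then show ?thesis
        unfolding A_def power_mult_distrib using \<delta> r by (subst cancel[symmetric]) auto
    qed
    also have "?\<omega> * ((1 + \<delta>) * C / \<delta> ^ ?N * F\<^sup>2 + (1 + 1 / \<delta>) * \<gamma>\<^sup>2) * r powr ?\<beta> \<le> B * r powr ?\<beta>"
    proof -
      have "(1 + \<delta>) * C / \<delta> ^ ?N * F\<^sup>2 + (1 + 1 / \<delta>) * \<gamma>\<^sup>2
          \<le> ((1 + \<delta>) * C / \<delta> ^ ?N + 1 + 1 / \<delta>) * (F\<^sup>2 + \<gamma>\<^sup>2)"
        unfolding distrib_left[of _ "F\<^sup>2"] using \<delta> qC by (intro add_mono mult_right_mono) auto
      then show ?thesis
        unfolding B_def mult.assoc[of ?\<omega>] using \<omega> by (intro mult_left_mono mult_right_mono) auto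
    qed
    finally show ?thesis by simp
  qed
  have B0: "B \<ge> 0" using \<omega> \<delta> qC by (auto simp: B_def)
  \<comment> \<open>The square integral grows with the radius, and the volumes differ by at most the
    factor \<open>\<delta> ^ N\<close>.\<close>
  have base: "A r \<le> 1 / \<delta> ^ ?N * A R" if "\<delta> * R < r" "r \<le> R" for r
  proof -
    have r0: "0 < \<delta> * R" using \<delta> R by simp
    then have "A r \<le> E R / (\<delta> * R) ^ ?N"
      unfolding A_def using that R E_mono[of r R] E(2)[of r]
      by (intro frac_le power_mono) auto
    then show ?thesis by (simp add: A_def power_mult_distrib mult.commute)
  qed
  have AR: "0 \<le> A R" "A R \<le> e1 / R ^ ?N"
    using E(2,3)[of R] R by (auto simp: A_def divide_right_mono)
  have small: "A r \<le> M * r powr ?\<beta>" if "0 < r" "r \<le> R" for r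
    unfolding M_def using \<alpha> qC(1) \<delta>
    by (intro decay_iteration[OF \<delta> _ qC(3) R(1) _ B0 _ AR(1) A_step base that]) auto
  have pos: "0 < (\<delta> * R) powr ?\<beta>" using \<delta> R by simp
  define C6 where "C6 = 1 / (\<delta> ^ ?N * R ^ ?N * (\<delta> * R) powr ?\<beta>)"
  define M' where "M' = C6 * e1 + B / (\<delta> powr ?\<beta> - (1 + \<delta>) * q)"
  have tail: "0 \<le> B / (\<delta> powr ?\<beta> - (1 + \<delta>) * q)" using B0 qC(3) by simp
  have "M \<le> M'"
  proof -
    have "1 / \<delta> ^ ?N * A R / (\<delta> * R) powr ?\<beta> \<le> 1 / \<delta> ^ ?N * (e1 / R ^ ?N) / (\<delta> * R) powr ?\<beta>"
      using AR(2) \<delta> by (intro divide_right_mono mult_left_mono) auto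
    then show ?thesis by (simp add: M_def M'_def C6_def mult_ac)
  qed
  have "A r \<le> M' * r powr ?\<beta>"
  proof (cases "r \<le> R")
    case True
    then show ?thesis
      using small[of r] r \<open>M \<le> M'\<close> by (meson mult_right_mono order_trans powr_ge_zero)
  next
    \<comment> \<open>Here the square integral is at most \<open>e1\<close>, and \<open>C6\<close>
      was made large enough to absorb the factor lost against
      \<open>r powr (2 * \<alpha>)\<close>.\<close>
    case False
    have "A r \<le> e1 / R ^ ?N"
      unfolding A_def using False r R E(2,3)[of r] e1(2) by (intro frac_le power_mono) auto
    also have "\<dots> \<le> C6 * e1 * R powr ?\<beta>"
    proof -
      have "\<delta> ^ ?N * (\<delta> * R) powr ?\<beta> \<le> 1 * R powr ?\<beta>"
        using \<delta> R \<alpha> by (intro mult_mono powr_mono2 power_le_one) auto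
      then have "1 \<le> R powr ?\<beta> / (\<delta> ^ ?N * (\<delta> * R) powr ?\<beta>)"
        using \<delta> pos by simp
      then have "e1 / R ^ ?N * 1 \<le> e1 / R ^ ?N * (R powr ?\<beta> / (\<delta> ^ ?N * (\<delta> * R) powr ?\<beta>))"
        using e1(2) R by (intro mult_left_mono) auto
      then show ?thesis by (simp add: C6_def mult_ac)
    qed
    also have "\<dots> \<le> C6 * e1 * r powr ?\<beta>"
      using False R \<alpha> e1(2) \<delta> by (intro mult_left_mono powr_mono2) (auto simp: C6_def)
    also have "\<dots> \<le> M' * r powr ?\<beta>"
      unfolding M'_def using tail by (intro mult_right_mono) auto
    finally show ?thesis .
  qed
  then have "E r \<le> M' * r powr ?\<beta> * r ^ ?N"
    using r by (simp add: A_def pos_divide_le_eq)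
  then have "ennreal (E r) \<le> ennreal (M' * r powr ?\<beta> * r ^ ?N)" by (rule ennreal_leI)
  then show ?thesis
    using E(1)[of r] r by (simp add: M'_def C6_def B_def)
qed

lemma L2_on_part:
  fixes f :: "'a::euclidean_space \<Rightarrow> real"
  assumes "L2_on \<Omega> f" "open \<Omega>" "p \<in> borel_measurable borel" "p 0 = 0" "\<And>y. \<bar>p y\<bar> \<le> \<bar>y\<bar>"
  shows "L2_on (ball a r) (\<lambda>x. p (zero_ext \<Omega> f x))"
proof -
  have "(\<lambda>x. indicator \<Omega> x *\<^sub>R f x) \<in> borel_measurable lebesgue"
    using assms(1) by (simp add: L2_on_def set_borel_measurable_def)
  also have eq: "(\<lambda>x. indicator \<Omega> x *\<^sub>R f x) = zero_ext \<Omega> f"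
    by (auto simp: zero_ext_def indicator_def)
  finally have [measurable]: "zero_ext \<Omega> f \<in> borel_measurable lebesgue" .
  have [measurable]: "p \<in> borel_measurable borel" by fact
  have [measurable]: "ball a r \<in> sets lebesgue" by simp
  have int: "integrable lebesgue (\<lambda>x. indicator \<Omega> x *\<^sub>R (norm (f x))\<^sup>2)"
    using assms(1) by (simp add: L2_on_def set_integrable_def)
  have "integrable lebesgue (\<lambda>x. indicator (ball a r) x *\<^sub>R (norm (p (zero_ext \<Omega> f x)))\<^sup>2)"
  proof (rule Bochner_Integration.integrable_bound[OF int])
    show "AE x in lebesgue. norm (indicator (ball a r) x *\<^sub>R (norm (p (zero_ext \<Omega> f x)))\<^sup>2)
        \<le> norm (indicator \<Omega> x *\<^sub>R (norm (f x))\<^sup>2)"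
      using assms(4) assms(5)[of "f _"]
      by (intro AE_I2) (auto simp: indicator_def zero_ext_def abs_le_square_iff[symmetric])
  qed measurable
  moreover have "(\<lambda>x. indicator (ball a r) x *\<^sub>R p (zero_ext \<Omega> f x)) \<in> borel_measurable lebesgue"
    by measurable
  ultimately show ?thesis by (simp add: L2_on_def set_integrable_def set_borel_measurable_def)
qed

lemma pos_part_measurable [measurable]: "pos_part \<in> borel_measurable borel"
  and neg_part_measurable [measurable]: "neg_part \<in> borel_measurable borel"
  unfolding pos_part_def[abs_def] neg_part_def[abs_def] by measurable

text \<open>The supremum \<open>M\<close> over the boundary portion satisfies
  \<open>g 0 \<le> M \<le> g 0 + e\<close>, because 0 belongs to it; hence
  \<open>(u - M)^+ \<le> (u - g 0)^+ \<le> (u - M)^+ + e\<close>. The infimum and the negative parts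
  are symmetric.\<close>

lemma weak_solution_decay_step:
  fixes u f g :: "'a::euclidean_space \<Rightarrow> real"
  assumes sol: "weak_solution \<Omega> f g u" and adm: "admissible_domain \<theta> \<Omega>" and f: "L2_on \<Omega> f"
    and z: "0 \<in> frontier \<Omega>" and r: "0 < r" "r < diameter \<Omega>" and \<delta>: "0 < \<delta>" "\<delta> < 1" and \<theta>: "\<theta> < 1"
    and g: "\<And>x. x \<in> ball 0 r \<inter> frontier \<Omega> \<Longrightarrow> \<bar>g x - g 0\<bar> \<le> e"
    and p: "p = pos_part \<or> p = neg_part"
  shows "sq_int \<Omega> (\<delta> * r) (\<lambda>x. p (u x - g 0))
    \<le> ennreal (1 + \<delta>) *
       (ennreal ((1 + \<delta>) * (1 - \<theta>) / (1 - \<delta>) ^ (4 * DIM('a) + 2) * \<delta> ^ DIM('a)) * sq_int \<Omega> r (\<lambda>x. p (u x - g 0))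
        + ennreal ((1 + 1 / \<delta>) / (1 - \<delta>) ^ (2 * DIM('a) + 2) * r ^ 4) * sq_int \<Omega> r f)
      + ennreal ((1 + 1 / \<delta>) * e\<^sup>2 * (unit_ball_vol DIM('a) * (\<delta> * r) ^ DIM('a)))"
proof -
  have op: "open \<Omega>" using adm by (simp add: admissible_domain_def domain_def)
  have vol: "emeasure lborel (\<Omega> \<inter> ball 0 r) \<le> ennreal ((1 - \<theta>) * (unit_ball_vol DIM('a) * r ^ DIM('a)))"
    by (rule volume_admissible[OF adm z r])
  have mem: "0 \<in> ball 0 r \<inter> frontier \<Omega>" using z r by simp
  have e: "e \<ge> 0" using g[OF mem] by simp
  have r': "0 < r \<and> r \<le> diameter \<Omega> \<and> 0 \<in> frontier \<Omega>" using r z by simp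
  let ?I = "ball 0 r \<inter> frontier \<Omega>"
  have g': "g x \<le> g 0 + e" "g 0 - e \<le> g x" if "x \<in> ?I" for x
    using g[OF that] by linarith+
  from p show ?thesis
  proof
    assume p: "p = pos_part"
    define M where "M = (SUP y\<in>?I. g y)"
    \<comment> \<open>A real \<open>Sup\<close> is meaningful only for a nonempty bounded set: 0
      provides the former, \<open>e\<close> the latter.\<close>
    have bdd: "bdd_above (g ` ?I)" using g'(1) by (rule bdd_aboveI2)
    have "M \<le> g 0 + e"
      unfolding M_def by (rule cSUP_least) (use mem g'(1) in blast)+
    then have M: "g 0 \<le> M" "M \<le> g 0 + e"
      unfolding M_def using cSUP_upper[OF mem bdd] by auto
    obtain G where G: "H1_with_gradient (ball 0 r) (zero_ext \<Omega> (\<lambda>x. pos_part (u x - M))) G"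
      and weak: "\<And>\<phi>. \<phi> \<in> test_functions (ball 0 r) \<Longrightarrow> (\<And>x. \<phi> x \<ge> 0) \<Longrightarrow>
        (LINT x:ball 0 r|lebesgue. G x \<bullet> grad \<phi> x)
          \<le> (LINT x:ball 0 r|lebesgue. pos_part (zero_ext \<Omega> f x) * \<phi> x)"
      using sol[unfolded weak_solution_def, THEN conjunct2, THEN conjunct1,
          THEN spec[of _ r], THEN spec[of _ 0], THEN mp, OF r', folded M_def] by blast
    have L2: "L2_on (ball 0 r) (\<lambda>x. pos_part (zero_ext \<Omega> f x))"
      by (rule L2_on_part[OF f op]) (auto simp: pos_part_def)
    show ?thesis
      unfolding p
      by (rule sq_int_decay_step[OF G L2 weak _ _ _ _ op r(1) \<delta> \<theta> vol _ _ e])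
         (use M in \<open>auto simp: zero_ext_def pos_part_def\<close>)
  next
    assume p: "p = neg_part"
    define M where "M = (INF y\<in>?I. g y)"
    have bdd: "bdd_below (g ` ?I)" using g'(2) by (rule bdd_belowI2)
    have "g 0 - e \<le> M"
      unfolding M_def by (rule cINF_greatest) (use mem g'(2) in blast)+
    then have M: "M \<le> g 0" "g 0 - e \<le> M"
      unfolding M_def using cINF_lower[OF bdd mem] by auto
    obtain G where G: "H1_with_gradient (ball 0 r) (zero_ext \<Omega> (\<lambda>x. neg_part (u x - M))) G"
      and weak: "\<And>\<phi>. \<phi> \<in> test_functions (ball 0 r) \<Longrightarrow> (\<And>x. \<phi> x \<ge> 0) \<Longrightarrow>
        (LINT x:ball 0 r|lebesgue. G x \<bullet> grad \<phi> x)
          \<le> (LINT x:ball 0 r|lebesgue. neg_part (zero_ext \<Omega> f x) * \<phi> x)"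
      using sol[unfolded weak_solution_def, THEN conjunct2, THEN conjunct2,
          THEN spec[of _ r], THEN spec[of _ 0], THEN mp, OF r', folded M_def] by blast
    have L2: "L2_on (ball 0 r) (\<lambda>x. neg_part (zero_ext \<Omega> f x))"
      by (rule L2_on_part[OF f op]) (auto simp: neg_part_def)
    show ?thesis
      unfolding p
      by (rule sq_int_decay_step[OF G L2 weak _ _ _ _ op r(1) \<delta> \<theta> vol _ _ e])
         (use M in \<open>auto simp: zero_ext_def neg_part_def\<close>)
  qed
qed

lemma weak_solution_measurable:
  assumes "weak_solution \<Omega> f g u" "open \<Omega>"
  shows "set_borel_measurable lebesgue \<Omega> u"
  using assms L2_loc_measurable by (auto simp: weak_solution_def H1_loc_with_gradient_def)

text \<open>Interior regularity is only local, so square integrability up to the boundary comes from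
  the truncations at radius \<open>diameter \<Omega>\<close>: \<open>\<bar>u\<bar>\<close> is at
  most their sum plus the constants \<open>\<bar>M\<bar>\<close> and \<open>\<bar>m\<bar>\<close>.
  The a priori finiteness lets the decay be computed with real numbers.\<close>

lemma weak_solution_sq_int_finite:
  fixes \<Omega> :: "'a::euclidean_space set"
  assumes sol: "weak_solution \<Omega> f g u" and \<Omega>: "open \<Omega>" "bounded \<Omega>" "0 \<in> frontier \<Omega>" "diameter \<Omega> > 0"
  shows "sq_int \<Omega> r u < \<infinity>"
proof -
  let ?B = "ball (0::'a) (diameter \<Omega>)"
  define M where "M = (SUP y\<in>?B \<inter> frontier \<Omega>. g y)"
  define m where "m = (INF y\<in>?B \<inter> frontier \<Omega>. g y)"
  define P where "P = zero_ext \<Omega> (\<lambda>x. pos_part (u x - M))"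
  define Q where "Q = zero_ext \<Omega> (\<lambda>x. neg_part (u x - m))"
  have d: "0 < diameter \<Omega> \<and> diameter \<Omega> \<le> diameter \<Omega> \<and> 0 \<in> frontier \<Omega>"
    using \<Omega> by simp
  have PQ: "L2_on ?B P" "L2_on ?B Q"
    using sol[unfolded weak_solution_def] d unfolding P_def Q_def M_def m_def H1_with_gradient_def by blast+
  define c where "c = \<bar>M\<bar> + \<bar>m\<bar>"
  have "integrable lebesgue (\<lambda>x. indicator ?B x * (P x)\<^sup>2)" "integrable lebesgue (\<lambda>x. indicator ?B x * (Q x)\<^sup>2)"
    using PQ by (simp_all add: L2_on_def set_integrable_def)
  moreover have "integrable lebesgue (\<lambda>x. indicator ?B x * c\<^sup>2)"
    using emeasure_lborel_ball_finite[of "0::'a" "diameter \<Omega>"]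
    by (intro integrable_mult_left integrable_real_indicator) auto
  ultimately have int: "integrable lebesgue (\<lambda>x. 3 * (indicator ?B x * (P x)\<^sup>2 + indicator ?B x * (Q x)\<^sup>2 + indicator ?B x * c\<^sup>2))"
    by auto
  have sq3: "(a + b + d)\<^sup>2 \<le> 3 * (a\<^sup>2 + b\<^sup>2 + d\<^sup>2)" for a b d :: real
  proof -
    have "0 \<le> (a - b)\<^sup>2 + (b - d)\<^sup>2 + (a - d)\<^sup>2" by simp
    then show ?thesis by (simp add: power2_eq_square algebra_simps)
  qed
  have "sq_int \<Omega> r u \<le> (\<integral>\<^sup>+x. ennreal (3 * (indicator ?B x * (P x)\<^sup>2 + indicator ?B x * (Q x)\<^sup>2 + indicator ?B x * c\<^sup>2)) \<partial>lebesgue)"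
  proof (intro nn_integral_mono)
    fix x
    show "ennreal ((u x)\<^sup>2) * indicator (\<Omega> \<inter> ball 0 r) x
      \<le> ennreal (3 * (indicator ?B x * (P x)\<^sup>2 + indicator ?B x * (Q x)\<^sup>2 + indicator ?B x * c\<^sup>2))"
    proof (cases "x \<in> \<Omega>")
      case True
      then have x: "x \<in> ?B" using domain_subset_ball_diameter[OF \<Omega>(1-3)] by auto
      have "\<bar>u x\<bar> \<le> P x + Q x + c"
        using True by (auto simp: P_def Q_def c_def zero_ext_def pos_part_def neg_part_def)
      then have "(u x)\<^sup>2 \<le> (P x + Q x + c)\<^sup>2"
        by (simp add: abs_le_square_iff[symmetric])
      also have "\<dots> \<le> 3 * ((P x)\<^sup>2 + (Q x)\<^sup>2 + c\<^sup>2)" by (rule sq3)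
      finally show ?thesis using x by (auto simp: indicator_def simp del: ennreal_plus intro: ennreal_leI)
    qed simp
  qed
  also have "\<dots> < \<infinity>"
    using int by (subst nn_integral_eq_integral) auto
  finally show ?thesis .
qed

text \<open>The factor \<open>r ^ 4\<close> from the potential compensates the square of
  \<open>r powr (-2)\<close>, so the source contributes at the rate
  \<open>r powr (2 * \<alpha>)\<close>, like the squared oscillation of \<open>g\<close>.\<close>

lemma seminorm_f_sq_int:
  fixes f :: "'a::euclidean_space \<Rightarrow> real"
  assumes f: "L2_on \<Omega> f" and fin: "seminorm_f \<Omega> \<alpha> f < \<infinity>" and r: "0 < r" "r < 1"
  shows "ennreal (r ^ 4) * sq_int \<Omega> r f
    \<le> ennreal (unit_ball_vol DIM('a) * r ^ DIM('a) * ((enn2real (seminorm_f \<Omega> \<alpha> f))\<^sup>2 * r powr (2 * \<alpha>)))"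
proof -
  let ?F = "enn2real (seminorm_f \<Omega> \<alpha> f)"
  define W where "W = unit_ball_vol DIM('a) * r ^ DIM('a)"
  have W: "W > 0" using r by (simp add: W_def)
  have "sq_int \<Omega> r f \<le> (\<integral>\<^sup>+x\<in>\<Omega>. ennreal ((f x)\<^sup>2) \<partial>lebesgue)"
    by (intro nn_integral_mono) (auto simp: indicator_def)
  also have "\<dots> < \<infinity>" by (rule L2_on_nn_integral_finite[OF f])
  finally obtain e where e: "sq_int \<Omega> r f = ennreal e" "e \<ge> 0" by (auto simp: less_top_ennreal)
  have "ennreal (1 / r powr (- 2 + \<alpha>)) * L2_mean \<Omega> r f \<le> seminorm_f \<Omega> \<alpha> f"
    unfolding seminorm_f_def using r by (intro SUP_upper) auto
  also have "\<dots> = ennreal ?F" using fin by simp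
  finally have "1 / r powr (- 2 + \<alpha>) * sqrt (e / W) \<le> ?F"
    unfolding L2_mean_eq[OF r(1) e] W_def[symmetric] using W e(2)
    by (simp add: ennreal_mult[symmetric] del: minus_add_distrib)
  then have "sqrt (e / W) \<le> ?F * r powr (- 2 + \<alpha>)"
    using r by (simp add: field_simps)
  then have "(sqrt (e / W))\<^sup>2 \<le> (?F * r powr (- 2 + \<alpha>))\<^sup>2"
    using W e(2) by (intro power_mono) auto
  then have "e / W \<le> ?F\<^sup>2 * r powr (2 * (- 2 + \<alpha>))"
    using W e(2) r by (simp add: power_mult_distrib powr_power mult.commute)
  then have "e \<le> W * (?F\<^sup>2 * r powr (2 * (- 2 + \<alpha>)))"
    using W by (simp add: pos_divide_le_eq mult.commute)
  then have "r ^ 4 * e \<le> r ^ 4 * (W * (?F\<^sup>2 * r powr (2 * (- 2 + \<alpha>))))"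
    using r by (intro mult_left_mono) auto
  also have "\<dots> = W * (?F\<^sup>2 * (r powr 4 * r powr (2 * (- 2 + \<alpha>))))"
    using r by (simp add: powr_numeral)
  also have "r powr 4 * r powr (2 * (- 2 + \<alpha>)) = r powr (2 * \<alpha>)"
    by (simp add: powr_add[symmetric])
  finally have "ennreal (r ^ 4 * e) \<le> ennreal (W * (?F\<^sup>2 * r powr (2 * \<alpha>)))" by (rule ennreal_leI)
  then show ?thesis using e r by (simp add: W_def ennreal_mult)
qed

lemma seminorm_g_bound:
  assumes fin: "seminorm_g \<Omega> \<alpha> g < \<infinity>" and r: "r \<le> 1" and \<alpha>: "\<alpha> > 0" and x: "x \<in> ball 0 r \<inter> frontier \<Omega>"
  shows "\<bar>g x - g 0\<bar> \<le> enn2real (seminorm_g \<Omega> \<alpha> g) * r powr \<alpha>"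
proof (cases "x = 0")
  case False
  let ?\<gamma> = "enn2real (seminorm_g \<Omega> \<alpha> g)"
  have "ennreal (\<bar>g x - g 0\<bar> / norm x powr \<alpha>) \<le> seminorm_g \<Omega> \<alpha> g"
    unfolding seminorm_g_def using x r False by (intro SUP_upper) auto
  also have "\<dots> = ennreal ?\<gamma>" using fin by simp
  finally have "\<bar>g x - g 0\<bar> / norm x powr \<alpha> \<le> ?\<gamma>" by simp
  then have "\<bar>g x - g 0\<bar> \<le> ?\<gamma> * norm x powr \<alpha>"
    using False by (simp add: field_simps)
  also have "\<dots> \<le> ?\<gamma> * r powr \<alpha>"
    using x \<alpha> by (intro mult_left_mono powr_mono2) auto
  finally show ?thesis .
qed simp

text \<open>At each point one of the two parts vanishes, so their squares add up exactly; each sign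
  can then be treated with its own subsolution.\<close>

lemma sq_int_parts:
  fixes u :: "'a::euclidean_space \<Rightarrow> real"
  assumes u: "set_borel_measurable lebesgue \<Omega> u" and \<Omega>: "open \<Omega>"
  shows "sq_int \<Omega> r (\<lambda>x. u x - k) = sq_int \<Omega> r (\<lambda>x. pos_part (u x - k)) + sq_int \<Omega> r (\<lambda>x. neg_part (u x - k))"
    and "sq_int \<Omega> r (\<lambda>x. u x - k) \<le> 2 * sq_int \<Omega> r u + ennreal (2 * k\<^sup>2) * emeasure lborel (ball (0::'a) r)"
proof -
  have [measurable]: "\<Omega> \<inter> ball 0 r \<in> sets lebesgue" "ball (0::'a) r \<in> sets lebesgue" using \<Omega> by auto
  define U where "U x = indicator \<Omega> x *\<^sub>R u x" for x
  have [measurable]: "U \<in> borel_measurable lebesgue"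
    using u by (simp add: U_def[abs_def] set_borel_measurable_def)
  have meas: "(\<lambda>x. ennreal ((p (u x))\<^sup>2) * indicator (\<Omega> \<inter> ball 0 r) x) \<in> borel_measurable lebesgue"
    if [measurable]: "p \<in> borel_measurable borel" for p :: "real \<Rightarrow> real"
  proof -
    have "(\<lambda>x. ennreal ((p (U x))\<^sup>2) * indicator (\<Omega> \<inter> ball 0 r) x) \<in> borel_measurable lebesgue" by measurable
    also have "(\<lambda>x. ennreal ((p (U x))\<^sup>2) * indicator (\<Omega> \<inter> ball 0 r) x)
        = (\<lambda>x. ennreal ((p (u x))\<^sup>2) * indicator (\<Omega> \<inter> ball 0 r) x)"
      by (auto simp: U_def indicator_def fun_eq_iff)
    finally show ?thesis .
  qed
  have "sq_int \<Omega> r (\<lambda>x. u x - k) = (\<integral>\<^sup>+x. ennreal ((pos_part (u x - k))\<^sup>2) * indicator (\<Omega> \<inter> ball 0 r) x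
      + ennreal ((neg_part (u x - k))\<^sup>2) * indicator (\<Omega> \<inter> ball 0 r) x \<partial>lebesgue)"
    by (intro nn_integral_cong) (auto simp: indicator_def pos_part_def neg_part_def max_def power2_commute)
  then show "sq_int \<Omega> r (\<lambda>x. u x - k) = sq_int \<Omega> r (\<lambda>x. pos_part (u x - k)) + sq_int \<Omega> r (\<lambda>x. neg_part (u x - k))"
    using meas[of "\<lambda>y. pos_part (y - k)"] meas[of "\<lambda>y. neg_part (y - k)"]
    by (simp add: nn_integral_add)
  have sq: "(a - k)\<^sup>2 \<le> 2 * a\<^sup>2 + 2 * k\<^sup>2" for a
  proof -
    have "0 \<le> (a + k)\<^sup>2" by simp
    then show ?thesis by (simp add: power2_eq_square algebra_simps)
  qed
  have "sq_int \<Omega> r (\<lambda>x. u x - k) \<le> (\<integral>\<^sup>+x. 2 * (ennreal ((u x)\<^sup>2) * indicator (\<Omega> \<inter> ball 0 r) x)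
      + ennreal (2 * k\<^sup>2) * indicator (ball 0 r) x \<partial>lebesgue)"
  proof (intro nn_integral_mono)
    fix x
    have "ennreal ((u x - k)\<^sup>2) \<le> ennreal (2 * (u x)\<^sup>2 + 2 * k\<^sup>2)"
      by (intro ennreal_leI sq)
    also have "\<dots> = 2 * ennreal ((u x)\<^sup>2) + ennreal (2 * k\<^sup>2)"
      by (simp add: ennreal_mult)
    finally show "ennreal ((u x - k)\<^sup>2) * indicator (\<Omega> \<inter> ball 0 r) x
      \<le> 2 * (ennreal ((u x)\<^sup>2) * indicator (\<Omega> \<inter> ball 0 r) x) + ennreal (2 * k\<^sup>2) * indicator (ball 0 r) x"
      by (auto simp: indicator_def)
  qed
  also have "\<dots> = 2 * sq_int \<Omega> r u + ennreal (2 * k\<^sup>2) * emeasure lborel (ball (0::'a) r)"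
    using meas[of "\<lambda>y. y"] by (subst nn_integral_add) (auto simp: nn_integral_cmult nn_integral_cmult_indicator)
  finally show "sq_int \<Omega> r (\<lambda>x. u x - k) \<le> 2 * sq_int \<Omega> r u + ennreal (2 * k\<^sup>2) * emeasure lborel (ball (0::'a) r)" .
qed

theorem theorem1p3:
  fixes L \<theta> C\<^sub>0 :: real
  assumes "CARD('n::finite) \<ge> 3"
    and "L > 1" and "0 < \<theta>" and "\<theta> < 1" and "C\<^sub>0 > 0"
  shows "\<exists>\<alpha>\<^sub>0. 0 < \<alpha>\<^sub>0 \<and> \<alpha>\<^sub>0 < 1 \<and>
    (\<forall>\<alpha>. 0 < \<alpha> \<and> \<alpha> < \<alpha>\<^sub>0 \<longrightarrow>
      (\<exists>C::real. C > 0 \<and>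
        (\<forall>(\<Omega> :: (real ^ 'n) set) (f :: real ^ 'n \<Rightarrow> real) (g :: real ^ 'n \<Rightarrow> real) (u :: real ^ 'n \<Rightarrow> real).
          bounded \<Omega> \<and> admissible_domain \<theta> \<Omega> \<and> uniform_domain L \<Omega> \<and>
          diameter \<Omega> \<ge> C\<^sub>0 \<and> 0 \<in> frontier \<Omega> \<and>
          L2_on \<Omega> f \<and> continuous_on (frontier \<Omega>) g \<and> weak_solution \<Omega> f g u \<and>
          seminorm_f \<Omega> \<alpha> f < \<infinity> \<and> seminorm_g \<Omega> \<alpha> g < \<infinity>
          \<longrightarrow>
          seminorm_u \<Omega> \<alpha> u < \<infinity> \<and>
          seminorm_u \<Omega> \<alpha> u
            \<le> ennreal C * L2_mean \<Omega> 1 u + ennreal C * (seminorm_f \<Omega> \<alpha> f + norm_g \<Omega> \<alpha> g))))"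
proof -
  let ?N = "DIM(real ^ 'n)"
  define \<omega> where "\<omega> = unit_ball_vol ?N"
  have \<omega>: "\<omega> > 0" by (simp add: \<omega>_def)
  \<comment> \<open>Chosen from \<theta> and the dimension alone, before \<alpha> and all data, so
    both \<open>\<alpha>\<^sub>0\<close> and \<open>C\<close> may depend on it.\<close>
  obtain \<delta> where \<delta>: "0 < \<delta>" "\<delta> < 1" and \<kappa>1: "(1 + \<delta>)\<^sup>2 * (1 - \<theta>) / (1 - \<delta>) ^ (4 * ?N + 2) < 1"
    using exists_decay_scale[OF assms(3)] by blast
  define q where "q = (1 + \<delta>) * (1 - \<theta>) / (1 - \<delta>) ^ (4 * ?N + 2)"
  define A where "A = (1 + 1 / \<delta>) / (1 - \<delta>) ^ (2 * ?N + 2)"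
  have qA: "q > 0" "A > 0"
    unfolding q_def A_def using \<delta> assms(4)
    by (intro divide_pos_pos mult_pos_pos add_pos_pos zero_less_power; simp)+
  define \<kappa> where "\<kappa> = (1 + \<delta>) * q"
  have "0 < \<kappa>" using qA(1) \<delta> by (simp add: \<kappa>_def)
  moreover have "\<kappa> < 1"
    using \<kappa>1 unfolding \<kappa>_def q_def times_divide_eq_right power2_eq_square mult.assoc .
  ultimately have \<kappa>: "0 < \<kappa>" "\<kappa> < 1" by auto
  \<comment> \<open>Both logarithms are negative, so
    \<open>\<alpha> < ln \<kappa> / (2 * ln \<delta>)\<close> says
    \<open>\<kappa> < \<delta> powr (2 * \<alpha>)\<close>: one step contracts faster than the
    desired rate. The cap 1/2 keeps \<open>\<alpha>\<^sub>0\<close> below 1.\<close>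
  define \<alpha>\<^sub>0 where "\<alpha>\<^sub>0 = min (1 / 2) (ln \<kappa> / (2 * ln \<delta>))"
  have ln\<delta>: "ln \<delta> < 0" and ln\<kappa>: "ln \<kappa> < 0" using \<delta> \<kappa> by auto
  then have \<alpha>\<^sub>0: "0 < \<alpha>\<^sub>0" "\<alpha>\<^sub>0 < 1" by (auto simp: \<alpha>\<^sub>0_def zero_less_divide_iff)
  \<comment> \<open>Below 1 for the range of the seminorms and below \<open>C\<^sub>0\<close>, hence
    below the diameter, for the decay step.\<close>
  define R where "R = min 1 C\<^sub>0 / 2"
  have R: "0 < R" "R < 1" "R < C\<^sub>0" using assms(5) by (auto simp: R_def)
  have "\<exists>C::real. C > 0 \<and>
        (\<forall>(\<Omega> :: (real ^ 'n) set) (f :: real ^ 'n \<Rightarrow> real) (g :: real ^ 'n \<Rightarrow> real) (u :: real ^ 'n \<Rightarrow> real).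
          bounded \<Omega> \<and> admissible_domain \<theta> \<Omega> \<and> uniform_domain L \<Omega> \<and>
          diameter \<Omega> \<ge> C\<^sub>0 \<and> 0 \<in> frontier \<Omega> \<and>
          L2_on \<Omega> f \<and> continuous_on (frontier \<Omega>) g \<and> weak_solution \<Omega> f g u \<and>
          seminorm_f \<Omega> \<alpha> f < \<infinity> \<and> seminorm_g \<Omega> \<alpha> g < \<infinity>
          \<longrightarrow>
          seminorm_u \<Omega> \<alpha> u < \<infinity> \<and>
          seminorm_u \<Omega> \<alpha> u
            \<le> ennreal C * L2_mean \<Omega> 1 u + ennreal C * (seminorm_f \<Omega> \<alpha> f + norm_g \<Omega> \<alpha> g))"
    if \<alpha>: "0 < \<alpha>" "\<alpha> < \<alpha>\<^sub>0" for \<alpha>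
  proof -
    have "\<alpha> * (2 * ln \<delta>) > ln \<kappa>"
      using \<alpha>(2) ln\<delta> by (auto simp: \<alpha>\<^sub>0_def less_divide_eq)
    then have "ln \<kappa> < ln (\<delta> powr (2 * \<alpha>))" using \<delta> by (simp add: ln_powr mult_ac)
    then have \<kappa>_less: "(1 + \<delta>) * q < \<delta> powr (2 * \<alpha>)"
      unfolding \<kappa>_def[symmetric] using \<kappa>(1) \<delta>(1) by (subst (asm) ln_less_cancel_iff) auto
    define C6 where "C6 = 1 / (\<delta> ^ ?N * R ^ ?N * (\<delta> * R) powr (2 * \<alpha>))"
    define C7 where "C7 = \<omega> * ((1 + \<delta>) * A / \<delta> ^ ?N + 1 + 1 / \<delta>) / (\<delta> powr (2 * \<alpha>) - (1 + \<delta>) * q)"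
    have C67: "C6 > 0" "C7 \<ge> 0"
      using \<delta> R \<omega> qA \<kappa>_less by (auto simp: C6_def C7_def)
    \<comment> \<open>Both signs together give \<open>2 * T / \<omega>\<close>. As
      \<open>(u - g 0)\<^sup>2 \<le> 2 * u\<^sup>2 + 2 * (g 0)\<^sup>2\<close>, this equals \<open>4
      * C6 * (U\<^sup>2 + (g 0)\<^sup>2) + 2 * C7 / \<omega> * (F\<^sup>2 +
      \<gamma>\<^sup>2)\<close>, at most \<open>C\<^sup>2\<close> times the square of
      \<open>U + F + \<bar>g 0\<bar> + \<gamma>\<close>.\<close>
    define C where "C = sqrt (4 * C6 + 2 * C7 / \<omega>)"
    have C2: "C > 0" "C\<^sup>2 = 4 * C6 + 2 * C7 / \<omega>"
      using C67 \<omega> by (auto simp: C_def add_pos_nonneg)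
    show ?thesis
    proof (intro exI[of _ C] conjI C2(1) allI impI; elim conjE)
      fix \<Omega> :: "(real ^ 'n) set" and f g u :: "real ^ 'n \<Rightarrow> real"
      assume bdd: "bounded \<Omega>" and adm: "admissible_domain \<theta> \<Omega>" and diam: "C\<^sub>0 \<le> diameter \<Omega>"
        and z: "0 \<in> frontier \<Omega>" and f: "L2_on \<Omega> f" and sol: "weak_solution \<Omega> f g u"
        and finf: "seminorm_f \<Omega> \<alpha> f < \<infinity>" and fing: "seminorm_g \<Omega> \<alpha> g < \<infinity>"
      have op: "open \<Omega>" using adm by (simp add: admissible_domain_def domain_def)
      have meas: "set_borel_measurable lebesgue \<Omega> u" by (rule weak_solution_measurable[OF sol op])
      define F where "F = enn2real (seminorm_f \<Omega> \<alpha> f)"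
      define \<gamma> where "\<gamma> = enn2real (seminorm_g \<Omega> \<alpha> g)"
      have F: "seminorm_f \<Omega> \<alpha> f = ennreal F" "F \<ge> 0" and \<gamma>: "seminorm_g \<Omega> \<alpha> g = ennreal \<gamma>" "\<gamma> \<ge> 0"
        using finf fing by (auto simp: F_def \<gamma>_def)
      have "sq_int \<Omega> 1 u < \<infinity>"
        using diam assms(5) by (intro weak_solution_sq_int_finite[OF sol op bdd z]) auto
      then obtain e where e: "sq_int \<Omega> 1 u = ennreal e" "e \<ge> 0" by (auto simp: less_top_ennreal)
      define U where "U = sqrt (e / \<omega>)"
      have U: "L2_mean \<Omega> 1 u = ennreal U" "U \<ge> 0" "e = \<omega> * U\<^sup>2"
        using L2_mean_eq[OF zero_less_one e, folded \<omega>_def] e(2) \<omega> by (auto simp: U_def)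
      define e1 where "e1 = 2 * e + 2 * (g 0)\<^sup>2 * \<omega>"
      have e10: "e1 \<ge> 0" using e(2) \<omega> by (simp add: e1_def)
      have e1: "sq_int \<Omega> 1 (\<lambda>x. u x - g 0) \<le> ennreal e1"
      proof -
        have "2 * sq_int \<Omega> 1 u + ennreal (2 * (g 0)\<^sup>2) * emeasure lborel (ball (0 :: real ^ 'n) 1) = ennreal e1"
          using e \<omega> emeasure_ball[of 1 "0 :: real ^ 'n"]
          by (simp add: e1_def \<omega>_def ennreal_mult)
        then show ?thesis using sq_int_parts(2)[OF meas op, of "g 0" 1] by simp
      qed
      define T where "T = C6 * e1 + C7 * (F\<^sup>2 + \<gamma>\<^sup>2)"
      have T0: "T \<ge> 0" using C67 e10 by (simp add: T_def)
      have part: "sq_int \<Omega> r (\<lambda>x. p (u x - g 0)) \<le> ennreal (T * r powr (2 * \<alpha>) * r ^ ?N)"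
        if p: "p = pos_part \<or> p = neg_part" and r: "0 < r" "r < 1" for p r
        unfolding T_def C6_def C7_def \<omega>_def
      proof (rule sq_int_growth[OF \<delta> less_imp_le[OF qA(1)] less_imp_le[OF qA(2)] \<kappa>_less \<alpha>(1) R(1,2) _ e10 _ _ r])
        have "sq_int \<Omega> 1 (\<lambda>x. p (u x - g 0)) \<le> sq_int \<Omega> 1 (\<lambda>x. u x - g 0)"
          using p by (intro sq_int_mono) (auto simp: pos_part_def neg_part_def)
        then show "sq_int \<Omega> 1 (\<lambda>x. p (u x - g 0)) \<le> ennreal e1" using e1 by simp
        show "ennreal (r ^ 4) * sq_int \<Omega> r f
            \<le> ennreal (unit_ball_vol ?N * r ^ ?N * (F\<^sup>2 * r powr (2 * \<alpha>)))" if "0 < r" "r < 1" for r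
          unfolding F_def by (rule seminorm_f_sq_int[OF f finf that])
        show "sq_int \<Omega> (\<delta> * r) (\<lambda>x. p (u x - g 0))
            \<le> ennreal (1 + \<delta>) * (ennreal (q * \<delta> ^ ?N) * sq_int \<Omega> r (\<lambda>x. p (u x - g 0))
                + ennreal (A * r ^ 4) * sq_int \<Omega> r f)
              + ennreal ((1 + 1 / \<delta>) * (\<gamma> * r powr \<alpha>)\<^sup>2 * (unit_ball_vol ?N * (\<delta> * r) ^ ?N))"
          if r: "0 < r" "r \<le> R" for r
          unfolding q_def A_def \<gamma>_def
          using r R diam seminorm_g_bound[OF fing _ \<alpha>(1)]
          by (intro weak_solution_decay_step[OF sol adm f z _ _ \<delta> assms(4) _ p]) auto
      qed
      have bound: "ennreal (1 / r powr \<alpha>) * L2_mean \<Omega> r (\<lambda>x. u x - g 0) \<le> ennreal (C * (U + F + \<bar>g 0\<bar> + \<gamma>))"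
        if r: "0 < r" "r < 1" for r
      proof -
        have "sq_int \<Omega> r (\<lambda>x. u x - g 0) \<le> ennreal (T * r powr (2 * \<alpha>) * r ^ ?N) + ennreal (T * r powr (2 * \<alpha>) * r ^ ?N)"
          unfolding sq_int_parts(1)[OF meas op] using r by (intro add_mono part) auto
        also have "\<dots> = ennreal (2 * T * r powr (2 * \<alpha>) * r ^ ?N)"
          using T0 r by (simp add: ennreal_plus[symmetric] del: ennreal_plus)
        finally have le: "sq_int \<Omega> r (\<lambda>x. u x - g 0) \<le> ennreal (2 * T * r powr (2 * \<alpha>) * r ^ ?N)" .
        then obtain s where s: "sq_int \<Omega> r (\<lambda>x. u x - g 0) = ennreal s" "s \<ge> 0"
          using le_less_trans[OF le ennreal_less_top] by (auto simp: less_top_ennreal)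
        have s_le: "s \<le> 2 * T * r powr (2 * \<alpha>) * r ^ ?N"
          using le s T0 r by simp
        have "s / (\<omega> * r ^ ?N) \<le> (2 * T * r powr (2 * \<alpha>) * r ^ ?N) / (\<omega> * r ^ ?N)"
          using s_le \<omega> r by (intro divide_right_mono) auto
        also have "\<dots> = 2 * T / \<omega> * (r powr \<alpha>)\<^sup>2"
          using r by (simp add: powr_power mult.commute)
        also have "2 * T / \<omega> \<le> (C * (U + F + \<bar>g 0\<bar> + \<gamma>))\<^sup>2"
        proof -
          have "2 * T / \<omega> = 4 * C6 * (U\<^sup>2 + \<bar>g 0\<bar>\<^sup>2) + 2 * C7 / \<omega> * (F\<^sup>2 + \<gamma>\<^sup>2)"
            using \<omega> by (simp add: T_def e1_def U(3) field_simps)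
          also have "\<dots> \<le> 4 * C6 * (U + F + \<bar>g 0\<bar> + \<gamma>)\<^sup>2 + 2 * C7 / \<omega> * (U + F + \<bar>g 0\<bar> + \<gamma>)\<^sup>2"
          proof -
            have "U\<^sup>2 + b\<^sup>2 \<le> (U + F + b + \<gamma>)\<^sup>2 \<and> F\<^sup>2 + \<gamma>\<^sup>2 \<le> (U + F + b + \<gamma>)\<^sup>2" if "b \<ge> 0" for b
            proof -
              have "(U + F + b + \<gamma>)\<^sup>2 = U\<^sup>2 + b\<^sup>2 + F\<^sup>2 + \<gamma>\<^sup>2
                  + 2 * (U * F + U * b + U * \<gamma> + F * b + F * \<gamma> + b * \<gamma>)"
                by (simp add: power2_eq_square algebra_simps)
              moreover have "0 \<le> U * F + U * b + U * \<gamma> + F * b + F * \<gamma> + b * \<gamma>"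
                using U(2) F(2) \<gamma>(2) that by simp
              ultimately show ?thesis by simp
            qed
            from this[of "\<bar>g 0\<bar>"] show ?thesis
              using C67 \<omega> by (intro add_mono mult_left_mono) auto
          qed
          also have "\<dots> = (C * (U + F + \<bar>g 0\<bar> + \<gamma>))\<^sup>2"
            unfolding power_mult_distrib C2(2) by (simp add: distrib_right)
          finally show ?thesis .
        qed
        finally have "s / (\<omega> * r ^ ?N) \<le> (C * (U + F + \<bar>g 0\<bar> + \<gamma>) * r powr \<alpha>)\<^sup>2"
          by (simp add: power_mult_distrib mult_right_mono)
        then have "sqrt (s / (\<omega> * r ^ ?N)) \<le> C * (U + F + \<bar>g 0\<bar> + \<gamma>) * r powr \<alpha>"
          using C2(1) U(2) F(2) \<gamma>(2) by (intro real_le_lsqrt) auto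
        then have "1 / r powr \<alpha> * sqrt (s / (\<omega> * r ^ ?N)) \<le> C * (U + F + \<bar>g 0\<bar> + \<gamma>)"
          using r by (simp add: pos_divide_le_eq)
        then show ?thesis
          unfolding L2_mean_eq[OF r(1) s] \<omega>_def[symmetric] using s(2) \<omega> r
          by (simp add: ennreal_mult[symmetric] ennreal_leI)
      qed
      have "seminorm_u \<Omega> \<alpha> u \<le> (SUP r\<in>{0<..<1}. ennreal (1 / r powr \<alpha>) * L2_mean \<Omega> r (\<lambda>x. u x - g 0))"
        unfolding seminorm_u_def by (rule INF_lower) simp
      also have "\<dots> \<le> ennreal (C * (U + F + \<bar>g 0\<bar> + \<gamma>))"
        using bound by (intro SUP_least) auto
      finally have le: "seminorm_u \<Omega> \<alpha> u \<le> ennreal (C * (U + F + \<bar>g 0\<bar> + \<gamma>))" .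
      then show "seminorm_u \<Omega> \<alpha> u < \<infinity>" using le_less_trans[OF le ennreal_less_top] by simp
      have "ennreal (C * (U + F + \<bar>g 0\<bar> + \<gamma>)) = ennreal C * ennreal U + ennreal C * (ennreal F + (ennreal \<bar>g 0\<bar> + ennreal \<gamma>))"
        using C2(1) U(2) F(2) \<gamma>(2)
        by (simp add: ennreal_plus[symmetric] ennreal_mult[symmetric] algebra_simps del: ennreal_plus)
      then show "seminorm_u \<Omega> \<alpha> u
          \<le> ennreal C * L2_mean \<Omega> 1 u + ennreal C * (seminorm_f \<Omega> \<alpha> f + norm_g \<Omega> \<alpha> g)"
        using le by (simp add: U(1) F(1) \<gamma>(1) norm_g_def)
    qed
  qed
  then show ?thesis using \<alpha>\<^sub>0 by blast
qed

end
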